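(* Consider the conformal class of $g=x^2dt^2+2dt\,dz+dx^2+dy^2$ on $M=\mathbb{R}^4=(t,x,y,z)$ and the solvable Lie algebra $\mathfrak{k}=\langle k_1,\dots,k_4\rangle$ of conformal Killing fields $k_1=\partial_t$, $k_2=e^{-t}(\partial_x+x\partial_z)$, $k_3=\partial_y$, $k_4=\partial_z$, with elements $(x_1,x_2,x_3,x_4)=\sum x_ik_i$. Suppose $\rho=w_1\lambda_1+w_2\lambda_2+w_3\lambda_3$ is (the highest weight of) a representation of $\mathfrak{so}(2,4)$, where $\lambda_i$ are the fundamental weights of the complexification of $\mathfrak{so}(2,4)$. Let $\mathbb{N}$ be the space of normal solutions of the corresponding first BGG operator, with the representation $\Phi|_{\mathbb{N}}$ of $\mathfrak{k}$ and projection $\pi:\mathbb{N}\to\mathbb{X}$. - If $w_2=w_3$, then $\Phi|_{\mathbb{N}}$ is obtained by branching (restricting) the representation $w_1\lambda_1$ of $\mathfrak{sl}(2,\mathbb{R})$ to $\left[\begin{smallmatrix}0&-\frac12x_1\\-x_1&0\end{smallmatrix}\right]$. - If $w_2\ne w_3$, then $\Phi|_{\mathbb{N}}$ is obtained by branching the complexification of the representation $w_1\lambda_1$ of $\mathfrak{sl}(2,\mathbb{R})$ to $\left[\begin{smallmatrix}0&-\frac12x_1\\-x_1&0\end{smallmatrix}\right]$. - In both cases the projection $\pi:\mathbb{N}\to\mathbb{X}$ is induced by the identification of $\mathbb{N}$ with the $\mathfrak{sl}(2,\mathbb{R})\oplus\mathfrak{so}(2)$-orbit (submodule generated by) of the lowest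 weight vector, where $\mathfrak{sl}(2,\mathbb{R})\oplus\mathfrak{so}(2)\subset\mathfrak{so}(2,4)$ corresponds to the diagonal in the decomposition of $\mathfrak{so}(2,4)$ into $2\times2$-blocks. In particular, there is (Es) a $2$-parameter family of Einstein scales with $\Phi(x_1,x_2,x_3,x_4)=\left[\begin{smallmatrix}0&-\frac12x_1\\-x_1&0\end{smallmatrix}\right]\in\mathfrak{gl}(2,\mathbb{R})$ and $\pi((v_1,v_2)^t)=v_2$; (ts) a $2$-parameter family of twistor spinors corresponding to the constant functions $(0,v_1+iv_2)^t$; (cKf) a $1$-parameter family of normal conformal Killing fields corresponding to constant functions valued in $\mathfrak{so}(2,4)$ with $w=v_1$ and remaining elements vanishing, where $w$ denotes the entry in row $5$, column $1$ (together with the entry in row $6$, column $2$ it determines).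
   Context: $\mathfrak{so}(2,4)$ consists of the $(1,4,1)$-block matrices $\left[\begin{smallmatrix} a&z&0\\ x&A&-\nu z^t\\ 0&-x^t\nu&-a\end{smallmatrix}\right]$ ($a\in\mathbb{R},x\in\mathbb{R}^4,z\in\mathbb{R}^{4*},A\in\mathfrak{so}(\nu)$), $\nu=\left[\begin{smallmatrix}0&0&0&1\\0&1&0&0\\0&0&1&0\\1&0&0&0\end{smallmatrix}\right]$, $\mathfrak{p}$ is the subalgebra $x=0$, and $E$ the element with $a=1$, all else zero. The diagonal is used to order roots: strictly lower triangular root spaces are negative. In terms of $2\times2$ blocks (rows $\{1,2\},\{3,4\},\{5,6\}$), the block diagonal is $\mathfrak{gl}(2,\mathbb{R})\oplus\mathfrak{so}(2)$, containing $\mathfrak{sl}(2,\mathbb{R})\oplus\mathfrak{so}(2)$. The fundamental weight $\lambda_1$ is that of the standard representation $\mathbb{R}^6$, $\lambda_2,\lambda_3$ those of the two (complex $4$-dimensional) half-spin representations; $w_i\geq0$ are integers. For $w_2=w_3$ the representation is the real irreducible one with this highest weight; for $w_2\neq w_3$ it is the complex irreducible representation viewed as a real one. The representation $w_1\lambda_1$ of $\mathfrak{sl}(2,\mathbb{R})$ is $\bigodot^{w_1}\mathbb{R}^2$. The bracket on $\mathfrak{k}$ is minus that of vector fields; $\mathfrak{k}$ acts simply transitively near the origin. The associated normal conformal extension $\alpha:\mathfrak{k}\to\mathfrak{so}(2,4)$ is $$\alpha(x_1,x_2,x_3,x_4)=\left[\begin{smallmatrix}0&\frac12x_1&0&0&0&0\\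 x_1&0&0&0&0&0\\ x_2&-x_2&0&0&0&0\\ x_3&0&0&0&0&0\\ x_4&0&x_2&0&0&-\frac12x_1\\ 0&-x_4&-x_2&-x_3&-x_1&0\end{smallmatrix}\right].$$ It encodes the normal conformal Cartan connection: tractor sections are functions $s:K\to\mathbb{V}$ on the (local) group $K$ of $\mathfrak{k}$ identified with $M$ via its orbit of the origin, with tractor connection $\nabla_Ys=\omega_K^{-1}(Y)\cdot s+\rho(\alpha(Y))s$, $Y\in\mathfrak{k}$ ($\omega_K$ the Maurer–Cartan form). The first BGG operator of $\rho:\mathfrak{so}(2,4)\to\mathfrak{gl}(\mathbb{V})$ acts on sections of the bundle with fibre $\mathbb{X}$, the lowest eigenspace of $\rho(E)$ (a quotient of $\mathbb{V}$): it is $\mathcal{D}=\pi_1\nabla\mathcal{L}_0$, with $\mathcal{L}_0$ the unique differential splitting with $\partial^*\nabla\mathcal{L}_0=0$, $\partial^*$ the Kostant codifferential and $\pi_1$ the projection to its first cohomology. A normal solution is a solution whose prolongation $\mathcal{L}_0\sigma$ is parallel for the tractor connection. $\mathbb{N}\subset\mathbb{V}$ is the space of values at the origin of (locally defined) parallel tractor sections; $\Phi|_{\mathbb{N}}=\rho\circ\alpha|_{\mathbb{N}}$ is a representation of $\mathfrak{k}$, and $v\in\mathbb{N}$ gives the solution $\exp(Y)\mapsto\pi(\exp(-\Phi(Y))v)$ with $\pi:\mathbb{N}\to\mathbb{X}$ the restriction of $\mathbb{V}\to\mathbb{X}$. Functions valued in $\mathbb{X}$ are interpreted via the $K$-invariant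 frame of $TM$ equal to $k_1,\dots,k_4$ at the origin. Einstein scales: $\mathbb{V}=\mathbb{R}^6$, $\mathbb{X}=\mathbb{R}[1]$ (almost Einstein scales are sections $\sigma$ of the density bundle $\mathcal{E}[1]$ such that $\sigma^{-2}\mathbf{g}$ is Einstein where $\sigma\ne0$, $\mathbf{g}$ being the conformal metric). Twistor spinors: $\mathbb{V}=\mathbb{C}^4$ the spin representation $\mathfrak{so}(2,4)\cong\mathfrak{su}(2,2)$, $\mathbb{X}=\mathbb{C}^2[\frac12]$ with basis of weight vectors whose second element is of lowest weight. Conformal Killing fields: $\mathbb{V}=\mathfrak{so}(2,4)$, $\mathbb{X}=\mathbb{R}^4$. *)

theory Defs
  imports "HOL-Analysis.Analysis"
begin

section \<open>The Lie algebra so(2,4)\<close>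

text \<open>Matrix entries are addressed by the numerals \<open>1, \<dots>, n\<close> of the index type \<open>n\<close>, as in
  \<^const>\<open>vector\<close>. In the index type \<open>6\<close> the numeral \<open>6\<close> equals \<open>0\<close>; hence the
  order of that type is never used and triangularity is expressed through \<^const>\<open>of_nat\<close>.\<close>

definition commutator :: "real^6^6 \<Rightarrow> real^6^6 \<Rightarrow> real^6^6" where
  "commutator X Y = X ** Y - Y ** X"

definition nu :: "real^4^4" where
  "nu = vector [vector [0, 0, 0, 1],
               vector [0, 1, 0, 0],
               vector [0, 0, 1, 0],
               vector [1, 0, 0, 0]]"

definition block :: "real \<Rightarrow> real^4 \<Rightarrow> real^4 \<Rightarrow> real^4^4 \<Rightarrow> real^6^6" where
  "block a x z A = vector
    [vector [a, z$1, z$2, z$3, z$4, 0],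
     vector [x$1, A$1$1, A$1$2, A$1$3, A$1$4, - (nu *v z)$1],
     vector [x$2, A$2$1, A$2$2, A$2$3, A$2$4, - (nu *v z)$2],
     vector [x$3, A$3$1, A$3$2, A$3$3, A$3$4, - (nu *v z)$3],
     vector [x$4, A$4$1, A$4$2, A$4$3, A$4$4, - (nu *v z)$4],
     vector [0, - (x v* nu)$1, - (x v* nu)$2, - (x v* nu)$3, - (x v* nu)$4, - a]]"

definition so_nu :: "(real^4^4) set" where
  "so_nu = {A. transpose A ** nu + nu ** A = 0}"

definition so24 :: "(real^6^6) set" where
  "so24 = {block a x z A | a x z A. A \<in> so_nu}"

definition grading_elt :: "real^6^6" where
  "grading_elt = block 1 0 0 0"

text \<open>The nilradical of the parabolic \<open>x = 0\<close> consists of the \<open>block 0 0 z 0\<close>. With respect to the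
  invariant form \<open>\<lambda>X Y. trace (X ** Y) / 2\<close> the following basis of it is dual to the basis
  \<open>block 0 (axis i 1) 0 0\<close> of \<open>so(2,4)\<close> modulo the parabolic.\<close>

definition p_plus :: "4 \<Rightarrow> real^6^6" where
  "p_plus i = block 0 0 (axis i 1) 0"

definition strictly_upper :: "real^6^6 \<Rightarrow> bool" where
  "strictly_upper X \<longleftrightarrow> (\<forall>m\<in>{1..6::nat}. \<forall>n\<in>{1..m}. X $ of_nat m $ of_nat n = 0)"

definition strictly_lower :: "real^6^6 \<Rightarrow> bool" where
  "strictly_lower X \<longleftrightarrow> (\<forall>m\<in>{1..6::nat}. \<forall>n\<in>{1..m}. X $ of_nat n $ of_nat m = 0)"

text \<open>The Cartan subalgebra contained in the block diagonal: the diagonal matrices together with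
  the \<open>so(2)\<close> in rows 3 and 4.\<close>

definition cartan :: "real \<Rightarrow> real \<Rightarrow> real \<Rightarrow> real^6^6" where
  "cartan a b c = block a 0 0 (vector [vector [b, 0, 0, 0],
                                       vector [0, 0, - c, 0],
                                       vector [0, c, 0, 0],
                                       vector [0, 0, 0, - b]])"

text \<open>The subalgebra \<open>gl(2,R) \<oplus> so(2)\<close> of \<open>2 \<times> 2\<close>-block diagonal matrices, parametrised by
  the lower right block \<open>B\<close> (which determines the upper left one) and the entry \<open>c\<close> of the
  middle block.\<close>

definition block_diagonal :: "real^2^2 \<Rightarrow> real \<Rightarrow> real^6^6" where
  "block_diagonal B c = vector
    [vector [- B$2$2, - B$1$2, 0, 0, 0, 0],
     vector [- B$2$1, - B$1$1, 0, 0, 0, 0],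
     vector [0, 0, 0, - c, 0, 0],
     vector [0, 0, c, 0, 0, 0],
     vector [0, 0, 0, 0, B$1$1, B$1$2],
     vector [0, 0, 0, 0, B$2$1, B$2$2]]"

definition sl2_so2 :: "(real^6^6) set" where
  "sl2_so2 = {block_diagonal B c | B c. trace B = 0}"

section \<open>Representations and highest weights\<close>

text \<open>Representation spaces are subspaces \<open>V\<close> of a Euclidean space (whose inner product plays no
  role). A complex representation is a real one with a commuting complex structure \<open>J\<close> on
  \<open>V\<close>.\<close>

definition so24_rep :: "'v::euclidean_space set \<Rightarrow> (real^6^6 \<Rightarrow> 'v \<Rightarrow> 'v) \<Rightarrow> bool" where
  "so24_rep V \<rho> \<longleftrightarrow> subspace V \<and>
    (\<forall>X\<in>so24. \<forall>v\<in>V. \<rho> X v \<in> V) \<and>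
    (\<forall>X\<in>so24. \<forall>u\<in>V. \<forall>v\<in>V. \<forall>a b. \<rho> X (a *\<^sub>R u + b *\<^sub>R v) = a *\<^sub>R \<rho> X u + b *\<^sub>R \<rho> X v) \<and>
    (\<forall>X\<in>so24. \<forall>Y\<in>so24. \<forall>v\<in>V. \<forall>a b. \<rho> (a *\<^sub>R X + b *\<^sub>R Y) v = a *\<^sub>R \<rho> X v + b *\<^sub>R \<rho> Y v) \<and>
    (\<forall>X\<in>so24. \<forall>Y\<in>so24. \<forall>v\<in>V. \<rho> (commutator X Y) v = \<rho> X (\<rho> Y v) - \<rho> Y (\<rho> X v))"

definition complex_structure :: "'v::euclidean_space set \<Rightarrow> ('v \<Rightarrow> 'v) \<Rightarrow> bool" where
  "complex_structure V J \<longleftrightarrow>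
    (\<forall>v\<in>V. J v \<in> V \<and> J (J v) = - v) \<and>
    (\<forall>u\<in>V. \<forall>v\<in>V. \<forall>a b. J (a *\<^sub>R u + b *\<^sub>R v) = a *\<^sub>R J u + b *\<^sub>R J v)"

definition scaleC :: "('v \<Rightarrow> 'v::real_vector) \<Rightarrow> complex \<Rightarrow> 'v \<Rightarrow> 'v" where
  "scaleC J c v = Re c *\<^sub>R v + Im c *\<^sub>R J v"

definition invariant_under :: "(real^6^6) set \<Rightarrow> (real^6^6 \<Rightarrow> 'v \<Rightarrow> 'v) \<Rightarrow> 'v set \<Rightarrow> bool" where
  "invariant_under L \<rho> W \<longleftrightarrow> (\<forall>X\<in>L. \<forall>v\<in>W. \<rho> X v \<in> W)"

definition irreducible_rep :: "'v::euclidean_space set \<Rightarrow> (real^6^6 \<Rightarrow> 'v \<Rightarrow> 'v) \<Rightarrow> bool" where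
  "irreducible_rep V \<rho> \<longleftrightarrow> V \<noteq> {0} \<and>
    (\<forall>W. subspace W \<and> W \<subseteq> V \<and> invariant_under so24 \<rho> W \<longrightarrow> W = {0} \<or> W = V)"

definition irreducible_complex_rep ::
    "'v::euclidean_space set \<Rightarrow> ('v \<Rightarrow> 'v) \<Rightarrow> (real^6^6 \<Rightarrow> 'v \<Rightarrow> 'v) \<Rightarrow> bool" where
  "irreducible_complex_rep V J \<rho> \<longleftrightarrow> V \<noteq> {0} \<and>
    (\<forall>W. subspace W \<and> W \<subseteq> V \<and> J ` W \<subseteq> W \<and> invariant_under so24 \<rho> W \<longrightarrow> W = {0} \<or> W = V)"

text \<open>The complexification of a representation on \<open>V\<close> lives on \<open>V \<times> V\<close>, with \<open>(u, v)\<close> standing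
  for \<open>u + i v\<close>.\<close>

definition complexify_J :: "'v \<times> 'v \<Rightarrow> 'v \<times> 'v::real_vector" where
  "complexify_J = (\<lambda>(u, v). (- v, u))"

definition complexify_rep :: "(real^6^6 \<Rightarrow> 'v \<Rightarrow> 'v) \<Rightarrow> real^6^6 \<Rightarrow> 'v \<times> 'v \<Rightarrow> 'v \<times> 'v" where
  "complexify_rep \<rho> X = (\<lambda>(u, v). (\<rho> X u, \<rho> X v))"

text \<open>Weights are recorded as functions of \<open>a, b, c\<close>, i.e. through their values on
  \<open>cartan a b c\<close>. A root space for a positive root is spanned over the complex numbers by
  strictly upper triangular elements of \<open>so(2,4)\<close>, so it suffices to test real ones. With
  \<open>\<epsilon>\<^sub>1 = a\<close>, \<open>\<epsilon>\<^sub>2 = b\<close>, \<open>\<epsilon>\<^sub>3 = i c\<close> the simple roots are \<open>\<epsilon>\<^sub>1 - \<epsilon>\<^sub>2\<close>,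
  \<open>\<epsilon>\<^sub>2 - \<epsilon>\<^sub>3\<close>, \<open>\<epsilon>\<^sub>2 + \<epsilon>\<^sub>3\<close>, dual to the fundamental weights
  below: the highest weights of the standard and of the two half-spin representations.\<close>

type_synonym weight = "real \<Rightarrow> real \<Rightarrow> real \<Rightarrow> complex"

definition fund_weight1 :: weight where "fund_weight1 a b c = of_real a"
definition fund_weight2 :: weight where "fund_weight2 a b c = (of_real a + of_real b - \<i> * of_real c) / 2"
definition fund_weight3 :: weight where "fund_weight3 a b c = (of_real a + of_real b + \<i> * of_real c) / 2"

definition weight_comb :: "nat \<Rightarrow> nat \<Rightarrow> nat \<Rightarrow> weight" where
  "weight_comb w1 w2 w3 a b c = of_nat w1 * fund_weight1 a b c + of_nat w2 * fund_weight2 a b c + of_nat w3 * fund_weight3 a b c"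

definition weight_vector ::
    "'v::euclidean_space set \<Rightarrow> ('v \<Rightarrow> 'v) \<Rightarrow> (real^6^6 \<Rightarrow> 'v \<Rightarrow> 'v) \<Rightarrow> weight \<Rightarrow> 'v \<Rightarrow> bool" where
  "weight_vector V J \<rho> \<Lambda> v \<longleftrightarrow> v \<in> V \<and> v \<noteq> 0 \<and>
    (\<forall>a b c. \<rho> (cartan a b c) v = scaleC J (\<Lambda> a b c) v)"

definition highest_weight_vector ::
    "'v::euclidean_space set \<Rightarrow> ('v \<Rightarrow> 'v) \<Rightarrow> (real^6^6 \<Rightarrow> 'v \<Rightarrow> 'v) \<Rightarrow> weight \<Rightarrow> 'v \<Rightarrow> bool" where
  "highest_weight_vector V J \<rho> \<Lambda> v \<longleftrightarrow> weight_vector V J \<rho> \<Lambda> v \<and>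
    (\<forall>X\<in>so24. strictly_upper X \<longrightarrow> \<rho> X v = 0)"

definition lowest_weight_vector ::
    "'v::euclidean_space set \<Rightarrow> ('v \<Rightarrow> 'v) \<Rightarrow> (real^6^6 \<Rightarrow> 'v \<Rightarrow> 'v) \<Rightarrow> 'v \<Rightarrow> bool" where
  "lowest_weight_vector V J \<rho> v \<longleftrightarrow> (\<exists>\<Lambda>. weight_vector V J \<rho> \<Lambda> v) \<and>
    (\<forall>X\<in>so24. strictly_lower X \<longrightarrow> \<rho> X v = 0)"

definition real_irrep ::
    "'v::euclidean_space set \<Rightarrow> (real^6^6 \<Rightarrow> 'v \<Rightarrow> 'v) \<Rightarrow> weight \<Rightarrow> bool" where
  "real_irrep V \<rho> \<Lambda> \<longleftrightarrow> so24_rep V \<rho> \<and> irreducible_rep V \<rho> \<and>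
    (\<exists>v. highest_weight_vector (V \<times> V) complexify_J (complexify_rep \<rho>) \<Lambda> v)"

definition complex_irrep ::
    "'v::euclidean_space set \<Rightarrow> ('v \<Rightarrow> 'v) \<Rightarrow> (real^6^6 \<Rightarrow> 'v \<Rightarrow> 'v) \<Rightarrow> weight \<Rightarrow> bool" where
  "complex_irrep V J \<rho> \<Lambda> \<longleftrightarrow> so24_rep V \<rho> \<and> complex_structure V J \<and>
    (\<forall>X\<in>so24. \<forall>v\<in>V. \<rho> X (J v) = J (\<rho> X v)) \<and>
    irreducible_complex_rep V J \<rho> \<and> (\<exists>v. highest_weight_vector V J \<rho> \<Lambda> v)"

definition submodule_generated ::
    "(real^6^6) set \<Rightarrow> (real^6^6 \<Rightarrow> 'v \<Rightarrow> 'v) \<Rightarrow> 'v::euclidean_space \<Rightarrow> 'v set" where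
  "submodule_generated L \<rho> v = (\<lambda>W. subspace W \<and> invariant_under L \<rho> W) hull {v}"

section \<open>Symmetric powers of the standard representation of sl(2)\<close>

text \<open>The \<open>w\<close>-th symmetric power of \<open>K\<^sup>2\<close> as the space of symmetric tensors
  \<open>T\<^bsup>i\<^sub>1\<dots>i\<^sub>w\<^esup>\<close>, with the derived action of matrices.\<close>

definition sym_tensors :: "nat \<Rightarrow> (2 list \<Rightarrow> 'k::field) set" where
  "sym_tensors w = {T. (\<forall>is. length is \<noteq> w \<longrightarrow> T is = 0) \<and> (\<forall>is js. mset is = mset js \<longrightarrow> T is = T js)}"

definition sym_action :: "'k::field^2^2 \<Rightarrow> (2 list \<Rightarrow> 'k) \<Rightarrow> 2 list \<Rightarrow> 'k" where
  "sym_action B T is = (\<Sum>m<length is. \<Sum>j\<in>UNIV. B $ (is ! m) $ j * T (is[m := j]))"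

definition linear_iso_sym ::
    "('k::field \<Rightarrow> 'v \<Rightarrow> 'v) \<Rightarrow> 'v::ab_group_add set \<Rightarrow> nat \<Rightarrow> ('v \<Rightarrow> 2 list \<Rightarrow> 'k) \<Rightarrow> bool" where
  "linear_iso_sym sc N w T \<longleftrightarrow> bij_betw T N (sym_tensors w) \<and>
    (\<forall>a b. \<forall>u\<in>N. \<forall>v\<in>N. sc a u + sc b v \<in> N \<and>
       T (sc a u + sc b v) = (\<lambda>is. a * T u is + b * T v is))"

definition complexify_matrix :: "real^2^2 \<Rightarrow> complex^2^2" where
  "complexify_matrix B = (\<chi> i j. of_real (B $ i $ j))"

section \<open>The metric, the Lie algebra k and the invariant frame\<close>

text \<open>Points and vectors of \<open>M\<close> have the coordinates \<open>(t, x, y, z)\<close>; elements of \<open>k\<close> have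
  the coordinates \<open>(x\<^sub>1, x\<^sub>2, x\<^sub>3, x\<^sub>4)\<close> with respect to \<open>k\<^sub>1, \<dots>, k\<^sub>4\<close>.\<close>

definition metric :: "real^4 \<Rightarrow> real^4^4" where
  "metric p = vector [vector [(p$2)\<^sup>2, 0, 0, 1],
                      vector [0, 1, 0, 0],
                      vector [0, 0, 1, 0],
                      vector [1, 0, 0, 0]]"

definition k_field :: "real^4 \<Rightarrow> real^4 \<Rightarrow> real^4" where
  "k_field X p = vector [X$1, X$2 * exp (- p$1), X$3, X$2 * exp (- p$1) * p$2 + X$4]"

definition field_bracket :: "(real^4 \<Rightarrow> real^4) \<Rightarrow> (real^4 \<Rightarrow> real^4) \<Rightarrow> real^4 \<Rightarrow> real^4" where
  "field_bracket A B p = frechet_derivative B (at p) (A p) - frechet_derivative A (at p) (B p)"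

definition k_bracket :: "real^4 \<Rightarrow> real^4 \<Rightarrow> real^4" where
  "k_bracket X Y = (THE Z. \<forall>p. k_field Z p = - field_bracket (k_field X) (k_field Y) p)"

text \<open>\<open>k_exp Y p\<close>: the element \<open>exp Y\<close> of \<open>K\<close> maps the origin to \<open>p\<close>.\<close>

definition k_exp :: "real^4 \<Rightarrow> real^4 \<Rightarrow> bool" where
  "k_exp Y p \<longleftrightarrow> (\<exists>c. c 0 = 0 \<and> c 1 = p \<and> (\<forall>t. (c has_vector_derivative k_field Y (c t)) (at t)))"

text \<open>Identifying \<open>K\<close> with \<open>M\<close> by its orbit of the origin, the fields \<open>k_field X\<close> are the
  right invariant ones and the \<open>K\<close>-invariant (i.e. left invariant) field
  \<open>\<omega>\<^sub>K\<^sup>-\<^sup>1(Y)\<close> is the following one.\<close>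

definition inv_field :: "real^4 \<Rightarrow> real^4 \<Rightarrow> real^4" where
  "inv_field Y p = vector [Y$1, Y$2 - Y$1 * p$2, Y$3, Y$4 + Y$2 * p$2 - Y$1 * (p$2)\<^sup>2]"

lemma vector_4_nth:
  "(vector [a, b, c, d] :: 'a::zero^4) $ 1 = a"
  "(vector [a, b, c, d] :: 'a::zero^4) $ 2 = b"
  "(vector [a, b, c, d] :: 'a::zero^4) $ 3 = c"
  "(vector [a, b, c, d] :: 'a::zero^4) $ 4 = d"
  by (simp_all add: vector_def)

lemma has_derivative_vector_4:
  fixes f1 f2 f3 f4 :: "real^4 \<Rightarrow> real"
  assumes "(f1 has_derivative f1') F" "(f2 has_derivative f2') F"
    "(f3 has_derivative f3') F" "(f4 has_derivative f4') F"
  shows "((\<lambda>p. vector [f1 p, f2 p, f3 p, f4 p] :: real^4)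
    has_derivative (\<lambda>h. vector [f1' h, f2' h, f3' h, f4' h])) F"
proof -
  have eq: "(vector [a, b, c, d] :: real^4)
      = a *\<^sub>R axis 1 1 + b *\<^sub>R axis 2 1 + c *\<^sub>R axis 3 1 + d *\<^sub>R axis 4 1" for a b c d :: real
    by (simp add: vec_eq_iff forall_4 axis_def vector_4_nth)
  show ?thesis
    unfolding eq by (intro has_derivative_add has_derivative_scaleR_left assms)
qed

lemma has_derivative_k_field:
  "(k_field X has_derivative (\<lambda>h. vector [0, - X$2 * exp (- p$1) * h$1, 0,
     X$2 * exp (- p$1) * (h$2 - p$2 * h$1)])) (at p)"
  unfolding k_field_def
  by (rule has_derivative_vector_4)
    (auto intro!: derivative_eq_intros bounded_linear.has_derivative[OF bounded_linear_vec_nth]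
      simp: algebra_simps)

lemma has_derivative_inv_field:
  "(inv_field Y has_derivative (\<lambda>h. vector [0, - Y$1 * h$2, 0, (Y$2 - 2 * Y$1 * p$2) * h$2])) (at p)"
  unfolding inv_field_def
  by (rule has_derivative_vector_4)
    (auto intro!: derivative_eq_intros bounded_linear.has_derivative[OF bounded_linear_vec_nth]
      simp: algebra_simps)

lemma inv_field_invariant:
  "inv_field Y 0 = k_field Y 0"
  "field_bracket (k_field X) (inv_field Y) p = 0"
proof -
  show "inv_field Y 0 = k_field Y 0"
    by (simp add: inv_field_def k_field_def)
  show "field_bracket (k_field X) (inv_field Y) p = 0"
    unfolding field_bracket_def
      frechet_derivative_at[OF has_derivative_k_field, symmetric]
      frechet_derivative_at[OF has_derivative_inv_field, symmetric]
    by (simp add: k_field_def inv_field_def vec_eq_iff forall_4 vector_4_nth algebra_simps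
      power2_eq_square)
qed

definition alpha :: "real^4 \<Rightarrow> real^6^6" where
  "alpha X = vector
    [vector [0, X$1 / 2, 0, 0, 0, 0],
     vector [X$1, 0, 0, 0, 0, 0],
     vector [X$2, - X$2, 0, 0, 0, 0],
     vector [X$3, 0, 0, 0, 0, 0],
     vector [X$4, 0, X$2, 0, 0, - X$1 / 2],
     vector [0, - X$4, - X$2, - X$3, - X$1, 0]]"

definition branch_matrix :: "real^4 \<Rightarrow> real^2^2" where
  "branch_matrix X = vector [vector [0, - X$1 / 2],
                             vector [- X$1, 0]]"

section \<open>Tractor connection, BGG operators and normal solutions\<close>

primrec Ck_on :: "nat \<Rightarrow> (real^4) set \<Rightarrow> (real^4 \<Rightarrow> 'v::real_normed_vector) \<Rightarrow> bool" where
  "Ck_on 0 U f \<longleftrightarrow> continuous_on U f"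
| "Ck_on (Suc k) U f \<longleftrightarrow> f differentiable_on U \<and>
     (\<forall>i. Ck_on k U (\<lambda>p. frechet_derivative f (at p) (axis i 1)))"

definition smooth_on :: "(real^4) set \<Rightarrow> (real^4 \<Rightarrow> 'v::real_normed_vector) \<Rightarrow> bool" where
  "smooth_on U f \<longleftrightarrow> (\<forall>k. Ck_on k U f)"

definition tractor_connection ::
    "(real^6^6 \<Rightarrow> 'v \<Rightarrow> 'v) \<Rightarrow> (real^4 \<Rightarrow> 'v::euclidean_space) \<Rightarrow> real^4 \<Rightarrow> real^4 \<Rightarrow> 'v" where
  "tractor_connection \<rho> s Y p = frechet_derivative s (at p) (inv_field Y p) + \<rho> (alpha Y) (s p)"

definition tractor_section :: "'v::euclidean_space set \<Rightarrow> (real^4) set \<Rightarrow> (real^4 \<Rightarrow> 'v) \<Rightarrow> bool" where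
  "tractor_section V U s \<longleftrightarrow> smooth_on U s \<and> s ` U \<subseteq> V"

definition parallel_section ::
    "'v::euclidean_space set \<Rightarrow> (real^6^6 \<Rightarrow> 'v \<Rightarrow> 'v) \<Rightarrow> (real^4) set \<Rightarrow> (real^4 \<Rightarrow> 'v) \<Rightarrow> bool" where
  "parallel_section V \<rho> U s \<longleftrightarrow> tractor_section V U s \<and>
    (\<forall>p\<in>U. \<forall>Y. tractor_connection \<rho> s Y p = 0)"

text \<open>The quotient \<open>V \<rightarrow> X\<close> is realised as the projection onto the lowest eigenspace of the
  grading element along the sum of the other eigenspaces.\<close>

definition lowest_eigenvalue :: "'v::euclidean_space set \<Rightarrow> (real^6^6 \<Rightarrow> 'v \<Rightarrow> 'v) \<Rightarrow> real" where
  "lowest_eigenvalue V \<rho> = Min {r. \<exists>v\<in>V. v \<noteq> 0 \<and> \<rho> grading_elt v = r *\<^sub>R v}"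

definition lowest_eigenspace :: "'v::euclidean_space set \<Rightarrow> (real^6^6 \<Rightarrow> 'v \<Rightarrow> 'v) \<Rightarrow> 'v set" where
  "lowest_eigenspace V \<rho> = {v\<in>V. \<rho> grading_elt v = lowest_eigenvalue V \<rho> *\<^sub>R v}"

definition lowest_proj :: "'v::euclidean_space set \<Rightarrow> (real^6^6 \<Rightarrow> 'v \<Rightarrow> 'v) \<Rightarrow> 'v \<Rightarrow> 'v" where
  "lowest_proj V \<rho> v = (THE u. u \<in> lowest_eigenspace V \<rho> \<and>
     v - u \<in> span {x\<in>V. \<exists>r > lowest_eigenvalue V \<rho>. \<rho> grading_elt x = r *\<^sub>R x})"

text \<open>In the invariant frame \<open>V\<close>-valued forms are given by their components \<open>\<phi>\<^sub>i\<close>,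
  \<open>\<psi>\<^sub>i\<^sub>j = - \<psi>\<^sub>j\<^sub>i\<close>. Identifying the dual of \<open>so(2,4)\<close> modulo the parabolic with the
  span of the \<open>p_plus i\<close>, these are \<open>p_plus i \<otimes> \<phi>\<^sub>i\<close> and
  \<open>(p_plus i \<and> p_plus j) \<otimes> \<psi>\<^sub>i\<^sub>j / 2\<close> (summed), and the Kostant codifferential, i.e. the
  Lie algebra homology differential of the abelian nilradical, takes the following form.\<close>

definition codiff1 :: "(real^6^6 \<Rightarrow> 'v \<Rightarrow> 'v) \<Rightarrow> (4 \<Rightarrow> 'v::euclidean_space) \<Rightarrow> 'v" where
  "codiff1 \<rho> \<phi> = - (\<Sum>i\<in>UNIV. \<rho> (p_plus i) (\<phi> i))"

definition codiff2 :: "(real^6^6 \<Rightarrow> 'v \<Rightarrow> 'v) \<Rightarrow> (4 \<Rightarrow> 4 \<Rightarrow> 'v::euclidean_space) \<Rightarrow> 4 \<Rightarrow> 'v" where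
  "codiff2 \<rho> \<psi> j = - (\<Sum>i\<in>UNIV. \<rho> (p_plus i) (\<psi> i j))"

definition tractor_derivative ::
    "(real^6^6 \<Rightarrow> 'v \<Rightarrow> 'v) \<Rightarrow> (real^4 \<Rightarrow> 'v::euclidean_space) \<Rightarrow> real^4 \<Rightarrow> 4 \<Rightarrow> 'v" where
  "tractor_derivative \<rho> s p i = tractor_connection \<rho> s (axis i 1) p"

text \<open>\<open>s\<close> is the image of \<open>\<sigma>\<close> under the splitting operator.\<close>

definition bgg_splitting ::
    "'v::euclidean_space set \<Rightarrow> (real^6^6 \<Rightarrow> 'v \<Rightarrow> 'v) \<Rightarrow> (real^4) set \<Rightarrow>
      (real^4 \<Rightarrow> 'v) \<Rightarrow> (real^4 \<Rightarrow> 'v) \<Rightarrow> bool" where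
  "bgg_splitting V \<rho> U \<sigma> s \<longleftrightarrow> tractor_section V U s \<and>
    (\<forall>p\<in>U. lowest_proj V \<rho> (s p) = \<sigma> p \<and> codiff1 \<rho> (tractor_derivative \<rho> s p) = 0)"

text \<open>The value of the BGG operator is the class of the derivative of the prolongation in
  \<open>ker \<partial>\<^sup>* / im \<partial>\<^sup>*\<close>.\<close>

definition bgg_solution ::
    "'v::euclidean_space set \<Rightarrow> (real^6^6 \<Rightarrow> 'v \<Rightarrow> 'v) \<Rightarrow> (real^4) set \<Rightarrow> (real^4 \<Rightarrow> 'v) \<Rightarrow> bool" where
  "bgg_solution V \<rho> U \<sigma> \<longleftrightarrow> (\<exists>s. bgg_splitting V \<rho> U \<sigma> s \<and>
    (\<forall>p\<in>U. tractor_derivative \<rho> s p \<in>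
       codiff2 \<rho> ` {\<psi>. \<forall>i j. \<psi> i j \<in> V \<and> \<psi> i j = - \<psi> j i}))"

definition normal_solution ::
    "'v::euclidean_space set \<Rightarrow> (real^6^6 \<Rightarrow> 'v \<Rightarrow> 'v) \<Rightarrow> (real^4) set \<Rightarrow> (real^4 \<Rightarrow> 'v) \<Rightarrow> bool" where
  "normal_solution V \<rho> U \<sigma> \<longleftrightarrow> bgg_solution V \<rho> U \<sigma> \<and>
    (\<exists>s. bgg_splitting V \<rho> U \<sigma> s \<and> parallel_section V \<rho> U s)"

definition normal_values :: "'v::euclidean_space set \<Rightarrow> (real^6^6 \<Rightarrow> 'v \<Rightarrow> 'v) \<Rightarrow> 'v set" where
  "normal_values V \<rho> = {s 0 | s U. open U \<and> 0 \<in> U \<and> parallel_section V \<rho> U s}"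

definition Phi :: "(real^6^6 \<Rightarrow> 'v \<Rightarrow> 'v) \<Rightarrow> real^4 \<Rightarrow> 'v \<Rightarrow> 'v" where
  "Phi \<rho> X v = \<rho> (alpha X) v"

definition k_rep :: "'v::euclidean_space set \<Rightarrow> (real^4 \<Rightarrow> 'v \<Rightarrow> 'v) \<Rightarrow> bool" where
  "k_rep N F \<longleftrightarrow> subspace N \<and>
    (\<forall>X. \<forall>v\<in>N. F X v \<in> N) \<and>
    (\<forall>X. \<forall>u\<in>N. \<forall>v\<in>N. \<forall>a b. F X (a *\<^sub>R u + b *\<^sub>R v) = a *\<^sub>R F X u + b *\<^sub>R F X v) \<and>
    (\<forall>X Y. \<forall>v\<in>N. \<forall>a b. F (a *\<^sub>R X + b *\<^sub>R Y) v = a *\<^sub>R F X v + b *\<^sub>R F Y v) \<and>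
    (\<forall>X Y. \<forall>v\<in>N. F (k_bracket X Y) v = F X (F Y v) - F Y (F X v))"

definition exp_op :: "('v \<Rightarrow> 'v) \<Rightarrow> 'v \<Rightarrow> 'v::euclidean_space" where
  "exp_op A v = (\<Sum>n. (A ^^ n) v /\<^sub>R fact n)"

text \<open>\<open>\<sigma>\<close> is the solution \<open>exp Y \<mapsto> \<pi> (exp (- Phi Y) v)\<close> on \<open>U\<close>.\<close>

definition solution_of ::
    "'v::euclidean_space set \<Rightarrow> (real^6^6 \<Rightarrow> 'v \<Rightarrow> 'v) \<Rightarrow> (real^4) set \<Rightarrow> 'v \<Rightarrow> (real^4 \<Rightarrow> 'v) \<Rightarrow> bool" where
  "solution_of V \<rho> U v \<sigma> \<longleftrightarrow> (\<forall>Y p. k_exp Y p \<and> p \<in> U \<longrightarrow>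
     \<sigma> p = lowest_proj V \<rho> (exp_op (\<lambda>u. - Phi \<rho> Y u) v))"

definition neighbourhood :: "(real^4) set \<Rightarrow> bool" where
  "neighbourhood U \<longleftrightarrow> open U \<and> connected U \<and> 0 \<in> U"

text \<open>The elements of \<open>N\<close> are exactly the normal solutions, via the projection \<open>\<pi>\<close>.\<close>

definition parametrises_normal_solutions ::
    "'v::euclidean_space set \<Rightarrow> (real^6^6 \<Rightarrow> 'v \<Rightarrow> 'v) \<Rightarrow> 'v set \<Rightarrow> bool" where
  "parametrises_normal_solutions V \<rho> N \<longleftrightarrow>
    (\<forall>U \<sigma>. neighbourhood U \<longrightarrow>
       (normal_solution V \<rho> U \<sigma> \<longleftrightarrow> (\<exists>!v. v \<in> N \<and> solution_of V \<rho> U v \<sigma>)))"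

section \<open>The three special cases\<close>

definition std_rep :: "real^6^6 \<Rightarrow> real^6 \<Rightarrow> real^6" where
  "std_rep X v = X *v v"

definition partial :: "4 \<Rightarrow> (real^4 \<Rightarrow> real) \<Rightarrow> real^4 \<Rightarrow> real" where
  "partial i f p = frechet_derivative f (at p) (axis i 1)"

definition christoffel :: "(real^4 \<Rightarrow> real^4^4) \<Rightarrow> 4 \<Rightarrow> 4 \<Rightarrow> 4 \<Rightarrow> real^4 \<Rightarrow> real" where
  "christoffel h k i j p = (\<Sum>l\<in>UNIV. matrix_inv (h p) $ k $ l *
     (partial i (\<lambda>q. h q $ j $ l) p + partial j (\<lambda>q. h q $ i $ l) p - partial l (\<lambda>q. h q $ i $ j) p)) / 2"

definition ricci :: "(real^4 \<Rightarrow> real^4^4) \<Rightarrow> real^4 \<Rightarrow> real^4^4" where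
  "ricci h p = (\<chi> i j. (\<Sum>k\<in>UNIV. partial k (christoffel h k i j) p - partial j (christoffel h k i k) p
     + (\<Sum>l\<in>UNIV. christoffel h k k l p * christoffel h l i j p
                - christoffel h k j l p * christoffel h l i k p)))"

definition einstein_on :: "(real^4) set \<Rightarrow> (real^4 \<Rightarrow> real^4^4) \<Rightarrow> bool" where
  "einstein_on W h \<longleftrightarrow> (\<exists>c. \<forall>p\<in>W. ricci h p = c *\<^sub>R h p)"

text \<open>Densities of weight 1 are identified with functions by means of the \<open>K\<close>-invariant metric
  \<^const>\<open>metric\<close> in the conformal class.\<close>

definition almost_einstein_scale :: "(real^4) set \<Rightarrow> (real^4 \<Rightarrow> real) \<Rightarrow> bool" where
  "almost_einstein_scale U f \<longleftrightarrow> smooth_on U f \<and>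
    einstein_on {p\<in>U. f p \<noteq> 0} (\<lambda>p. (1 / (f p)\<^sup>2) *\<^sub>R metric p)"

text \<open>Clifford multiplications between the half-spinors and the opposite half-spinors: for
  \<open>q v = 2 v\<^sub>1 v\<^sub>6 + 2 v\<^sub>2 v\<^sub>5 + v\<^sub>3\<^sup>2 + v\<^sub>4\<^sup>2\<close>, the quadratic form preserved by
  \<open>so(2,4)\<close>, one has \<open>clifford v ** clifford' v = q v *\<^sub>R mat 1\<close>. The endomorphism \<open>X\<close> acts on spinors by
  a quarter of the sum of the Clifford products of \<open>X e\<^sub>i\<close> with the dual basis vector \<open>e\<^sup>i\<close>.\<close>

definition clifford :: "real^6 \<Rightarrow> complex^4^4" where
  "clifford v = vector
    [vector [0, of_real (2 * v$1), of_real (2 * v$2), Complex (v$3) (v$4)],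
     vector [of_real (- 2 * v$1), 0, Complex (v$3) (- v$4), of_real (- v$5)],
     vector [of_real (- 2 * v$2), Complex (- v$3) (v$4), 0, of_real (v$6)],
     vector [Complex (- v$3) (- v$4), of_real (v$5), of_real (- v$6), 0]]"

definition clifford' :: "real^6 \<Rightarrow> complex^4^4" where
  "clifford' v = vector
    [vector [0, of_real (- v$6), of_real (- v$5), Complex (- v$3) (v$4)],
     vector [of_real (v$6), 0, Complex (- v$3) (- v$4), of_real (2 * v$2)],
     vector [of_real (v$5), Complex (v$3) (v$4), 0, of_real (- 2 * v$1)],
     vector [Complex (v$3) (- v$4), of_real (- 2 * v$2), of_real (2 * v$1), 0]]"

definition dual_basis :: "6 \<Rightarrow> real^6" where
  "dual_basis i = vector [axis 6 1, axis 5 1, axis 3 1, axis 4 1, axis 2 1, axis 1 1 :: real^6] $ i"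

definition spin_rep :: "real^6^6 \<Rightarrow> complex^4 \<Rightarrow> complex^4" where
  "spin_rep X \<psi> = ((1 / 4) *\<^sub>R (\<Sum>i\<in>UNIV. clifford (X *v axis i 1) ** clifford' (dual_basis i))) *v \<psi>"

lemma vector_6_nth:
  "(vector [a, b, c, d, e, f] :: 'a::zero^6) $ 1 = a"
  "(vector [a, b, c, d, e, f] :: 'a::zero^6) $ 2 = b"
  "(vector [a, b, c, d, e, f] :: 'a::zero^6) $ 3 = c"
  "(vector [a, b, c, d, e, f] :: 'a::zero^6) $ 4 = d"
  "(vector [a, b, c, d, e, f] :: 'a::zero^6) $ 5 = e"
  "(vector [a, b, c, d, e, f] :: 'a::zero^6) $ 6 = f"
  by (simp_all add: vector_def)

lemma UNIV_6: "(UNIV :: 6 set) = {1, 2, 3, 4, 5, 6}"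
proof -
  have "card {1, 2, 3, 4, 5, 6 :: 6} = CARD(6)"
    by simp
  then show ?thesis
    by (metis card_subset_eq finite_class.finite_UNIV subset_UNIV)
qed

lemma sum_6: "sum f (UNIV :: 6 set) = f 1 + f 2 + f 3 + f 4 + f 5 + f 6"
  for f :: "6 \<Rightarrow> 'a::comm_monoid_add"
  unfolding UNIV_6 by (simp add: ac_simps)

lemma forall_6: "(\<forall>i::6. P i) \<longleftrightarrow> P 1 \<and> P 2 \<and> P 3 \<and> P 4 \<and> P 5 \<and> P 6"
proof -
  have "(\<forall>i::6. P i) \<longleftrightarrow> (\<forall>i\<in>UNIV. P i)" by simp
  then show ?thesis unfolding UNIV_6 by simp
qed

lemma strictly_upperD:
  assumes "strictly_upper X"
  shows "X$1$1 = 0" "X$2$1 = 0" "X$2$2 = 0" "X$3$1 = 0" "X$3$2 = 0" "X$3$3 = 0"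
    "X$4$1 = 0" "X$4$2 = 0" "X$4$3 = 0" "X$4$4 = 0"
    "X$5$1 = 0" "X$5$2 = 0" "X$5$3 = 0" "X$5$4 = 0" "X$5$5 = 0"
    "X$6$1 = 0" "X$6$2 = 0" "X$6$3 = 0" "X$6$4 = 0" "X$6$5 = 0" "X$6$6 = 0"
proof -
  have *: "X $ of_nat m $ of_nat n = 0" if "m \<in> {1..6}" "n \<in> {1..m}" for m n :: nat
    using assms that unfolding strictly_upper_def by blast
  show "X$1$1 = 0" "X$2$1 = 0" "X$2$2 = 0" "X$3$1 = 0" "X$3$2 = 0" "X$3$3 = 0"
    "X$4$1 = 0" "X$4$2 = 0" "X$4$3 = 0" "X$4$4 = 0"
    "X$5$1 = 0" "X$5$2 = 0" "X$5$3 = 0" "X$5$4 = 0" "X$5$5 = 0"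
    "X$6$1 = 0" "X$6$2 = 0" "X$6$3 = 0" "X$6$4 = 0" "X$6$5 = 0" "X$6$6 = 0"
    using *[of 1 1] *[of 2 1] *[of 2 2] *[of 3 1] *[of 3 2] *[of 3 3]
      *[of 4 1] *[of 4 2] *[of 4 3] *[of 4 4]
      *[of 5 1] *[of 5 2] *[of 5 3] *[of 5 4] *[of 5 5]
      *[of 6 1] *[of 6 2] *[of 6 3] *[of 6 4] *[of 6 5] *[of 6 6]
    by simp_all
qed

text \<open>The standard representation has highest weight \<^const>\<open>fund_weight1\<close>, and the spin
  representation and its complex conjugate have the highest weights \<^const>\<open>fund_weight3\<close> and
  \<^const>\<open>fund_weight2\<close>.\<close>

lemma highest_weight_std_rep:
  "highest_weight_vector (UNIV \<times> UNIV) complexify_J (complexify_rep std_rep) fund_weight1 (axis 1 1, 0)"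
  unfolding highest_weight_vector_def weight_vector_def
  by (simp add: complexify_J_def complexify_rep_def std_rep_def scaleC_def fund_weight1_def
      cartan_def block_def vec_eq_iff forall_6 matrix_vector_mult_def sum_6 axis_def vector_6_nth
      vector_4_nth nu_def vector_matrix_mult_def sum_4 strictly_upperD zero_prod_def)

lemma so24_skew_34:
  assumes "X \<in> so24"
  shows "X$3$4 = - X$4$3"
proof -
  obtain a x z A where X: "X = block a x z A" and A: "A \<in> so_nu"
    using assms unfolding so24_def by blast
  have "(transpose A ** nu + nu ** A) $ 2 $ 3 = 0"
    using A by (simp add: so_nu_def)
  then have "A$2$3 = - A$3$2"
    by (simp add: transpose_def matrix_matrix_mult_def sum_4 nu_def vector_4_nth)
  then show ?thesis
    by (simp add: X block_def vector_6_nth)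
qed

lemma spin_rep_axis_1:
  "spin_rep X (axis 1 1) = (1 / 4) *\<^sub>R (\<Sum>i\<in>UNIV. clifford (X *v axis i 1) *v column 1 (clifford' (dual_basis i)))"
proof -
  have "(M ** N) *v axis 1 1 = M *v column 1 N" for M N :: "complex^4^4"
    by (simp add: vec_eq_iff forall_4 matrix_vector_mult_def matrix_matrix_mult_def column_def sum_4 axis_def)
  moreover have "(r *\<^sub>R M) *v v = r *\<^sub>R (M *v v)" for r and M :: "complex^4^4" and v
    by (simp add: vec_eq_iff matrix_vector_mult_def scaleR_right.sum sum_4 scaleR_add_right)
  ultimately show ?thesis
    unfolding spin_rep_def by (simp add: sum_6 matrix_vector_mult_add_rdistrib)
qed

lemma highest_weight_spin_rep:
  "highest_weight_vector UNIV (\<lambda>\<psi>. \<i> *s \<psi>) spin_rep fund_weight3 (axis 1 1)"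
  "highest_weight_vector UNIV (\<lambda>\<psi>. - (\<i> *s \<psi>)) spin_rep fund_weight2 (axis 1 1)"
proof -
  note defs = sum_6 sum_4 forall_4 vec_eq_iff matrix_vector_mult_def column_def axis_def
    clifford_def clifford'_def dual_basis_def vector_6_nth vector_4_nth scaleC_def complex_eq_iff
  have "spin_rep X (axis 1 1) = 0" if "X \<in> so24" "strictly_upper X" for X
    using so24_skew_34[OF that(1)] unfolding spin_rep_axis_1
    by (simp add: defs strictly_upperD[OF that(2)])
  moreover have "spin_rep (cartan a b c) (axis 1 1)
      = scaleC (\<lambda>\<psi>. \<i> *s \<psi>) (fund_weight3 a b c) (axis 1 1)"
    "spin_rep (cartan a b c) (axis 1 1)
      = scaleC (\<lambda>\<psi>. - (\<i> *s \<psi>)) (fund_weight2 a b c) (axis 1 1)" for a b c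
    unfolding spin_rep_axis_1
    by (simp_all add: defs cartan_def block_def nu_def vector_matrix_mult_def fund_weight2_def
        fund_weight3_def field_simps)
  ultimately show "highest_weight_vector UNIV (\<lambda>\<psi>. \<i> *s \<psi>) spin_rep fund_weight3 (axis 1 1)"
    "highest_weight_vector UNIV (\<lambda>\<psi>. - (\<i> *s \<psi>)) spin_rep fund_weight2 (axis 1 1)"
    unfolding highest_weight_vector_def weight_vector_def by (simp_all add: axis_eq_0_iff)
qed

definition conformal_killing_on :: "(real^4) set \<Rightarrow> (real^4 \<Rightarrow> real^4) \<Rightarrow> bool" where
  "conformal_killing_on U A \<longleftrightarrow> smooth_on U A \<and>
    (\<exists>f. \<forall>p\<in>U. \<forall>i j. (\<Sum>k\<in>UNIV. A p $ k * partial k (\<lambda>q. metric q $ i $ j) p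
       + metric p $ k $ j * partial i (\<lambda>q. A q $ k) p
       + metric p $ i $ k * partial j (\<lambda>q. A q $ k) p) = f p * metric p $ i $ j)"

text \<open>The class of \<open>Z\<close> modulo the parabolic, an element of \<open>R\<^sup>4\<close>, as a tangent vector at \<open>p\<close>.\<close>

definition tangent_of :: "real^6^6 \<Rightarrow> real^4 \<Rightarrow> real^4" where
  "tangent_of Z p = inv_field (vector [Z$2$1, Z$3$1, Z$4$1, Z$5$1]) p"

end

theory Submission
  imports Defs
begin

text \<open>The curvature of the tractor connection and its derivatives generate the nilradical of the
  lower triangular \<open>2 \<times> 2\<close>-block matrices. Hence the values of a parallel section are annihilated by
  this nilradical, on whose annihilator \<open>\<alpha>\<close> acts through the block diagonal matrix given by
  \<open>x\<^sub>1\<close> alone, so that every element of the annihilator extends to the parallel section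
  \<open>p \<mapsto> exp (- p\<^sub>1 A) v\<close>. In an irreducible representation the annihilator is the lowest eigenspace of
  \<open>cartan 1 1 0\<close>. The elements of degree 2 and -2 of the block grading form an \<open>sl(2)\<close>-triple with
  \<open>cartan 1 1 0\<close>, which commutes with \<open>sl(2) \<oplus> so(2)\<close> in the block diagonal; its strings identify the
  lowest with the highest eigenspace, and the latter is the irreducible module of highest weight
  \<open>w\<^sub>1\<close> generated by a highest weight vector.\<close>

section \<open>The block grading of so(2,4)\<close>

text \<open>That the annihilator is no larger than the expected eigenspace rests on irreducibility
  alone. The least scalar-closed subspace that is stable under \<open>g_pos\<close> and contains a
  nonzero scalar-closed module \<open>S\<close> of the block diagonal part inside the annihilator is
  already stable under all of \<open>so24\<close>, hence equal to \<open>V\<close>. Varying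
  \<open>S\<close> and the subspace that contains it gives both the splitting of \<open>V\<close>
  for \<open>h\<close> and the lower bound for the eigenvalues of \<open>grading_elt\<close>. All
  sl(2)-strings run over the reals, because the highest weight is real on
  \<open>cartan a b 0\<close>. Only so(2) sees \<open>w2 - w3\<close>; if this difference is not
  zero, so(2) acts on the annihilator by a nonzero imaginary scalar, and real submodules become
  complex ones. The projection keeps one of \<open>w1 + 1\<close> coefficients, so the value of a
  solution at the origin does not in general determine its vector. The others are recovered by
  differentiating along the first coordinate. An operator \<open>\<rho> X\<close> is linear on
  \<open>V\<close> only, while derivatives and exponential series are formed in the ambient space.
  This is why linear extensions recur.\<close>

text \<open>The parts of \<open>so(2,4)\<close> below, on and above the \<open>2 \<times> 2\<close>-block diagonal; the arguments \<open>w\<close> are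
  the components of degree -2 and 2 with respect to \<open>cartan 1 1 0\<close>.\<close>

definition g_neg :: "real \<Rightarrow> real \<Rightarrow> real \<Rightarrow> real \<Rightarrow> real \<Rightarrow> real^6^6" where
  "g_neg p q r s w = vector
    [vector [0, 0, 0, 0, 0, 0],
     vector [0, 0, 0, 0, 0, 0],
     vector [p, r, 0, 0, 0, 0],
     vector [q, s, 0, 0, 0, 0],
     vector [w, 0, - r, - s, 0, 0],
     vector [0, - w, - p, - q, 0, 0]]"

definition g_zero :: "real \<Rightarrow> real \<Rightarrow> real \<Rightarrow> real \<Rightarrow> real \<Rightarrow> real^6^6" where
  "g_zero a b c x z = vector
    [vector [a, z, 0, 0, 0, 0],
     vector [x, b, 0, 0, 0, 0],
     vector [0, 0, 0, - c, 0, 0],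
     vector [0, 0, c, 0, 0, 0],
     vector [0, 0, 0, 0, - b, - z],
     vector [0, 0, 0, 0, - x, - a]]"

definition g_pos :: "real \<Rightarrow> real \<Rightarrow> real \<Rightarrow> real \<Rightarrow> real \<Rightarrow> real^6^6" where
  "g_pos p q r s w = vector
    [vector [0, 0, p, q, w, 0],
     vector [0, 0, r, s, 0, - w],
     vector [0, 0, 0, 0, - r, - p],
     vector [0, 0, 0, 0, - s, - q],
     vector [0, 0, 0, 0, 0, 0],
     vector [0, 0, 0, 0, 0, 0]]"

lemmas matrix6_simps = vec_eq_iff forall_6 vector_6_nth

lemma so24_iff:
  "X \<in> so24 \<longleftrightarrow> (\<exists>p q r s w a b c x z p' q' r' s' w'.
     X = g_neg p q r s w + g_zero a b c x z + g_pos p' q' r' s' w')" (is "_ \<longleftrightarrow> ?R")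
proof
  assume "X \<in> so24"
  then obtain a x z A where X: "X = block a x z A" and A: "A \<in> so_nu"
    unfolding so24_def by blast
  have "A$4$1 = 0" "A$1$4 = 0" "A$4$2 = - A$2$1" "A$4$3 = - A$3$1" "A$4$4 = - A$1$1" "A$2$2 = 0"
    "A$2$3 = - A$3$2" "A$2$4 = - A$1$2" "A$3$3 = 0" "A$3$4 = - A$1$3"
    using A by (auto simp: so_nu_def nu_def vec_eq_iff forall_4 transpose_def matrix_matrix_mult_def
        sum_4 vector_4_nth)
  then have "X = g_neg (x$2) (x$3) (A$2$1) (A$3$1) (x$4)
      + g_zero a (A$1$1) (A$3$2) (x$1) (z$1)
      + g_pos (z$2) (z$3) (A$1$2) (A$1$3) (z$4)"
    by (simp add: X block_def g_neg_def g_zero_def g_pos_def matrix6_simps nu_def vector_4_nth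
        matrix_vector_mult_def vector_matrix_mult_def sum_4)
  then show ?R by blast
next
  assume ?R
  then obtain p q r s w a b c x z p' q' r' s' w' where
    X: "X = g_neg p q r s w + g_zero a b c x z + g_pos p' q' r' s' w'" by blast
  have "X = block a (vector [x, p, q, w]) (vector [z, p', q', w'])
     (vector [vector [b, r', s', 0], vector [r, 0, - c, - r'], vector [s, c, 0, - s'], vector [0, - r, - s, - b]])"
    by (simp add: X block_def g_neg_def g_zero_def g_pos_def matrix6_simps nu_def vector_4_nth
        matrix_vector_mult_def vector_matrix_mult_def sum_4)
  moreover have "vector [vector [b, r', s', 0], vector [r, 0, - c, - r'], vector [s, c, 0, - s'], vector [0, - r, - s, - b]] \<in> so_nu"
    by (simp add: so_nu_def nu_def vec_eq_iff forall_4 transpose_def matrix_matrix_mult_def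
        sum_4 vector_4_nth)
  ultimately show "X \<in> so24" unfolding so24_def by blast
qed

lemma g_sums_zero [simp]:
  "g_neg 0 0 0 0 0 = 0" "g_zero 0 0 0 0 0 = 0" "g_pos 0 0 0 0 0 = 0"
  by (simp_all add: g_neg_def g_zero_def g_pos_def matrix6_simps)

lemma g_in_so24 [simp]:
  "g_neg p q r s w \<in> so24" "g_zero a b c x z \<in> so24" "g_pos p q r s w \<in> so24"
  unfolding so24_iff by (metis add.left_neutral add.right_neutral g_sums_zero)+

lemma so24_cases:
  assumes "X \<in> so24"
  obtains p q r s w a b c x z p' q' r' s' w' where
    "X = g_neg p q r s w + g_zero a b c x z + g_pos p' q' r' s' w'"
  using assms unfolding so24_iff by blast

lemma g_add:
  "g_neg p q r s w + g_neg p' q' r' s' w' = g_neg (p + p') (q + q') (r + r') (s + s') (w + w')"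
  "g_zero a b c x z + g_zero a' b' c' x' z' = g_zero (a + a') (b + b') (c + c') (x + x') (z + z')"
  "g_pos p q r s w + g_pos p' q' r' s' w' = g_pos (p + p') (q + q') (r + r') (s + s') (w + w')"
  by (simp_all add: g_neg_def g_zero_def g_pos_def matrix6_simps)

lemma g_scaleR:
  "k *\<^sub>R g_neg p q r s w = g_neg (k * p) (k * q) (k * r) (k * s) (k * w)"
  "k *\<^sub>R g_zero a b c x z = g_zero (k * a) (k * b) (k * c) (k * x) (k * z)"
  "k *\<^sub>R g_pos p q r s w = g_pos (k * p) (k * q) (k * r) (k * s) (k * w)"
  by (simp_all add: g_neg_def g_zero_def g_pos_def matrix6_simps)

lemma so24_lincomb:
  assumes "X \<in> so24" "Y \<in> so24"
  shows "a *\<^sub>R X + b *\<^sub>R Y \<in> so24"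
proof -
  have *: "a *\<^sub>R (N + Z + P) + b *\<^sub>R (N' + Z' + P')
    = (a *\<^sub>R N + b *\<^sub>R N') + (a *\<^sub>R Z + b *\<^sub>R Z') + (a *\<^sub>R P + b *\<^sub>R P')"
    for N Z P N' Z' P' :: "real^6^6"
    by (simp add: algebra_simps)
  show ?thesis
    using assms(1)
    apply (rule so24_cases)
    using assms(2)
    apply (rule so24_cases)
    apply (simp only: * g_add g_scaleR)
    unfolding so24_iff by blast
qed

lemma subspace_so24: "subspace so24"
  unfolding subspace_def
  using so24_lincomb[of _ _ 1 1] so24_lincomb[of _ _ _ 0] g_in_so24(1)[of 0 0 0 0 0]
  by (auto simp del: g_in_so24)

text \<open>Skewness for the invariant quadratic form, entry by entry. In this form closure under
  brackets and the matrix of the spin representation become polynomial identities.\<close>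

lemma so24_iff_skew:
  "X \<in> so24 \<longleftrightarrow>
     X$1$6 = 0 \<and> X$2$5 = 0 \<and> X$3$3 = 0 \<and> X$4$4 = 0 \<and> X$5$2 = 0 \<and> X$6$1 = 0 \<and>
     X$6$6 = - X$1$1 \<and> X$5$5 = - X$2$2 \<and> X$5$6 = - X$1$2 \<and> X$6$5 = - X$2$1 \<and> X$3$4 = - X$4$3 \<and>
     X$3$6 = - X$1$3 \<and> X$4$6 = - X$1$4 \<and> X$3$5 = - X$2$3 \<and> X$4$5 = - X$2$4 \<and>
     X$6$3 = - X$3$1 \<and> X$6$4 = - X$4$1 \<and> X$5$3 = - X$3$2 \<and> X$5$4 = - X$4$2 \<and>
     X$2$6 = - X$1$5 \<and> X$6$2 = - X$5$1" (is "_ \<longleftrightarrow> ?R")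
proof
  assume "X \<in> so24"
  then show ?R
    by (rule so24_cases) (simp add: g_neg_def g_zero_def g_pos_def vector_6_nth)
next
  assume ?R
  then have "X = g_neg (X$3$1) (X$4$1) (X$3$2) (X$4$2) (X$5$1)
      + g_zero (X$1$1) (X$2$2) (X$4$3) (X$2$1) (X$1$2)
      + g_pos (X$1$3) (X$1$4) (X$2$3) (X$2$4) (X$1$5)"
    by (simp add: g_neg_def g_zero_def g_pos_def matrix6_simps)
  then show "X \<in> so24" unfolding so24_iff by blast
qed

section \<open>Brackets between the graded parts\<close>

lemma commutator_nth:
  "commutator X Y $ i $ j = X$i$1 * Y$1$j + X$i$2 * Y$2$j + X$i$3 * Y$3$j + X$i$4 * Y$4$j
     + X$i$5 * Y$5$j + X$i$6 * Y$6$j - (Y$i$1 * X$1$j + Y$i$2 * X$2$j + Y$i$3 * X$3$j + Y$i$4 * X$4$j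
     + Y$i$5 * X$5$j + Y$i$6 * X$6$j)"
  by (simp add: commutator_def matrix_matrix_mult_def sum_6)

lemma commutator_add:
  "commutator (A + B) C = commutator A C + commutator B C"
  "commutator A (B + C) = commutator A B + commutator A C"
  by (simp_all add: vec_eq_iff commutator_nth algebra_simps)

lemma commutator_scaleR:
  "commutator (k *\<^sub>R A) B = k *\<^sub>R commutator A B"
  "commutator A (k *\<^sub>R B) = k *\<^sub>R commutator A B"
  by (simp_all add: vec_eq_iff commutator_nth algebra_simps)

lemma commutator_zero: "commutator A 0 = 0" "commutator 0 A = 0"
  by (simp_all add: commutator_def)

lemma commutator_swap: "commutator A B = - commutator B A"
  by (simp add: commutator_def)

lemma commutator_so24:
  assumes "X \<in> so24" "Y \<in> so24"
  shows "commutator X Y \<in> so24"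
  using assms unfolding so24_iff_skew commutator_nth by simp

lemma commutator_g_zero_g_neg:
  "commutator (g_zero a b c x z) (g_neg p q r s w)
     = g_neg (- c * q - p * a - r * x) (c * p - q * a - s * x)
         (- c * s - p * z - r * b) (c * r - q * z - s * b) (- (a + b) * w)"
  by (simp add: matrix6_simps commutator_nth g_neg_def g_zero_def algebra_simps)

lemma commutator_g_zero_g_pos:
  "commutator (g_zero a b c x z) (g_pos p q r s w)
     = g_pos (a * p + z * r - c * q) (a * q + z * s + c * p)
         (x * p + b * r - c * s) (x * q + b * s + c * r) ((a + b) * w)"
  by (simp add: matrix6_simps commutator_nth g_pos_def g_zero_def algebra_simps)

lemma commutator_g_zero_g_zero:
  "commutator (g_zero a b c x z) (g_zero a' b' c' x' z')
     = g_zero (z * x' - z' * x) (x * z' - x' * z) 0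
        (x * a' + b * x' - x' * a - b' * x) (a * z' + z * b' - a' * z - z' * b)"
  by (simp add: matrix6_simps commutator_nth g_zero_def algebra_simps)

text \<open>The nilradical is a Heisenberg algebra with centre in degree -2. Centrality later allows
  \<open>g_neg p q r s 0\<close> to be moved past powers of \<open>g_neg 0 0 0 0 1\<close>.\<close>

lemma commutator_g_neg_g_neg:
  "commutator (g_neg p q r s w) (g_neg p' q' r' s' w')
     = g_neg 0 0 0 0 (r' * p + s' * q - r * p' - s * q')"
  by (simp add: matrix6_simps commutator_nth g_neg_def algebra_simps)

lemma commutator_g_pos_top_g_neg_bottom:
  "commutator (g_pos 0 0 0 0 w) (g_neg 0 0 0 0 w') = g_zero (w * w') (w * w') 0 0 0"
  by (simp add: matrix6_simps commutator_nth g_neg_def g_zero_def g_pos_def algebra_simps)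

lemma commutator_g_pos_top_g_neg:
  "commutator (g_pos 0 0 0 0 w) (g_neg p q r s 0)
     = g_pos (- w * r) (- w * s) (w * p) (w * q) 0"
  by (simp add: matrix6_simps commutator_nth g_neg_def g_pos_def algebra_simps)

lemma cartan_eq_g_zero: "cartan a b c = g_zero a b c 0 0"
  by (simp add: cartan_def block_def g_zero_def matrix6_simps vector_4_nth nu_def
      matrix_vector_mult_def vector_matrix_mult_def sum_4)

lemma grading_elt_eq_g_zero: "grading_elt = g_zero 1 0 0 0 0"
  by (simp add: grading_elt_def block_def g_zero_def matrix6_simps vector_4_nth nu_def
      matrix_vector_mult_def vector_matrix_mult_def sum_4)

lemma block_diagonal_eq_g_zero:
  "block_diagonal B c = g_zero (- B$2$2) (- B$1$1) c (- B$2$1) (- B$1$2)"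
  by (simp add: block_diagonal_def g_zero_def matrix6_simps)

lemma alpha_eq: "alpha X = g_neg (X$2) (X$3) (- X$2) 0 (X$4) + g_zero 0 0 0 (X$1) (X$1 / 2)"
  by (simp add: alpha_def g_zero_def g_neg_def matrix6_simps)

lemma alpha_in_so24 [simp]: "alpha X \<in> so24"
  unfolding alpha_eq using so24_lincomb[of _ _ 1 1, OF g_in_so24(1) g_in_so24(2)] by simp

lemma block_diagonal_branch_matrix:
  "block_diagonal (branch_matrix X) 0 = g_zero 0 0 0 (X$1) (X$1 / 2)"
  by (simp add: block_diagonal_eq_g_zero branch_matrix_def vector_def)

lemma sl2_so2_eq: "sl2_so2 = {g_zero a (- a) c x z | a c x z. True}"
proof -
  have "g_zero a (- a) c x z = block_diagonal (vector [vector [a, - z], vector [- x, - a]]) c" for a c x z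
    by (simp add: block_diagonal_eq_g_zero)
  moreover have "trace (vector [vector [a, - z], vector [- x, - a]] :: real^2^2) = 0" for a x z :: real
    by (simp add: trace_def sum_2)
  moreover have "block_diagonal B c = g_zero (- B$2$2) (- (- B$2$2)) c (- B$2$1) (- B$1$2)"
    if "trace B = 0" for B c
    using that unfolding block_diagonal_eq_g_zero by (simp add: trace_def sum_2 add_eq_0_iff)
  ultimately show ?thesis
    unfolding sl2_so2_def by blast
qed

lemma strictly_lower_iff:
  "X \<in> so24 \<and> strictly_lower X \<longleftrightarrow> (\<exists>p q r s w x. X = g_neg p q r s w + g_zero 0 0 0 x 0)"
  (is "?L \<longleftrightarrow> ?R")
proof
  assume L: ?L
  then have *: "X $ of_nat n $ of_nat m = 0" if "m \<in> {1..6}" "n \<in> {1..m}" for m n :: nat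
    using that unfolding strictly_lower_def by blast
  from L have "X \<in> so24" by simp
  then obtain p q r s w a b c x z p' q' r' s' w' where
    X: "X = g_neg p q r s w + g_zero a b c x z + g_pos p' q' r' s' w'" by (rule so24_cases)
  show ?R
    \<comment> \<open>The pair \<open>4 3\<close> addresses the entry in row 3, column 4; as the
      middle block is skew, its vanishing removes \<open>c\<close> altogether.\<close>
    using *[of 1 1] *[of 2 1] *[of 2 2] *[of 3 1] *[of 3 2] *[of 4 1] *[of 4 2] *[of 4 3] *[of 5 1]
    unfolding X by (auto simp: g_neg_def g_zero_def g_pos_def matrix6_simps)
next
  assume ?R
  then obtain p q r s w x where X: "X = g_neg p q r s w + g_zero 0 0 0 x 0" by blast
  have "{1..6} = {1::nat, 2, 3, 4, 5, 6}" "{1..5} = {1::nat, 2, 3, 4, 5}" "{1..4} = {1::nat, 2, 3, 4}"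
    "{1..3} = {1::nat, 2, 3}" "{1..2} = {1::nat, 2}" by auto
  then have "strictly_lower X"
    by (simp add: strictly_lower_def X g_neg_def g_zero_def vector_6_nth del: One_nat_def)
  then show ?L
    using so24_lincomb[of _ _ 1 1, OF g_in_so24(1) g_in_so24(2)] X by simp
qed

lemma strictly_upper_g:
  "strictly_upper (g_pos p q r s w)" "strictly_upper (g_zero 0 0 0 0 z)"
proof -
  have "{1..6} = {1::nat, 2, 3, 4, 5, 6}" "{1..5} = {1::nat, 2, 3, 4, 5}" "{1..4} = {1::nat, 2, 3, 4}"
    "{1..3} = {1::nat, 2, 3}" "{1..2} = {1::nat, 2}" by auto
  then show "strictly_upper (g_pos p q r s w)" "strictly_upper (g_zero 0 0 0 0 z)"
    by (simp_all add: strictly_upper_def g_pos_def g_zero_def vector_6_nth del: One_nat_def)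
qed

section \<open>Exponentials of endomorphisms and smoothness\<close>

text \<open>The mean value theorem in direction \<open>i\<close>, applied to the increment of
  \<open>f\<close> in direction \<open>j\<close>, reduces the second difference to two values of
  \<open>\<lambda>x. f' x i\<close>, which are then expanded at \<open>p\<close>.\<close>

lemma second_difference_bound:
  fixes f :: "'a::real_normed_vector \<Rightarrow> real"
  assumes U: "open U" "p \<in> U"
    and f: "\<And>x. x \<in> U \<Longrightarrow> (f has_derivative f' x) (at x)"
    and D: "((\<lambda>x. f' x i) has_derivative D) (at p)"
    and e: "0 < e"
  shows "\<exists>d>0. \<forall>h. 0 < h \<and> h < d \<longrightarrow>
    \<bar>f (p + h *\<^sub>R i + h *\<^sub>R j) - f (p + h *\<^sub>R i) - f (p + h *\<^sub>R j) + f p - h\<^sup>2 * D j\<bar> \<le> e * h\<^sup>2"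
proof -
  \<comment> \<open>Increments \<open>t *\<^sub>R i + s *\<^sub>R j\<close> with \<open>s\<close>
    and \<open>t\<close> between 0 and \<open>h\<close> have norm at most \<open>h * C\<close>. An
    accuracy of \<open>e / (2 * C)\<close> therefore costs \<open>e / 2 * h\<close> at each of the
    two points; the summand 1 keeps \<open>C\<close> positive.\<close>
  define C where "C = norm i + norm j + 1"
  have C: "0 < C" by (simp add: C_def add_nonneg_pos)
  interpret D: bounded_linear D using D by (rule has_derivative_bounded_linear)
  from U obtain r where r: "0 < r" "ball p r \<subseteq> U" by (meson openE)
  have "0 < e / (2 * C)" using e C by simp
  with D obtain d where d: "0 < d"
    "\<And>y. norm (y - p) < d \<Longrightarrow> \<bar>f' y i - f' p i - D (y - p)\<bar> \<le> e / (2 * C) * norm (y - p)"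
    unfolding has_derivative_at_alt real_norm_def by blast
  show ?thesis
  proof (intro exI[of _ "min d r / C"] conjI allI impI)
    show "0 < min d r / C" using d(1) r C by simp
    fix h assume h: "0 < h \<and> h < min d r / C"
    then have hC: "h * C < d" "h * C < r" using C by (simp_all add: field_simps)
    have near: "norm (t *\<^sub>R i + s *\<^sub>R j) \<le> h * C" if "0 \<le> t" "t \<le> h" "0 \<le> s" "s \<le> h" for s t
    proof -
      have "norm (t *\<^sub>R i + s *\<^sub>R j) \<le> t * norm i + s * norm j"
        using norm_triangle_ineq[of "t *\<^sub>R i" "s *\<^sub>R j"] that by simp
      also have "\<dots> \<le> h * norm i + h * norm j"
        using that by (intro add_mono mult_right_mono) auto
      also have "\<dots> \<le> h * C" using h by (simp add: C_def algebra_simps)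
      finally show ?thesis .
    qed
    have inU: "p + t *\<^sub>R i + s *\<^sub>R j \<in> U" if "0 \<le> t" "t \<le> h" "0 \<le> s" "s \<le> h" for s t
    proof -
      have "dist (p + (t *\<^sub>R i + s *\<^sub>R j)) p < r"
        using near[OF that] hC(2) by (simp add: dist_norm)
      then show ?thesis
        using r(2) by (auto simp: dist_commute add.assoc)
    qed
    define g where "g t = f (p + t *\<^sub>R i + h *\<^sub>R j) - f (p + t *\<^sub>R i)" for t
    define g' where "g' t = f' (p + t *\<^sub>R i + h *\<^sub>R j) i - f' (p + t *\<^sub>R i) i" for t
    have "(g has_real_derivative g' t) (at t)" if "0 \<le> t" "t \<le> h" for t
    proof -
      have 1: "(f has_derivative f' (p + t *\<^sub>R i + h *\<^sub>R j)) (at (p + t *\<^sub>R i + h *\<^sub>R j))"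
        "(f has_derivative f' (p + t *\<^sub>R i)) (at (p + t *\<^sub>R i))"
        using f inU[of t h] inU[of t 0] that by auto
      have lin: "f' (p + t *\<^sub>R i + h *\<^sub>R j) (k *\<^sub>R i) = k * f' (p + t *\<^sub>R i + h *\<^sub>R j) i"
        "f' (p + t *\<^sub>R i) (k *\<^sub>R i) = k * f' (p + t *\<^sub>R i) i" for k
        using 1[THEN has_derivative_linear, THEN linear_scale] by simp_all
      have "(g has_derivative (\<lambda>k. f' (p + t *\<^sub>R i + h *\<^sub>R j) (k *\<^sub>R i) - f' (p + t *\<^sub>R i) (k *\<^sub>R i))) (at t)"
        unfolding g_def
        by (intro has_derivative_diff
            has_derivative_compose[of "\<lambda>t. p + t *\<^sub>R i + h *\<^sub>R j" _ _ _ f, OF _ 1(1)]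
            has_derivative_compose[of "\<lambda>t. p + t *\<^sub>R i" _ _ _ f, OF _ 1(2)])
          (auto intro!: derivative_eq_intros)
      then show ?thesis
        unfolding has_field_derivative_def
        by (rule has_derivative_eq_rhs)
          (simp only: fun_eq_iff g'_def lin, simp add: algebra_simps)
    qed
    then obtain z where z: "0 < z" "z < h" "g h - g 0 = (h - 0) * g' z"
      using MVT2[of 0 h g g'] h by auto
    have *: "\<bar>f' (p + v) i - f' p i - D v\<bar> \<le> e / 2 * h" if "norm v \<le> h * C" for v
    proof -
      have "\<bar>f' (p + v) i - f' p i - D v\<bar> \<le> e / (2 * C) * norm v"
        using d(2)[of "p + v"] that hC by simp
      also have "\<dots> \<le> e / (2 * C) * (h * C)"
        using that e C by (intro mult_left_mono) auto
      finally show ?thesis using C by simp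
    qed
    have "\<bar>f' (p + z *\<^sub>R i + h *\<^sub>R j) i - f' p i - (z * D i + h * D j)\<bar> \<le> e / 2 * h"
      using *[OF near[of z h]] z h by (simp add: D.add D.scaleR add.assoc)
    moreover have "\<bar>f' (p + z *\<^sub>R i) i - f' p i - z * D i\<bar> \<le> e / 2 * h"
      using *[OF near[of z 0]] z h by (simp add: D.scaleR)
    ultimately have "\<bar>g' z - h * D j\<bar> \<le> e * h"
      unfolding g'_def by linarith
    then have "h * \<bar>g' z - h * D j\<bar> \<le> h * (e * h)"
      using h by (intro mult_left_mono) auto
    moreover have "\<bar>h * g' z - h\<^sup>2 * D j\<bar> = h * \<bar>g' z - h * D j\<bar>"
    proof -
      have "h * g' z - h\<^sup>2 * D j = h * (g' z - h * D j)"
        by (simp add: power2_eq_square algebra_simps)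
      then show ?thesis using h by (simp add: abs_mult)
    qed
    moreover have "g h - g 0 = f (p + h *\<^sub>R i + h *\<^sub>R j) - f (p + h *\<^sub>R i) - f (p + h *\<^sub>R j) + f p"
      by (simp add: g_def)
    ultimately show "\<bar>f (p + h *\<^sub>R i + h *\<^sub>R j) - f (p + h *\<^sub>R i) - f (p + h *\<^sub>R j) + f p - h\<^sup>2 * D j\<bar> \<le> e * h\<^sup>2"
      using z(3) by (simp add: power2_eq_square algebra_simps)
  qed
qed

text \<open>The second difference is symmetric in \<open>i\<close> and \<open>j\<close>, and its
  quotient by \<open>h\<^sup>2\<close> tends to both values. For parallel sections this becomes the
  curvature condition.\<close>

lemma mixed_derivatives_eq:
  fixes f :: "'a::real_normed_vector \<Rightarrow> 'b::euclidean_space"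
  assumes U: "open U" "p \<in> U"
    and f: "\<And>x. x \<in> U \<Longrightarrow> (f has_derivative f' x) (at x)"
    and Di: "((\<lambda>x. f' x i) has_derivative Di) (at p)"
    and Dj: "((\<lambda>x. f' x j) has_derivative Dj) (at p)"
  shows "Di j = Dj i"
proof (rule euclidean_eqI)
  fix b :: 'b assume "b \<in> Basis"
  have 1: "((\<lambda>x. f x \<bullet> b) has_derivative (\<lambda>h. f' x h \<bullet> b)) (at x)" if "x \<in> U" for x
    using f[OF that] by (rule has_derivative_inner_left)
  note 2 = has_derivative_inner_left[OF Di, of b]
  note 3 = has_derivative_inner_left[OF Dj, of b]
  have "\<bar>Di j \<bullet> b - Dj i \<bullet> b\<bar> \<le> e" if "0 < e" for e
  proof -
    have "0 < e / 2" using that by simp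
    from second_difference_bound[OF U 1 2 this, of j] second_difference_bound[OF U 1 3 this, of i]
    obtain d d' where d: "0 < d" "0 < d'"
      "\<And>h. 0 < h \<and> h < d \<Longrightarrow> \<bar>f (p + h *\<^sub>R i + h *\<^sub>R j) \<bullet> b - f (p + h *\<^sub>R i) \<bullet> b - f (p + h *\<^sub>R j) \<bullet> b + f p \<bullet> b - h\<^sup>2 * (Di j \<bullet> b)\<bar> \<le> e / 2 * h\<^sup>2"
      "\<And>h. 0 < h \<and> h < d' \<Longrightarrow> \<bar>f (p + h *\<^sub>R j + h *\<^sub>R i) \<bullet> b - f (p + h *\<^sub>R j) \<bullet> b - f (p + h *\<^sub>R i) \<bullet> b + f p \<bullet> b - h\<^sup>2 * (Dj i \<bullet> b)\<bar> \<le> e / 2 * h\<^sup>2"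
      by metis
    define h where "h = min d d' / 2"
    have h: "0 < h" "h < d" "h < d'" using d(1,2) by (auto simp: h_def)
    have "p + h *\<^sub>R j + h *\<^sub>R i = p + h *\<^sub>R i + h *\<^sub>R j" by simp
    then have "\<bar>h\<^sup>2 * (Di j \<bullet> b) - h\<^sup>2 * (Dj i \<bullet> b)\<bar> \<le> e * h\<^sup>2"
      using d(3)[OF conjI, OF h(1,2)] d(4)[OF conjI, OF h(1,3)] by (simp only:)
    then have "h\<^sup>2 * \<bar>Di j \<bullet> b - Dj i \<bullet> b\<bar> \<le> h\<^sup>2 * e"
      by (simp only: right_diff_distrib[symmetric] abs_mult abs_power2 mult.commute[of e])
    then show ?thesis using h by simp
  qed
  then show "Di j \<bullet> b = Dj i \<bullet> b"
    using field_le_epsilon[of "\<bar>Di j \<bullet> b - Dj i \<bullet> b\<bar>" 0] by simp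
qed

section \<open>The exponential series of an endomorphism\<close>

lemma funpow_scaleR_linear:
  fixes A :: "'v::real_vector \<Rightarrow> 'v"
  assumes "linear A"
  shows "((\<lambda>u. t *\<^sub>R A u) ^^ n) v = t ^ n *\<^sub>R (A ^^ n) v"
  by (induction n) (simp_all add: linear_scale[OF assms])

lemma linear_funpow: "linear A \<Longrightarrow> linear (A ^^ n)"
  for A :: "'v::real_vector \<Rightarrow> 'v"
  by (induction n) (auto intro: linear_compose linear_id simp: id_def[symmetric])

lemma summable_exp_op:
  fixes A :: "'v::euclidean_space \<Rightarrow> 'v"
  assumes "linear A"
  shows "summable (\<lambda>n. (A ^^ n) v /\<^sub>R fact n)"
proof -
  interpret A: bounded_linear A using assms by (rule linear_conv_bounded_linear[THEN iffD1])
  obtain K where K: "0 < K" "\<And>x. norm (A x) \<le> norm x * K" using A.pos_bounded by blast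
  have "norm ((A ^^ n) v) \<le> K ^ n * norm v" for n
  proof (induction n)
    case (Suc n)
    have "norm ((A ^^ Suc n) v) \<le> norm ((A ^^ n) v) * K" using K(2) by simp
    also have "\<dots> \<le> K ^ n * norm v * K" using Suc K(1) by (intro mult_right_mono) auto
    finally show ?case by (simp add: algebra_simps)
  qed simp
  then have *: "norm ((A ^^ n) v /\<^sub>R fact n) \<le> K ^ n /\<^sub>R fact n * norm v" for n
    by (simp add: divide_simps)
  have "summable (\<lambda>n. K ^ n /\<^sub>R fact n * norm v)"
    by (intro summable_mult2 summable_exp_generic)
  then show ?thesis
    by (rule summable_comparison_test'[where N = 0, OF _ *])
qed

lemma exp_op_zero: "exp_op (\<lambda>u. 0) v = v"
proof -
  have "((\<lambda>u. 0) ^^ n) v = (if n = 0 then v else 0)" for n by (cases n) auto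
  then have "(\<lambda>n. ((\<lambda>u. 0) ^^ n) v /\<^sub>R fact n) = (\<lambda>n. if n = 0 then v else 0)"
    by (intro ext) (simp only:, simp)
  then show "exp_op (\<lambda>u. 0) v = v"
    unfolding exp_op_def using sums_single[of 0 "\<lambda>_. v", THEN sums_unique] by (simp only:)

qed

lemma linear_exp_op:
  fixes A :: "'v::euclidean_space \<Rightarrow> 'v"
  assumes "linear A"
  shows "linear (exp_op (\<lambda>u. t *\<^sub>R A u))"
proof -
  have tA: "linear (\<lambda>u. t *\<^sub>R A u)" using assms by (rule linear_compose_scale_right)
  note lin = linear_funpow[OF tA]
  show ?thesis
  proof (rule linearI)
    fix u v
    show "exp_op (\<lambda>u. t *\<^sub>R A u) (u + v) = exp_op (\<lambda>u. t *\<^sub>R A u) u + exp_op (\<lambda>u. t *\<^sub>R A u) v"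
      unfolding exp_op_def suminf_add[OF summable_exp_op[OF tA] summable_exp_op[OF tA]]
        linear_add[OF lin] scaleR_add_right ..
  next
    fix r v
    show "exp_op (\<lambda>u. t *\<^sub>R A u) (r *\<^sub>R v) = r *\<^sub>R exp_op (\<lambda>u. t *\<^sub>R A u) v"
    proof -
      have "((\<lambda>u. t *\<^sub>R A u) ^^ n) (r *\<^sub>R v) /\<^sub>R fact n = r *\<^sub>R (((\<lambda>u. t *\<^sub>R A u) ^^ n) v /\<^sub>R fact n)" for n
        unfolding linear_scale[OF lin] by (rule scaleR_left_commute)
      then show ?thesis
        unfolding exp_op_def
        by (subst suminf_scaleR_right[OF summable_exp_op[OF tA]]) (rule suminf_cong)
    qed
  qed
qed

lemma exp_op_commute:
  fixes A :: "'v::euclidean_space \<Rightarrow> 'v"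
  assumes "linear A"
  shows "A (exp_op (\<lambda>u. t *\<^sub>R A u) v) = exp_op (\<lambda>u. t *\<^sub>R A u) (A v)"
proof -
  have tA: "linear (\<lambda>u. t *\<^sub>R A u)" using assms by (rule linear_compose_scale_right)
  interpret A: bounded_linear A using assms by (rule linear_conv_bounded_linear[THEN iffD1])
  have "A (((\<lambda>u. t *\<^sub>R A u) ^^ n) v /\<^sub>R fact n) = ((\<lambda>u. t *\<^sub>R A u) ^^ n) (A v) /\<^sub>R fact n" for n
    unfolding funpow_scaleR_linear[OF assms] A.scaleR funpow_swap1 ..
  then show ?thesis
    unfolding exp_op_def by (subst A.suminf[OF summable_exp_op[OF tA]]) (rule suminf_cong)
qed

text \<open>Lets the exponential of an operator that is linear only on \<open>V\<close> be computed
  with a linear map of the whole space that agrees with it on an invariant set.\<close>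

lemma exp_op_cong_on:
  assumes "\<And>u. u \<in> N \<Longrightarrow> B u = A u" "\<And>u. u \<in> N \<Longrightarrow> A u \<in> N" "v \<in> N"
  shows "exp_op B v = exp_op A v"
proof -
  have "(B ^^ n) v = (A ^^ n) v \<and> (A ^^ n) v \<in> N" for n
    by (induction n) (use assms in auto)
  then show ?thesis unfolding exp_op_def by simp
qed

lemma exp_op_closed:
  fixes A :: "'v::euclidean_space \<Rightarrow> 'v"
  assumes "linear A" "subspace N" "\<And>u. u \<in> N \<Longrightarrow> A u \<in> N" "v \<in> N"
  shows "exp_op A v \<in> N"
proof -
  have "(A ^^ n) v \<in> N" for n by (induction n) (use assms in auto)
  then have "(\<Sum>n<m. (A ^^ n) v /\<^sub>R fact n) \<in> N" for m
    using assms(2) by (intro subspace_sum subspace_scale) auto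
  moreover have "(\<lambda>m. \<Sum>n<m. (A ^^ n) v /\<^sub>R fact n) \<longlonglongrightarrow> exp_op A v"
    unfolding exp_op_def by (rule summable_LIMSEQ[OF summable_exp_op[OF assms(1)]])
  ultimately show ?thesis
    by (rule closed_sequentially[OF closed_subspace[OF assms(2)]])
qed

text \<open>Paired with a basis vector, the series is an everywhere convergent power series in
  \<open>t\<close>, and differentiating its coefficients amounts to replacing \<open>v\<close> by
  \<open>A v\<close>.\<close>

lemma has_vector_derivative_exp_op:
  fixes A :: "'v::euclidean_space \<Rightarrow> 'v"
  assumes "linear A"
  shows "((\<lambda>t. exp_op (\<lambda>u. t *\<^sub>R A u) v) has_vector_derivative exp_op (\<lambda>u. t *\<^sub>R A u) (A v)) (at t)"
  unfolding has_vector_derivative_def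
proof (subst has_derivative_componentwise_within, intro ballI)
  fix b :: 'v assume "b \<in> Basis"
  define c where "c v n = ((A ^^ n) v \<bullet> b) / fact n" for v n
  have tA: "linear (\<lambda>u. t *\<^sub>R A u)" for t using assms by (rule linear_compose_scale_right)
  note bl = bounded_linear_inner_left[of b]
  have term_eq: "(((\<lambda>u. t *\<^sub>R A u) ^^ n) v /\<^sub>R fact n) \<bullet> b = c v n * t ^ n" for t n v
    by (simp add: funpow_scaleR_linear[OF assms] c_def field_simps)
  have sm: "summable (\<lambda>n. c v n * t ^ n)" for t v
    using bounded_linear.summable[OF bl summable_exp_op[OF tA[of t], of v]] unfolding term_eq .
  have eq: "exp_op (\<lambda>u. t *\<^sub>R A u) v \<bullet> b = (\<Sum>n. c v n * t ^ n)" for t v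
    unfolding exp_op_def bounded_linear.suminf[OF bl summable_exp_op[OF tA]] term_eq ..
  have "diffs (c v) n = c (A v) n" for n
    by (simp add: diffs_def c_def funpow_swap1 divide_simps del: of_nat_Suc)
  then have "diffs (c v) = c (A v)" by blast
  with termdiffs_strong_converges_everywhere[of "c v" t, OF sm]
  have "((\<lambda>t. exp_op (\<lambda>u. t *\<^sub>R A u) v \<bullet> b) has_field_derivative exp_op (\<lambda>u. t *\<^sub>R A u) (A v) \<bullet> b) (at t)"
    unfolding eq by simp
  then show "((\<lambda>t. exp_op (\<lambda>u. t *\<^sub>R A u) v \<bullet> b) has_derivative (\<lambda>s. s *\<^sub>R exp_op (\<lambda>u. t *\<^sub>R A u) (A v) \<bullet> b)) (at t)"
    unfolding has_field_derivative_def by (rule has_derivative_eq_rhs) (simp add: fun_eq_iff)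
qed

text \<open>In use, \<open>L\<close> is the identity for tractor sections and a coordinate for the
  densities of the Einstein scales.\<close>

lemma has_derivative_exp_op_coordinate:
  fixes A :: "'v::euclidean_space \<Rightarrow> 'v" and p :: "real^4"
  assumes "linear A" "bounded_linear L"
  shows "((\<lambda>p. L (exp_op (\<lambda>u. p$1 *\<^sub>R A u) v)) has_derivative
    (\<lambda>h. h$1 *\<^sub>R L (exp_op (\<lambda>u. p$1 *\<^sub>R A u) (A v)))) (at p)"
proof -
  have 1: "((\<lambda>t. L (exp_op (\<lambda>u. t *\<^sub>R A u) v)) has_derivative
      (\<lambda>s. L (s *\<^sub>R exp_op (\<lambda>u. p$1 *\<^sub>R A u) (A v)))) (at (p$1))"
    using bounded_linear.has_derivative[OF assms(2)]
      has_vector_derivative_exp_op[OF assms(1), of v "p$1"]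
    unfolding has_vector_derivative_def by blast
  have "((\<lambda>p. L (exp_op (\<lambda>u. p$1 *\<^sub>R A u) v)) has_derivative
      (\<lambda>h. L (h$1 *\<^sub>R exp_op (\<lambda>u. p$1 *\<^sub>R A u) (A v)))) (at p)"
    by (rule has_derivative_compose[OF bounded_linear_imp_has_derivative[OF bounded_linear_vec_nth] 1])
  then show ?thesis
    by (simp add: linear_scale[OF bounded_linear.linear[OF assms(2)]])
qed

section \<open>Smoothness of the flow, and derivatives as local data\<close>

lemma Ck_on_const: "Ck_on k U (\<lambda>_. c)"
  by (induction k arbitrary: c) (simp_all add: frechet_derivative_const)

lemma smooth_on_exp_op_coordinate:
  fixes A :: "'v::euclidean_space \<Rightarrow> 'v"
  assumes "linear A" "bounded_linear L"
  shows "smooth_on U (\<lambda>p. L (exp_op (\<lambda>u. p$1 *\<^sub>R A u) v))"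
proof -
  note d = has_derivative_exp_op_coordinate[OF assms]
  have "Ck_on k U (\<lambda>p. L (exp_op (\<lambda>u. p$1 *\<^sub>R A u) v))" for k
  \<comment> \<open>Partial derivatives have the same form with \<open>A v\<close> in place of
    \<open>v\<close> in direction 1 and vanish in the others; hence the generalisation over
    \<open>v\<close>.\<close>
  proof (induction k arbitrary: v)
    case 0
    show ?case
      using d by (auto intro!: continuous_at_imp_continuous_on dest: has_derivative_continuous)
  next
    case (Suc k)
    have "(\<lambda>p. L (exp_op (\<lambda>u. p$1 *\<^sub>R A u) v)) differentiable_on U"
      unfolding differentiable_on_def
      using d by (meson differentiable_def has_derivative_at_withinI)
    moreover have "Ck_on k U (\<lambda>p. frechet_derivative (\<lambda>p. L (exp_op (\<lambda>u. p$1 *\<^sub>R A u) v)) (at p) (axis i 1))" for i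
      unfolding frechet_derivative_at[OF d, symmetric]
      using Suc[of "A v"] Ck_on_const[of k U 0] by (cases "i = 1") (simp_all add: axis_def)
    ultimately show ?case by simp
  qed
  then show ?thesis by (simp add: smooth_on_def)
qed

lemma has_derivative_cong_open:
  assumes "open U" "p \<in> U" "\<And>x. x \<in> U \<Longrightarrow> f x = g x"
  shows "(f has_derivative D) (at p) \<longleftrightarrow> (g has_derivative D) (at p)"
  by (rule iffI; erule has_derivative_transform_within_open[OF _ assms(1,2)]) (simp_all add: assms(3))

lemma frechet_derivative_cong_open:
  assumes "open U" "p \<in> U" "\<And>x. x \<in> U \<Longrightarrow> f x = g x"
  shows "frechet_derivative f (at p) = frechet_derivative g (at p)"
proof -
  have "(f has_derivative D) (at p) \<longleftrightarrow> (g has_derivative D) (at p)" for D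
    by (rule has_derivative_cong_open) (fact assms)+
  then show ?thesis unfolding frechet_derivative_def by simp
qed

lemma Ck_on_cong:
  assumes "open U" "\<And>x. x \<in> U \<Longrightarrow> f x = g x"
  shows "Ck_on k U f \<longleftrightarrow> Ck_on k U g"
  using assms(2)
proof (induction k arbitrary: f g)
  case 0
  then show ?case using continuous_on_cong[OF refl, of U f g] by simp
next
  case (Suc k)
  have "f differentiable_on U \<longleftrightarrow> g differentiable_on U"
    unfolding differentiable_on_eq_differentiable_at[OF assms(1)] differentiable_def
    using has_derivative_cong_open[OF assms(1) _ Suc.prems] by (intro ball_cong refl) auto
  moreover have "Ck_on k U (\<lambda>p. frechet_derivative f (at p) (axis i 1))
      = Ck_on k U (\<lambda>p. frechet_derivative g (at p) (axis i 1))" for i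
    using frechet_derivative_cong_open[OF assms(1) _ Suc.prems] by (intro Suc.IH) simp
  ultimately show ?case by simp
qed

lemma smooth_on_cong: "open U \<Longrightarrow> (\<And>x. x \<in> U \<Longrightarrow> f x = g x) \<Longrightarrow> smooth_on U f = smooth_on U g"
  unfolding smooth_on_def using Ck_on_cong by metis

lemma smooth_on_has_derivative:
  assumes "smooth_on U f" "open U" "p \<in> U"
  shows "(f has_derivative frechet_derivative f (at p)) (at p)"
proof -
  have "Ck_on (Suc 0) U f" using assms(1) unfolding smooth_on_def by blast
  then have "f differentiable_on U" by simp
  then show ?thesis
    using assms(2,3) frechet_derivative_works unfolding differentiable_on_eq_differentiable_at[OF assms(2)]
    by blast
qed

text \<open>Uniqueness by duality: pairing a solution with a solution of the adjoint equation gives a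
  constant.\<close>

lemma linear_ode_unique_on_connected:
  fixes A :: "'v::euclidean_space \<Rightarrow> 'v" and s :: "real^4 \<Rightarrow> 'v"
  assumes A: "linear A" and U: "open U" "connected U" "q \<in> U"
    and s: "\<And>p. p \<in> U \<Longrightarrow> (s has_derivative (\<lambda>h. h$1 *\<^sub>R A (s p))) (at p)"
    and q: "s q = 0" and p: "p \<in> U"
  shows "s p = 0"
proof (rule euclidean_eqI)
  fix b :: 'v
  define B where "B = (\<lambda>x. - adjoint A x)"
  have "linear (adjoint A)" using A by (rule adjoint_linear)
  then have B: "linear B" unfolding B_def by (rule linear_compose_neg)
  \<comment> \<open>The solution of the adjoint equation with value \<open>b\<close> at
    \<open>p\<close>. It exists on all of \<open>real^4\<close>, so it can be paired with
    \<open>s\<close> throughout \<open>U\<close>, and at \<open>p\<close> the pairing is the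
    component of \<open>s p\<close> along \<open>b\<close>.\<close>
  define X where "X = (\<lambda>x::real^4. exp_op (\<lambda>u. (x - p)$1 *\<^sub>R B u) b)"
  have X: "(X has_derivative (\<lambda>h. h$1 *\<^sub>R B (X x))) (at x)" for x
    unfolding X_def exp_op_commute[OF B]
    using has_derivative_compose[OF has_derivative_diff[OF has_derivative_ident has_derivative_const]
      has_derivative_exp_op_coordinate[OF B bounded_linear_ident, of b "x - p"]] by simp
  have "((\<lambda>x. s x \<bullet> X x) has_derivative (\<lambda>h. 0)) (at x)" if "x \<in> U" for x
  proof -
    have "A (s x) \<bullet> X x = - (s x \<bullet> B (X x))"
      unfolding B_def using adjoint_works[OF A, of "s x" "X x"] by (simp add: inner_commute)
    then show ?thesis
      by (intro has_derivative_eq_rhs[OF has_derivative_inner[OF s[OF that] X]])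
        (simp add: fun_eq_iff algebra_simps)
  qed
  then have "s p \<bullet> X p = s q \<bullet> X q"
    by (rule has_derivative_zero_unique_connected[OF U(1,2) _ p U(3)])
  moreover have "X p = b" unfolding X_def by (simp add: exp_op_zero)
  ultimately show "s p \<bullet> b = 0 \<bullet> b" using q by simp
qed

section \<open>Parallel tractor sections\<close>

definition neg_null :: "'v::euclidean_space set \<Rightarrow> (real^6^6 \<Rightarrow> 'v \<Rightarrow> 'v) \<Rightarrow> 'v set" where
  "neg_null V \<rho> = {v \<in> V. \<forall>p q r s w. \<rho> (g_neg p q r s w) v = 0}"

text \<open>The matrix \<open>g_zero 0 0 0 1 (1 / 2)\<close> is the block diagonal part of
  \<open>alpha X\<close> for \<open>X$1 = 1\<close>.\<close>

definition axial_flow :: "(real^6^6 \<Rightarrow> 'v \<Rightarrow> 'v) \<Rightarrow> real \<Rightarrow> 'v \<Rightarrow> 'v::euclidean_space" where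
  "axial_flow \<rho> t v = exp_op (\<lambda>u. - (t *\<^sub>R \<rho> (g_zero 0 0 0 1 (1 / 2)) u)) v"

section \<open>Exponential coordinates and the bracket of k\<close>

text \<open>The first component of \<open>k_field Y\<close> is the constant \<open>Y$1\<close>. On
  the annihilator \<open>Phi\<close> depends on that number only, so this turns the formula with
  \<open>k_exp\<close> into one in the coordinate \<open>p$1\<close>.\<close>

lemma k_exp_first_coordinate:
  assumes "k_exp Y p"
  shows "p$1 = Y$1"
proof -
  obtain c where c: "c 0 = 0" "c 1 = p" "\<And>t. (c has_vector_derivative k_field Y (c t)) (at t)"
    using assms unfolding k_exp_def by blast
  have "((\<lambda>t. c t $ 1 - Y$1 * t) has_derivative (\<lambda>h. 0)) (at t)" for t
    by (rule has_derivative_eq_rhs[OF has_derivative_diff[OF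
          bounded_linear.has_derivative[OF bounded_linear_vec_nth[of 1] c(3)[unfolded has_vector_derivative_def]]
          has_derivative_mult_right[OF has_derivative_ident]]])
      (simp add: fun_eq_iff k_field_def vector_4_nth)
  then have "c 1 $ 1 - Y$1 * 1 = c 0 $ 1 - Y$1 * 0"
    by (intro has_derivative_zero_unique_connected[of UNIV "\<lambda>t. c t $ 1 - Y$1 * t"]) auto
  then show ?thesis using c by simp
qed

lemma k_exp_surj: "\<exists>Y. k_exp Y p"
proof -
  \<comment> \<open>\<open>E\<close> is the integral of \<open>exp (- p$1 * s)\<close> from 0 to
    \<open>t\<close>, the shape of the second coordinate along an integral curve. The fourth
    velocity is the second coordinate times its own velocity plus \<open>Y$4\<close>, so the fourth
    coordinate is half the square of the second plus a linear term; \<open>Y\<close> is solved from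
    this at \<open>t = 1\<close>.\<close>
  define E where "E t = (if p$1 = 0 then t else (1 - exp (- p$1 * t)) / p$1)" for t
  have E: "(E has_real_derivative exp (- p$1 * t)) (at t)" for t
  proof (cases "p$1 = 0")
    case True
    then show ?thesis unfolding E_def by simp
  next
    case False
    have "((\<lambda>t. (1 - exp (- p$1 * t)) / p$1) has_real_derivative exp (- p$1 * t)) (at t)"
      using False by (auto intro!: derivative_eq_intros)
    then show ?thesis unfolding E_def using False by simp
  qed
  have E1: "E 1 \<noteq> 0" by (auto simp: E_def)
  define Y :: "real^4" where "Y = vector [p$1, p$2 / E 1, p$3, p$4 - (p$2)\<^sup>2 / 2]"
  have Y1: "p$1 = Y$1" by (simp add: Y_def vector_4_nth)
  define c :: "real \<Rightarrow> real^4" where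
    "c t = vector [Y$1 * t, Y$2 * E t, Y$3 * t, (Y$2 * E t)\<^sup>2 / 2 + Y$4 * t]" for t
  have eq: "(vector [a, b, c, d] :: real^4)
      = a *\<^sub>R axis 1 1 + b *\<^sub>R axis 2 1 + c *\<^sub>R axis 3 1 + d *\<^sub>R axis 4 1" for a b c d :: real
    by (simp add: vec_eq_iff forall_4 axis_def vector_4_nth)
  have "(c has_vector_derivative k_field Y (c t)) (at t)" for t
  proof -
    have 1: "((\<lambda>t. Y$1 * t) has_real_derivative Y$1) (at t)"
      "((\<lambda>t. Y$2 * E t) has_real_derivative Y$2 * exp (- (Y$1 * t))) (at t)"
      "((\<lambda>t. Y$3 * t) has_real_derivative Y$3) (at t)"
      "((\<lambda>t. (Y$2 * E t)\<^sup>2 / 2 + Y$4 * t) has_real_derivative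
         Y$2 * exp (- (Y$1 * t)) * (Y$2 * E t) + Y$4) (at t)"
      using E[of t] unfolding Y1 by (auto intro!: derivative_eq_intros)
    note 2 = 1[THEN has_real_derivative_iff_has_vector_derivative[THEN iffD1],
        THEN bounded_linear.has_vector_derivative[OF bounded_linear_scaleR_left]]
    show ?thesis
      unfolding c_def k_field_def vector_4_nth unfolding eq
      by (intro has_vector_derivative_add 2)
  qed
  moreover have "c 0 = 0" by (simp add: c_def E_def vec_eq_iff forall_4 vector_4_nth)
  moreover have "c 1 = p" using E1 by (simp add: c_def Y_def vec_eq_iff forall_4 vector_4_nth)
  ultimately show ?thesis unfolding k_exp_def by blast
qed

lemma k_bracket_eq: "k_bracket X Y = vector [0, X$1 * Y$2 - X$2 * Y$1, 0, 0]"
  unfolding k_bracket_def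
proof (rule the_equality)
  have br: "field_bracket (k_field X) (k_field Y) p
      = k_field (vector [0, X$2 * Y$1 - X$1 * Y$2, 0, 0]) p" for p
    unfolding field_bracket_def frechet_derivative_at[OF has_derivative_k_field, symmetric]
    by (simp add: k_field_def vec_eq_iff forall_4 vector_4_nth algebra_simps)
  then show "\<forall>p. k_field (vector [0, X$1 * Y$2 - X$2 * Y$1, 0, 0]) p
      = - field_bracket (k_field X) (k_field Y) p"
    by (simp add: k_field_def vec_eq_iff forall_4 vector_4_nth algebra_simps)
  fix Z assume "\<forall>p. k_field Z p = - field_bracket (k_field X) (k_field Y) p"
  \<comment> \<open>At the origin \<open>k_field Z 0 = Z\<close>, so one evaluation determines the
    element.\<close>
  from this[rule_format, of 0] show "Z = vector [0, X$1 * Y$2 - X$2 * Y$1, 0, 0]"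
    unfolding br by (simp add: k_field_def vec_eq_iff forall_4 vector_4_nth)
qed

lemma p_plus_in_so24: "p_plus i \<in> so24"
proof -
  have "0 \<in> so_nu"
    by (simp add: so_nu_def vec_eq_iff transpose_def matrix_matrix_mult_def)
  then show ?thesis unfolding p_plus_def so24_def by blast
qed

text \<open>Replaces a map that is linear only on a subspace by one to which the rules for
  derivatives and for \<open>exp_op\<close> apply.\<close>

lemma linear_extension_on_subspace:
  fixes f :: "'a::real_vector \<Rightarrow> 'b::real_vector"
  assumes V: "subspace V"
    and f: "\<And>u v a b. u \<in> V \<Longrightarrow> v \<in> V \<Longrightarrow> f (a *\<^sub>R u + b *\<^sub>R v) = a *\<^sub>R f u + b *\<^sub>R f v"
  obtains L where "linear L" "\<And>v. v \<in> V \<Longrightarrow> L v = f v"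
proof -
  obtain B where B: "B \<subseteq> V" "independent B" "V \<subseteq> span B"
    using basis_exists[of V] by metis
  obtain L where L: "linear L" "\<And>x. x \<in> B \<Longrightarrow> L x = f x"
    using linear_independent_extend[OF B(2), of f] by blast
  have "v \<in> V \<and> L v = f v" if "v \<in> span B" for v
    using that
  proof (induction rule: span_induct_alt)
    case base
    show ?case using f[of 0 0 0 0] V L(1) by (simp add: linear_0 subspace_0)
  next
    case (step c x y)
    then have "x \<in> V" using B(1) by auto
    then show ?case
      using step L V f[of x y c 1] by (simp add: linear_add linear_scale subspace_add subspace_scale)
  qed
  with that L(1) B(3) show thesis by blast
qed

section \<open>Modules over so(2,4) and the annihilator of the nilradical\<close>

locale so24_module =
  fixes V :: "'v::euclidean_space set" and \<rho> :: "real^6^6 \<Rightarrow> 'v \<Rightarrow> 'v"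
  assumes rep: "so24_rep V \<rho>"
begin

lemma subspace_V: "subspace V"
  and closed [simp]: "X \<in> so24 \<Longrightarrow> v \<in> V \<Longrightarrow> \<rho> X v \<in> V"
  and lincomb_vec: "X \<in> so24 \<Longrightarrow> u \<in> V \<Longrightarrow> v \<in> V \<Longrightarrow> \<rho> X (a *\<^sub>R u + b *\<^sub>R v) = a *\<^sub>R \<rho> X u + b *\<^sub>R \<rho> X v"
  and lincomb_mat: "X \<in> so24 \<Longrightarrow> Y \<in> so24 \<Longrightarrow> v \<in> V \<Longrightarrow> \<rho> (a *\<^sub>R X + b *\<^sub>R Y) v = a *\<^sub>R \<rho> X v + b *\<^sub>R \<rho> Y v"
  and rho_commutator: "X \<in> so24 \<Longrightarrow> Y \<in> so24 \<Longrightarrow> v \<in> V \<Longrightarrow> \<rho> (commutator X Y) v = \<rho> X (\<rho> Y v) - \<rho> Y (\<rho> X v)"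
  using rep unfolding so24_rep_def by simp_all

lemma V_closed [simp]:
  "0 \<in> V" "u \<in> V \<Longrightarrow> v \<in> V \<Longrightarrow> u + v \<in> V" "u \<in> V \<Longrightarrow> v \<in> V \<Longrightarrow> u - v \<in> V"
  "v \<in> V \<Longrightarrow> a *\<^sub>R v \<in> V" "v \<in> V \<Longrightarrow> - v \<in> V"
  using subspace_V by (auto intro: subspace_0 subspace_add subspace_diff subspace_scale subspace_neg)

lemma rho_vec [simp]:
  assumes X: "X \<in> so24"
  shows "\<rho> X 0 = 0"
    "u \<in> V \<Longrightarrow> v \<in> V \<Longrightarrow> \<rho> X (u + v) = \<rho> X u + \<rho> X v"
    "u \<in> V \<Longrightarrow> v \<in> V \<Longrightarrow> \<rho> X (u - v) = \<rho> X u - \<rho> X v"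
    "v \<in> V \<Longrightarrow> \<rho> X (a *\<^sub>R v) = a *\<^sub>R \<rho> X v"
    "v \<in> V \<Longrightarrow> \<rho> X (- v) = - \<rho> X v"
proof -
  show "\<rho> X 0 = 0"
    using lincomb_vec[OF X, of 0 0 0 0] by simp
  show "\<rho> X (u + v) = \<rho> X u + \<rho> X v" if "u \<in> V" "v \<in> V"
    using lincomb_vec[OF X that, of 1 1] by simp
  show "\<rho> X (u - v) = \<rho> X u - \<rho> X v" if "u \<in> V" "v \<in> V"
    using lincomb_vec[OF X that, of 1 "-1"] by simp
  show "\<rho> X (a *\<^sub>R v) = a *\<^sub>R \<rho> X v" if "v \<in> V"
    using lincomb_vec[OF X that that, of a 0] by simp
  show "\<rho> X (- v) = - \<rho> X v" if "v \<in> V"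
    using lincomb_vec[OF X that that, of "-1" 0] by simp
qed

lemma rho_mat:
  assumes v: "v \<in> V"
  shows "\<rho> 0 v = 0"
    "X \<in> so24 \<Longrightarrow> Y \<in> so24 \<Longrightarrow> \<rho> (X + Y) v = \<rho> X v + \<rho> Y v"
    "X \<in> so24 \<Longrightarrow> \<rho> (a *\<^sub>R X) v = a *\<^sub>R \<rho> X v"
proof -
  show "\<rho> 0 v = 0"
    using lincomb_mat[OF _ _ v, of 0 0 0 0] subspace_0[OF subspace_so24] by simp
  show "\<rho> (X + Y) v = \<rho> X v + \<rho> Y v" if "X \<in> so24" "Y \<in> so24"
    using lincomb_mat[OF that v, of 1 1] by simp
  show "\<rho> (a *\<^sub>R X) v = a *\<^sub>R \<rho> X v" if "X \<in> so24"
    using lincomb_mat[OF that that v, of a 0] by simp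
qed

lemma linear_extension:
  assumes X: "X \<in> so24"
  obtains L where "linear L" "\<And>v. v \<in> V \<Longrightarrow> L v = \<rho> X v"
  using linear_extension_on_subspace[OF subspace_V, of "\<rho> X"] lincomb_vec[OF X] by metis

lemma neg_null_subset: "neg_null V \<rho> \<subseteq> V"
  by (auto simp: neg_null_def)

lemma subspace_neg_null: "subspace (neg_null V \<rho>)"
  unfolding subspace_def neg_null_def by simp

lemma rho_neg_null: "v \<in> neg_null V \<rho> \<Longrightarrow> \<rho> (g_neg p q r s w) v = 0"
  by (simp add: neg_null_def)

text \<open>Block diagonal matrices normalise the nilradical.\<close>

lemma neg_null_g_zero:
  assumes "v \<in> neg_null V \<rho>"
  shows "\<rho> (g_zero a b c x z) v \<in> neg_null V \<rho>"
proof -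
  have v: "v \<in> V" using assms neg_null_subset by blast
  have "\<rho> (g_neg p q r s w) (\<rho> (g_zero a b c x z) v) = 0" for p q r s w
  proof -
    have "\<rho> (commutator (g_zero a b c x z) (g_neg p q r s w)) v = 0"
      unfolding commutator_g_zero_g_neg using assms by (rule rho_neg_null)
    then show ?thesis
      unfolding rho_commutator[OF g_in_so24(2,1) v] rho_neg_null[OF assms] by simp
  qed
  then show ?thesis using v by (simp add: neg_null_def)
qed

lemma neg_nullI:
  assumes v: "v \<in> V"
    and "\<rho> (g_neg 1 0 0 0 0) v = 0" "\<rho> (g_neg 0 1 0 0 0) v = 0" "\<rho> (g_neg 0 0 1 0 0) v = 0"
      "\<rho> (g_neg 0 0 0 1 0) v = 0" "\<rho> (g_neg 0 0 0 0 1) v = 0"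
  shows "v \<in> neg_null V \<rho>"
proof -
  let ?K = "{X \<in> so24. \<rho> X v = 0}"
  have K: "subspace ?K"
    using v by (intro subspaceI)
      (simp_all add: rho_mat subspace_0[OF subspace_so24] subspace_add[OF subspace_so24]
        subspace_scale[OF subspace_so24])
  have eq: "g_neg p q r s w = p *\<^sub>R g_neg 1 0 0 0 0 + q *\<^sub>R g_neg 0 1 0 0 0 + r *\<^sub>R g_neg 0 0 1 0 0
     + s *\<^sub>R g_neg 0 0 0 1 0 + w *\<^sub>R g_neg 0 0 0 0 1" for p q r s w
    by (simp add: g_add g_scaleR)
  have "g_neg p q r s w \<in> ?K" for p q r s w
    by (subst eq) (intro subspace_add[OF K] subspace_scale[OF K] CollectI conjI assms g_in_so24)
  then show ?thesis using v by (simp add: neg_null_def)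
qed

lemma rho_alpha_neg_null:
  assumes "v \<in> neg_null V \<rho>"
  shows "\<rho> (alpha X) v = X$1 *\<^sub>R \<rho> (g_zero 0 0 0 1 (1 / 2)) v"
proof -
  have v: "v \<in> V" using assms neg_null_subset by blast
  have "g_zero 0 0 0 (X$1) (X$1 / 2) = X$1 *\<^sub>R g_zero 0 0 0 1 (1 / 2)"
    by (simp add: g_scaleR)
  then have "\<rho> (g_zero 0 0 0 (X$1) (X$1 / 2)) v = X$1 *\<^sub>R \<rho> (g_zero 0 0 0 1 (1 / 2)) v"
    using v by (simp only: rho_mat g_in_so24)
  then show ?thesis
    unfolding alpha_eq using assms v by (simp add: rho_mat rho_neg_null)
qed

section \<open>Curvature conditions on parallel sections\<close>

text \<open>The left Maurer-Cartan form in coordinates: it expands a coordinate vector at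
  \<open>p\<close> in the invariant frame and so inverts \<open>inv_field\<close>.\<close>

definition frame_form :: "real^4 \<Rightarrow> real^4 \<Rightarrow> real^4" where
  "frame_form p h = vector [h$1, h$2 + h$1 * p$2, h$3, h$4 - h$2 * p$2]"

lemma inv_field_frame_form: "inv_field (frame_form p h) p = h"
  by (simp add: inv_field_def frame_form_def vec_eq_iff forall_4 vector_4_nth algebra_simps
      power2_eq_square)

lemma parallel_section_has_derivative:
  assumes "parallel_section V \<rho> U s" "open U" "p \<in> U"
  shows "(s has_derivative (\<lambda>h. - \<rho> (alpha (frame_form p h)) (s p))) (at p)"
proof -
  let ?D = "frechet_derivative s (at p)"
  have s: "(s has_derivative ?D) (at p)"
    using assms smooth_on_has_derivative unfolding parallel_section_def tractor_section_def by blast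
  have "?D h = - \<rho> (alpha (frame_form p h)) (s p)" for h
    using assms(1,3) inv_field_frame_form[of p h]
    unfolding parallel_section_def tractor_connection_def by (metis add_eq_0_iff minus_minus)
  then have "?D = (\<lambda>h. - \<rho> (alpha (frame_form p h)) (s p))" by (rule ext)
  with s show ?thesis by (simp only:)
qed

lemma parallel_section_in_V:
  "parallel_section V \<rho> U s \<Longrightarrow> p \<in> U \<Longrightarrow> s p \<in> V"
  unfolding parallel_section_def tractor_section_def by blast

text \<open>Symmetry of the second derivative of \<open>s\<close>, whose first derivative is minus
  the connection form. The vector on the right is the bracket in k of \<open>frame_form p i\<close>
  and \<open>frame_form p j\<close>, so the identity says that the curvature annihilates
  \<open>s p\<close>.\<close>

lemma parallel_section_curvature:
  assumes s: "parallel_section V \<rho> U s" and U: "open U" "p \<in> U"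
  shows "\<rho> (commutator (alpha (frame_form p i)) (alpha (frame_form p j))) (s p)
    = \<rho> (alpha (vector [0, i$1 * j$2 - j$1 * i$2, 0, 0])) (s p)"
proof -
  \<comment> \<open>The second derivative of \<open>s\<close>, first along \<open>i\<close>, then
    along \<open>h\<close>. The summand with \<open>h$2\<close> arises because
    \<open>frame_form\<close> depends on the point, affinely in its second coordinate.\<close>
  define D where "D i h = \<rho> (alpha (frame_form p i)) (\<rho> (alpha (frame_form p h)) (s p))
      - h$2 *\<^sub>R \<rho> (alpha (vector [0, i$1, 0, - i$2])) (s p)" for i h
  have D: "((\<lambda>q. - \<rho> (alpha (frame_form q i)) (s q)) has_derivative D i) (at p)" for i
  proof -
    let ?b = "vector [0, i$1, 0, - i$2]"
    obtain K L where K: "linear K" "\<And>v. v \<in> V \<Longrightarrow> K v = \<rho> (alpha i) v"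
      and L: "linear L" "\<And>v. v \<in> V \<Longrightarrow> L v = \<rho> (alpha ?b) v"
      using linear_extension[OF alpha_in_so24] by metis
    have ff: "alpha (frame_form q i) = alpha i + q$2 *\<^sub>R alpha ?b" for q
      by (simp add: alpha_def frame_form_def matrix6_simps vector_4_nth algebra_simps)
    have scaled: "q$2 *\<^sub>R alpha ?b \<in> so24" for q :: "real^4"
      using subspace_scale[OF subspace_so24 alpha_in_so24] .
    have val: "\<rho> (alpha (frame_form q i)) v = K v + q$2 *\<^sub>R L v" if "v \<in> V" for q v
      using that scaled[of q] K L by (simp add: ff rho_mat)
    let ?s' = "\<lambda>h. - \<rho> (alpha (frame_form p h)) (s p)"
    have "((\<lambda>q. - (K (s q) + q$2 *\<^sub>R L (s q))) has_derivative
        (\<lambda>h. - (K (?s' h) + (p$2 *\<^sub>R L (?s' h) + h$2 *\<^sub>R L (s p))))) (at p)"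
      using parallel_section_has_derivative[OF s U]
      by (intro has_derivative_minus has_derivative_add has_derivative_scaleR
          bounded_linear.has_derivative[of K] bounded_linear.has_derivative[of L]
          bounded_linear_imp_has_derivative[OF bounded_linear_vec_nth])
        (use K(1) L(1) in \<open>auto simp: linear_conv_bounded_linear\<close>)
    then have "((\<lambda>q. - \<rho> (alpha (frame_form q i)) (s q)) has_derivative
        (\<lambda>h. - (K (?s' h) + (p$2 *\<^sub>R L (?s' h) + h$2 *\<^sub>R L (s p))))) (at p)"
      by (rule has_derivative_transform_within_open[OF _ U])
        (use parallel_section_in_V[OF s] in \<open>simp add: val\<close>)
    then show ?thesis
    proof (rule has_derivative_eq_rhs)
      have sp: "s p \<in> V" using parallel_section_in_V[OF s U(2)] .
      have "- (K (?s' h) + (p$2 *\<^sub>R L (?s' h) + h$2 *\<^sub>R L (s p))) = D i h" for h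
        unfolding D_def using sp by (simp add: val K L)
      then show "(\<lambda>h. - (K (?s' h) + (p$2 *\<^sub>R L (?s' h) + h$2 *\<^sub>R L (s p)))) = D i" by blast
    qed
  qed
  have sp: "s p \<in> V" using parallel_section_in_V[OF s U(2)] .
  have "D i j = D j i"
    by (rule mixed_derivatives_eq[OF U parallel_section_has_derivative[OF s U(1)] D D])
  then have "\<rho> (commutator (alpha (frame_form p i)) (alpha (frame_form p j))) (s p)
    = j$2 *\<^sub>R \<rho> (alpha (vector [0, i$1, 0, - i$2])) (s p) - i$2 *\<^sub>R \<rho> (alpha (vector [0, j$1, 0, - j$2])) (s p)"
    using sp by (simp add: rho_commutator D_def algebra_simps)
  also have "\<dots> = \<rho> (j$2 *\<^sub>R alpha (vector [0, i$1, 0, - i$2]) + (- i$2) *\<^sub>R alpha (vector [0, j$1, 0, - j$2])) (s p)"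
    by (subst lincomb_mat[OF alpha_in_so24 alpha_in_so24 sp]) simp
  also have "j$2 *\<^sub>R alpha (vector [0, i$1, 0, - i$2]) + (- i$2) *\<^sub>R alpha (vector [0, j$1, 0, - j$2])
    = alpha (vector [0, i$1 * j$2 - j$1 * i$2, 0, 0])"
    by (simp add: alpha_def matrix6_simps vector_4_nth algebra_simps)
  finally show ?thesis .
qed

text \<open>Differentiating \<open>\<rho> X (s q) = 0\<close> shows that \<open>X\<close> also kills
  \<open>\<rho> (alpha _) (s p)\<close>, and the product in the other order vanishes anyway.
  Annihilating elements may thus be bracketed with the connection form.\<close>

lemma parallel_section_annihilator:
  assumes s: "parallel_section V \<rho> U s" and U: "open U" "p \<in> U"
    and X: "X \<in> so24" "\<And>q. q \<in> U \<Longrightarrow> \<rho> X (s q) = 0"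
  shows "\<rho> (commutator X (alpha (frame_form p h))) (s p) = 0"
proof -
  obtain L where L: "linear L" "\<And>v. v \<in> V \<Longrightarrow> L v = \<rho> X v"
    using linear_extension[OF X(1)] by metis
  have sp: "s p \<in> V" using parallel_section_in_V[OF s U(2)] .
  have "((\<lambda>q. L (s q)) has_derivative (\<lambda>h. L (- \<rho> (alpha (frame_form p h)) (s p)))) (at p)"
    using parallel_section_has_derivative[OF s U] L(1)
    by (intro bounded_linear.has_derivative[of L]) (auto simp: linear_conv_bounded_linear)
  moreover have "((\<lambda>q. L (s q)) has_derivative (\<lambda>h. 0)) (at p)"
    by (rule has_derivative_transform_within_open[OF has_derivative_const U])
      (use X(2) L(2) parallel_section_in_V[OF s] in simp)
  ultimately have "L (- \<rho> (alpha (frame_form p h)) (s p)) = 0"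
    by (metis has_derivative_unique)
  then show ?thesis
    using sp X U L by (simp add: rho_commutator)
qed

lemma parallel_section_neg_null:
  assumes s: "parallel_section V \<rho> U s" and U: "open U" and p: "p \<in> U"
  shows "s p \<in> neg_null V \<rho>"
proof -
  have sV: "s q \<in> V" if "q \<in> U" for q using parallel_section_in_V[OF s that] .

  have al: "alpha (frame_form q (axis 1 1)) = g_neg (q$2) 0 (- q$2) 0 0 + g_zero 0 0 0 1 (1 / 2)"
    "alpha (frame_form q (axis 2 1)) = g_neg 1 0 (- 1) 0 (- q$2) + g_zero 0 0 0 0 0"
    "alpha (frame_form q (axis 3 1)) = g_neg 0 1 0 0 0 + g_zero 0 0 0 0 0" for q
    by (simp_all add: alpha_eq frame_form_def vector_4_nth axis_def)
  \<comment> \<open>Curvature on the first two coordinate directions: the bracket of the two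
    matrices is \<open>g_neg 1 0 (- 1 / 2) 0 0\<close>, whereas \<open>alpha\<close> of the bracket
    in k is \<open>g_neg 1 0 (- 1) 0 0\<close>. The difference is half of
    \<open>g_neg 0 0 1 0 0\<close>.\<close>
  have k3: "\<rho> (g_neg 0 0 1 0 0) (s q) = 0" if "q \<in> U" for q
  proof -
    have "\<rho> (g_neg 1 0 (- 1 / 2) 0 0) (s q) = \<rho> (g_neg 1 0 (- 1) 0 0) (s q)"
      using parallel_section_curvature[OF s U that, of "axis 1 1" "axis 2 1", unfolded al]
      by (simp add: commutator_add commutator_zero commutator_g_neg_g_neg commutator_g_zero_g_neg alpha_eq
          vector_4_nth axis_def g_add)
    moreover have "g_neg 0 0 1 0 0 = 2 *\<^sub>R g_neg 1 0 (- 1 / 2) 0 0 + (- 2) *\<^sub>R g_neg 1 0 (- 1) 0 0"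
      by (simp add: g_add g_scaleR)
    ultimately show ?thesis
      using lincomb_mat[of "g_neg 1 0 (- 1 / 2) 0 0" "g_neg 1 0 (- 1) 0 0" "s q" 2 "-2"] sV[OF that]
      by (simp del: g_sums_zero)
  qed
  \<comment> \<open>In directions 1 and 3 the bracket in k is zero, so the bracket of the matrices
    itself annihilates the section.\<close>
  have k4: "\<rho> (g_neg 0 0 0 1 0) (s q) = 0" if "q \<in> U" for q
  proof -
    have "alpha (vector [0, 0, 0, 0]) = 0" by (simp add: alpha_eq vector_4_nth)
    then have "\<rho> (g_neg 0 0 0 (- 1 / 2) 0) (s q) = 0"
      using parallel_section_curvature[OF s U that, of "axis 1 1" "axis 3 1", unfolded al] sV[OF that]
      by (simp add: commutator_add commutator_zero commutator_g_neg_g_neg commutator_g_zero_g_neg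
          axis_def rho_mat)
    moreover have "g_neg 0 0 0 1 0 = (- 2) *\<^sub>R g_neg 0 0 0 (- 1 / 2) 0"
      by (simp add: g_scaleR)
    ultimately show ?thesis
      using rho_mat(3)[OF sV[OF that] g_in_so24(1), of "-2" 0 0 0 "- 1 / 2" 0] by simp
  qed
  \<comment> \<open>The bracket of \<open>g_neg 0 0 1 0 0\<close> with direction 2 lies in degree
    -2.\<close>
  have k5: "\<rho> (g_neg 0 0 0 0 1) (s p) = 0"
  proof -
    have "\<rho> (g_neg 0 0 0 0 (- 1)) (s p) = 0"
      using parallel_section_annihilator[OF s U p _ k3, of "axis 2 1", unfolded al]
      by (simp add: commutator_zero commutator_g_neg_g_neg)
    moreover have "g_neg 0 0 0 0 1 = (- 1) *\<^sub>R g_neg 0 0 0 0 (- 1)"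
      by (simp add: g_scaleR)
    ultimately show ?thesis
      using rho_mat(3)[OF sV[OF p] g_in_so24(1), of "-1" 0 0 0 0 "-1"] by simp
  qed
  have strip: "\<rho> (g_neg a b 0 0 0) (s p) = 0" if "\<rho> (g_neg a b 0 0 w) (s p) = 0" for a b w
  proof -
    have "g_neg a b 0 0 0 = 1 *\<^sub>R g_neg a b 0 0 w + (- w) *\<^sub>R g_neg 0 0 0 0 1"
      by (simp add: g_add g_scaleR)
    then show ?thesis
      using lincomb_mat[of "g_neg a b 0 0 w" "g_neg 0 0 0 0 1" "s p" 1 "- w"] sV[OF p] k5 that by simp
  qed
  have expand: "commutator A (C + D) = commutator A C - commutator D A" for A C D
    using commutator_swap[of A D] by (simp add: commutator_add)
  have diff: "g_neg a b c d e - g_neg a' b' c' d' e' = g_neg (a - a') (b - b') (c - c') (d - d') (e - e')"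
    for a b c d e a' b' c' d' e'
    by (simp add: g_neg_def matrix6_simps)
  \<comment> \<open>Brackets with direction 1 carry the elements of \<open>k3\<close> and
    \<open>k4\<close> to the two missing ones of degree -1. The first bracket has an additional
    degree -2 part depending on the point, which \<open>strip\<close> removes.\<close>
  have "\<rho> (g_neg 1 0 0 0 (- p$2)) (s p) = 0"
    using parallel_section_annihilator[OF s U p _ k3, of "axis 1 1", unfolded al expand]
    by (simp add: commutator_g_neg_g_neg commutator_g_zero_g_neg diff)
  moreover have "\<rho> (g_neg 0 1 0 0 0) (s p) = 0"
    using parallel_section_annihilator[OF s U p _ k4, of "axis 1 1", unfolded al expand]
    using diff[of 0 0 0 0 0 0 "- 1" 0 0 0]
    by (simp add: commutator_g_neg_g_neg commutator_g_zero_g_neg)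
  ultimately show ?thesis
    using sV[OF p] k3[OF p] k4[OF p] k5 strip by (intro neg_nullI) auto
qed

section \<open>The flow on the annihilator\<close>

lemma axial_flow_extension:
  obtains M where "linear M" "\<And>v. v \<in> neg_null V \<rho> \<Longrightarrow> M v = - \<rho> (g_zero 0 0 0 1 (1 / 2)) v"
    "\<And>t v. v \<in> neg_null V \<rho> \<Longrightarrow> axial_flow \<rho> t v = exp_op (\<lambda>u. t *\<^sub>R M u) v"
proof -
  obtain L where L: "linear L" "\<And>v. v \<in> V \<Longrightarrow> L v = \<rho> (g_zero 0 0 0 1 (1 / 2)) v"
    using linear_extension[OF g_in_so24(2)] by metis
  let ?M = "\<lambda>v. - L v"
  have M: "?M v = - \<rho> (g_zero 0 0 0 1 (1 / 2)) v" if "v \<in> neg_null V \<rho>" for v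
    using that L neg_null_subset by auto
  have "axial_flow \<rho> t v = exp_op (\<lambda>u. t *\<^sub>R ?M u) v" if "v \<in> neg_null V \<rho>" for t v
    unfolding axial_flow_def
  proof (rule exp_op_cong_on[OF _ _ that])
    fix u assume u: "u \<in> neg_null V \<rho>"
    show "- (t *\<^sub>R \<rho> (g_zero 0 0 0 1 (1 / 2)) u) = t *\<^sub>R ?M u" using M[OF u] by simp
    show "t *\<^sub>R ?M u \<in> neg_null V \<rho>"
      unfolding M[OF u] using u subspace_neg_null
      by (intro subspace_scale subspace_neg neg_null_g_zero)
  qed
  moreover have "linear ?M" using L(1) by (rule linear_compose_neg)
  ultimately show thesis using that M by blast
qed

lemma axial_flow_neg_null:
  assumes "v \<in> neg_null V \<rho>"
  shows "axial_flow \<rho> t v \<in> neg_null V \<rho>"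
proof -
  obtain M where M: "linear M" "\<And>v. v \<in> neg_null V \<rho> \<Longrightarrow> M v = - \<rho> (g_zero 0 0 0 1 (1 / 2)) v"
    "\<And>t v. v \<in> neg_null V \<rho> \<Longrightarrow> axial_flow \<rho> t v = exp_op (\<lambda>u. t *\<^sub>R M u) v"
    using axial_flow_extension by metis
  show ?thesis
    unfolding M(3)[OF assms]
  proof (rule exp_op_closed[OF linear_compose_scale_right[OF M(1)] subspace_neg_null _ assms])
    fix u assume u: "u \<in> neg_null V \<rho>"
    show "t *\<^sub>R M u \<in> neg_null V \<rho>"
      unfolding M(2)[OF u] using u subspace_neg_null
      by (intro subspace_scale subspace_neg neg_null_g_zero)
  qed
qed

lemma axial_flow_zero: "axial_flow \<rho> 0 v = v"
  unfolding axial_flow_def by (simp add: exp_op_zero)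

lemma axial_flow_diff:
  assumes "u \<in> neg_null V \<rho>" "v \<in> neg_null V \<rho>"
  shows "axial_flow \<rho> t (u - v) = axial_flow \<rho> t u - axial_flow \<rho> t v"
proof -
  obtain M where M: "linear M"
    "\<And>t v. v \<in> neg_null V \<rho> \<Longrightarrow> axial_flow \<rho> t v = exp_op (\<lambda>u. t *\<^sub>R M u) v"
    using axial_flow_extension by metis
  show ?thesis
    using assms subspace_diff[OF subspace_neg_null assms] linear_diff[OF linear_exp_op[OF M(1)]]
    by (simp add: M(2))
qed

lemma has_vector_derivative_axial_flow:
  assumes "v \<in> neg_null V \<rho>"
  shows "((\<lambda>t. axial_flow \<rho> t v) has_vector_derivative
      - axial_flow \<rho> t (\<rho> (g_zero 0 0 0 1 (1 / 2)) v)) (at t)"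
    "\<rho> (g_zero 0 0 0 1 (1 / 2)) (axial_flow \<rho> t v) = axial_flow \<rho> t (\<rho> (g_zero 0 0 0 1 (1 / 2)) v)"
proof -
  let ?A = "\<rho> (g_zero 0 0 0 1 (1 / 2))"
  obtain M where M: "linear M" "\<And>v. v \<in> neg_null V \<rho> \<Longrightarrow> M v = - ?A v"
    "\<And>t v. v \<in> neg_null V \<rho> \<Longrightarrow> axial_flow \<rho> t v = exp_op (\<lambda>u. t *\<^sub>R M u) v"
    using axial_flow_extension by metis
  have Av: "?A v \<in> neg_null V \<rho>" using assms by (rule neg_null_g_zero)
  have *: "exp_op (\<lambda>u. t *\<^sub>R M u) (M v) = - axial_flow \<rho> t (?A v)"
    unfolding M(2)[OF assms] M(3)[OF Av] by (rule linear_neg[OF linear_exp_op[OF M(1)]])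
  show "((\<lambda>t. axial_flow \<rho> t v) has_vector_derivative - axial_flow \<rho> t (?A v)) (at t)"
    unfolding M(3)[OF assms] *[symmetric] by (rule has_vector_derivative_exp_op[OF M(1)])
  have "M (axial_flow \<rho> t v) = - axial_flow \<rho> t (?A v)"
    unfolding M(3)[OF assms] exp_op_commute[OF M(1)] by (rule *)
  then show "?A (axial_flow \<rho> t v) = axial_flow \<rho> t (?A v)"
    using M(2)[OF axial_flow_neg_null[OF assms], of t] by simp
qed

lemma parallel_section_axial_flow:
  assumes "v \<in> neg_null V \<rho>"
  shows "parallel_section V \<rho> U (\<lambda>p. axial_flow \<rho> (p$1) v)"
  unfolding parallel_section_def tractor_section_def
proof (intro conjI ballI allI)
  let ?A = "\<rho> (g_zero 0 0 0 1 (1 / 2))"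
  obtain M where M: "linear M" "\<And>v. v \<in> neg_null V \<rho> \<Longrightarrow> M v = - ?A v"
    "\<And>t v. v \<in> neg_null V \<rho> \<Longrightarrow> axial_flow \<rho> t v = exp_op (\<lambda>u. t *\<^sub>R M u) v"
    using axial_flow_extension by metis
  show "smooth_on U (\<lambda>p. axial_flow \<rho> (p$1) v)"
    unfolding M(3)[OF assms] by (rule smooth_on_exp_op_coordinate[OF M(1) bounded_linear_ident])
  show "(\<lambda>p. axial_flow \<rho> (p$1) v) ` U \<subseteq> V"
    using axial_flow_neg_null[OF assms] neg_null_subset by blast
  fix p :: "real^4" and Y :: "real^4"
  have "((\<lambda>p. axial_flow \<rho> (p$1) v) has_derivative
      (\<lambda>h. h$1 *\<^sub>R M (axial_flow \<rho> (p$1) v))) (at p)"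
    unfolding M(3)[OF assms] exp_op_commute[OF M(1)]
    by (rule has_derivative_exp_op_coordinate[OF M(1) bounded_linear_ident])
  from frechet_derivative_at[OF this, symmetric]
  show "tractor_connection \<rho> (\<lambda>p. axial_flow \<rho> (p$1) v) Y p = 0"
    unfolding tractor_connection_def rho_alpha_neg_null[OF axial_flow_neg_null[OF assms]]
    by (simp add: M(2)[OF axial_flow_neg_null[OF assms]] inv_field_def vector_4_nth)
qed

text \<open>Since all values lie in the annihilator, parallelism is a linear equation in the first
  coordinate alone. The difference from the flow of \<open>s 0\<close> solves it and vanishes at the
  origin.\<close>

lemma parallel_section_eq_axial_flow:
  assumes U: "neighbourhood U" and s: "parallel_section V \<rho> U s" and p: "p \<in> U"
  shows "s 0 \<in> neg_null V \<rho>" "s p = axial_flow \<rho> (p$1) (s 0)"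
proof -
  have U': "open U" "connected U" "0 \<in> U" using U unfolding neighbourhood_def by auto
  show s0: "s 0 \<in> neg_null V \<rho>" using parallel_section_neg_null[OF s U'(1,3)] .
  let ?A = "\<rho> (g_zero 0 0 0 1 (1 / 2))" and ?f = "\<lambda>p. axial_flow \<rho> (p$1) (s 0)"
  obtain M where M: "linear M" "\<And>v. v \<in> neg_null V \<rho> \<Longrightarrow> M v = - ?A v"
    using axial_flow_extension by metis
  have der: "(f has_derivative (\<lambda>h. h$1 *\<^sub>R M (f q))) (at q)"
    if "q \<in> U" "parallel_section V \<rho> U f" for f q
  proof (rule has_derivative_eq_rhs[OF parallel_section_has_derivative[OF that(2) U'(1) that(1)]])
    have fq: "f q \<in> neg_null V \<rho>" using parallel_section_neg_null[OF that(2) U'(1) that(1)] .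
    show "(\<lambda>h. - \<rho> (alpha (frame_form q h)) (f q)) = (\<lambda>h. h$1 *\<^sub>R M (f q))"
      unfolding rho_alpha_neg_null[OF fq] M(2)[OF fq] by (simp add: frame_form_def vector_4_nth)
  qed
  have f: "parallel_section V \<rho> U ?f" using s0 by (rule parallel_section_axial_flow)
  have "s p - ?f p = 0"
  proof (rule linear_ode_unique_on_connected[OF M(1) U' _ _ p, of "\<lambda>p. s p - ?f p"])
    fix q assume q: "q \<in> U"
    show "((\<lambda>p. s p - ?f p) has_derivative (\<lambda>h. h$1 *\<^sub>R M (s q - ?f q))) (at q)"
      using has_derivative_diff[OF der[OF q s] der[OF q f]]
      by (simp add: linear_diff[OF M(1)] scaleR_diff_right)
  qed (simp add: axial_flow_zero)
  then show "s p = ?f p" by simp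
qed

lemma normal_values_eq_neg_null: "normal_values V \<rho> = neg_null V \<rho>"
proof (intro equalityI subsetI)
  fix v assume "v \<in> normal_values V \<rho>"
  then show "v \<in> neg_null V \<rho>"
    unfolding normal_values_def using parallel_section_neg_null by blast
next
  fix v assume v: "v \<in> neg_null V \<rho>"
  then have "v = axial_flow \<rho> ((0 :: real^4)$1) v" by (simp add: axial_flow_zero)
  then show "v \<in> normal_values V \<rho>"
    unfolding normal_values_def using parallel_section_axial_flow[OF v, of UNIV]
    by (intro CollectI exI[of _ "\<lambda>p. axial_flow \<rho> (p$1) v"] exI[of _ UNIV]) auto
qed

lemma parallel_section_iff:
  assumes U: "neighbourhood U"
  shows "parallel_section V \<rho> U s \<longleftrightarrow> (\<exists>v\<in>neg_null V \<rho>. \<forall>p\<in>U. s p = axial_flow \<rho> (p$1) v)"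
proof
  assume s: "parallel_section V \<rho> U s"
  then show "\<exists>v\<in>neg_null V \<rho>. \<forall>p\<in>U. s p = axial_flow \<rho> (p$1) v"
    using parallel_section_eq_axial_flow[OF U s] U unfolding neighbourhood_def by blast
next
  assume "\<exists>v\<in>neg_null V \<rho>. \<forall>p\<in>U. s p = axial_flow \<rho> (p$1) v"
  then obtain v where v: "v \<in> neg_null V \<rho>" and eq: "\<And>p. p \<in> U \<Longrightarrow> s p = axial_flow \<rho> (p$1) v"
    by blast
  have op: "open U" using U unfolding neighbourhood_def by blast
  note par = parallel_section_axial_flow[OF v, of U]
  have "smooth_on U s \<longleftrightarrow> smooth_on U (\<lambda>p. axial_flow \<rho> (p$1) v)"
    using op eq by (rule smooth_on_cong)
  then have "smooth_on U s"
    using par unfolding parallel_section_def tractor_section_def by simp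
  moreover have "s ` U \<subseteq> V"
    using par eq unfolding parallel_section_def tractor_section_def by auto
  moreover have "tractor_connection \<rho> s Y p = 0" if p: "p \<in> U" for Y p
  proof -
    have "frechet_derivative s (at p) = frechet_derivative (\<lambda>p. axial_flow \<rho> (p$1) v) (at p)"
      using op p eq by (rule frechet_derivative_cong_open)
    moreover have "tractor_connection \<rho> (\<lambda>p. axial_flow \<rho> (p$1) v) Y p = 0"
      using par p unfolding parallel_section_def by blast
    ultimately show ?thesis unfolding tractor_connection_def by (simp add: eq[OF p])
  qed
  ultimately show "parallel_section V \<rho> U s"
    unfolding parallel_section_def tractor_section_def by blast
qed

section \<open>Normal solutions as projections of the flow\<close>

lemma normal_solution_iff:
  assumes U: "neighbourhood U"
  shows "normal_solution V \<rho> U \<sigma> \<longleftrightarrow>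
    (\<exists>v\<in>neg_null V \<rho>. \<forall>p\<in>U. \<sigma> p = lowest_proj V \<rho> (axial_flow \<rho> (p$1) v))"
proof
  assume "normal_solution V \<rho> U \<sigma>"
  then obtain s where s: "bgg_splitting V \<rho> U \<sigma> s" "parallel_section V \<rho> U s"
    unfolding normal_solution_def by blast
  then show "\<exists>v\<in>neg_null V \<rho>. \<forall>p\<in>U. \<sigma> p = lowest_proj V \<rho> (axial_flow \<rho> (p$1) v)"
    unfolding parallel_section_iff[OF U] bgg_splitting_def by metis
next
  assume "\<exists>v\<in>neg_null V \<rho>. \<forall>p\<in>U. \<sigma> p = lowest_proj V \<rho> (axial_flow \<rho> (p$1) v)"
  then obtain v where v: "v \<in> neg_null V \<rho>"
    and eq: "\<And>p. p \<in> U \<Longrightarrow> \<sigma> p = lowest_proj V \<rho> (axial_flow \<rho> (p$1) v)" by blast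
  let ?s = "\<lambda>p. axial_flow \<rho> (p$1) v"
  have par: "parallel_section V \<rho> U ?s" using v by (rule parallel_section_axial_flow)
  then have 0: "tractor_derivative \<rho> ?s p = (\<lambda>_. 0)" if "p \<in> U" for p
    using that unfolding parallel_section_def tractor_derivative_def by blast
  have split: "bgg_splitting V \<rho> U \<sigma> ?s"
    using par eq unfolding bgg_splitting_def parallel_section_def
    by (auto simp: 0 codiff1_def p_plus_in_so24)
  \<comment> \<open>The tractor derivative of a parallel section is zero, hence the codifferential
    of the zero two-form, so the BGG operator vanishes on its projection.\<close>
  have "codiff2 \<rho> (\<lambda>_ _. 0) = (\<lambda>_. 0)"
    by (simp add: fun_eq_iff codiff2_def p_plus_in_so24)
  then have z: "(\<lambda>_. 0) \<in> codiff2 \<rho> ` {\<psi>. \<forall>i j. \<psi> i j \<in> V \<and> \<psi> i j = - \<psi> j i}"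
    by (intro rev_image_eqI[of "\<lambda>_ _. 0"]) auto
  have "tractor_derivative \<rho> ?s p \<in>
      codiff2 \<rho> ` {\<psi>. \<forall>i j. \<psi> i j \<in> V \<and> \<psi> i j = - \<psi> j i}" if "p \<in> U" for p
    unfolding 0[OF that] by (rule z)
  then show "normal_solution V \<rho> U \<sigma>"
    unfolding normal_solution_def bgg_solution_def using split par by blast
qed

lemma solution_of_iff:
  assumes v: "v \<in> neg_null V \<rho>"
  shows "solution_of V \<rho> U v \<sigma> \<longleftrightarrow> (\<forall>p\<in>U. \<sigma> p = lowest_proj V \<rho> (axial_flow \<rho> (p$1) v))"
proof -
  have "exp_op (\<lambda>u. - Phi \<rho> Y u) v = axial_flow \<rho> (p$1) v" if "k_exp Y p" for Y p
    unfolding axial_flow_def k_exp_first_coordinate[OF that] Phi_def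
    by (rule exp_op_cong_on[OF _ _ v])
      (simp_all add: rho_alpha_neg_null subspace_neg[OF subspace_neg_null]
        subspace_scale[OF subspace_neg_null] neg_null_g_zero)
  then have "solution_of V \<rho> U v \<sigma> \<longleftrightarrow>
      (\<forall>Y p. k_exp Y p \<and> p \<in> U \<longrightarrow> \<sigma> p = lowest_proj V \<rho> (axial_flow \<rho> (p$1) v))"
    unfolding solution_of_def by auto
  then show ?thesis using k_exp_surj by blast
qed

lemma k_rep_neg_null: "k_rep (neg_null V \<rho>) (Phi \<rho>)"
proof -
  have V: "v \<in> V" if "v \<in> neg_null V \<rho>" for v using that neg_null_subset by blast
  have lc: "a *\<^sub>R u + b *\<^sub>R v \<in> neg_null V \<rho>" if "u \<in> neg_null V \<rho>" "v \<in> neg_null V \<rho>" for a b u v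
    using that by (intro subspace_add subspace_scale subspace_neg_null)
  have "k_bracket X Y $ 1 = 0" for X Y by (simp add: k_bracket_eq vector_4_nth)
  then show ?thesis
    unfolding k_rep_def Phi_def
    using subspace_neg_null
    by (auto simp: rho_alpha_neg_null neg_null_g_zero subspace_scale[OF subspace_neg_null] lc V
        scaleR_add_left scaleR_add_right mult.commute)
qed

text \<open>Uniqueness becomes a property of the flow: \<open>U\<close> contains the points
  \<open>axis 1 t\<close> for small \<open>t\<close>, and along them the difference of two
  candidates projects to zero.\<close>

lemma parametrises_normal_solutionsI:
  assumes inj: "\<And>w e. w \<in> neg_null V \<rho> \<Longrightarrow> 0 < e \<Longrightarrow>
      (\<And>t. \<bar>t\<bar> < e \<Longrightarrow> lowest_proj V \<rho> (axial_flow \<rho> t w) = 0) \<Longrightarrow> w = 0"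
    and diff: "\<And>u v. u \<in> V \<Longrightarrow> v \<in> V \<Longrightarrow>
      lowest_proj V \<rho> (u - v) = lowest_proj V \<rho> u - lowest_proj V \<rho> v"
  shows "parametrises_normal_solutions V \<rho> (neg_null V \<rho>)"
  unfolding parametrises_normal_solutions_def
proof (intro allI impI)
  fix U \<sigma> assume U: "neighbourhood U"
  then have op: "open U" "0 \<in> U" unfolding neighbourhood_def by auto
  then obtain e where e: "0 < e" "ball 0 e \<subseteq> U" by (meson openE)
  have "u = v" if u: "u \<in> neg_null V \<rho>" "\<And>p. p \<in> U \<Longrightarrow> \<sigma> p = lowest_proj V \<rho> (axial_flow \<rho> (p$1) u)"
    and v: "v \<in> neg_null V \<rho>" "\<And>p. p \<in> U \<Longrightarrow> \<sigma> p = lowest_proj V \<rho> (axial_flow \<rho> (p$1) v)" for u v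
  proof -
    have "lowest_proj V \<rho> (axial_flow \<rho> t (u - v)) = 0" if "\<bar>t\<bar> < e" for t
    proof -
      have "axis 1 t = t *\<^sub>R (axis 1 1 :: real^4)" by (simp add: vec_eq_iff axis_def)
      then have "axis 1 t \<in> U" using that e(2) by (auto simp: subset_eq norm_axis_1)
      then show ?thesis
        unfolding axial_flow_diff[OF u(1) v(1)]
        using u(2)[of "axis 1 t"] v(2)[of "axis 1 t"]
          diff[OF subsetD[OF neg_null_subset axial_flow_neg_null[OF u(1)]]
            subsetD[OF neg_null_subset axial_flow_neg_null[OF v(1)]]]
        by (simp add: axis_nth)
    qed
    then have "u - v = 0"
      using inj[OF subspace_diff[OF subspace_neg_null u(1) v(1)] e(1)] by blast
    then show ?thesis by simp
  qed
  then have "normal_solution V \<rho> U \<sigma> \<longleftrightarrow> (\<exists>!v. v \<in> neg_null V \<rho> \<and>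
      (\<forall>p\<in>U. \<sigma> p = lowest_proj V \<rho> (axial_flow \<rho> (p$1) v)))"
    unfolding normal_solution_iff[OF U] by blast
  also have "\<dots> \<longleftrightarrow> (\<exists>!v. v \<in> neg_null V \<rho> \<and> solution_of V \<rho> U v \<sigma>)"
    by (rule arg_cong[where f = Ex1]) (auto simp: solution_of_iff fun_eq_iff)
  finally show "normal_solution V \<rho> U \<sigma> \<longleftrightarrow> (\<exists>!v. v \<in> neg_null V \<rho> \<and> solution_of V \<rho> U v \<sigma>)" .
qed

text \<open>Differentiation in \<open>t\<close>: if the flow of \<open>w\<close> stays in the kernel
  of \<open>P\<close>, so does the flow of the generator applied to \<open>w\<close>. This provides
  the recursion by which the projection is shown to lose nothing.\<close>

lemma axial_flow_kernel:
  fixes P :: "'v \<Rightarrow> 'b::euclidean_space"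
  assumes P: "linear P" and w: "w \<in> neg_null V \<rho>"
    and 0: "\<And>t. \<bar>t\<bar> < e \<Longrightarrow> P (axial_flow \<rho> t w) = 0" and t: "\<bar>t\<bar> < e"
  shows "P (axial_flow \<rho> t (\<rho> (g_zero 0 0 0 1 (1 / 2)) w)) = 0"
proof -
  have "bounded_linear P" using P by (simp add: linear_conv_bounded_linear)
  from bounded_linear.has_vector_derivative[OF this has_vector_derivative_axial_flow(1)[OF w]]
  have 1: "((\<lambda>t. P (axial_flow \<rho> t w)) has_vector_derivative
      P (- axial_flow \<rho> t (\<rho> (g_zero 0 0 0 1 (1 / 2)) w))) (at t)" .
  have "((\<lambda>t. P (axial_flow \<rho> t w)) has_vector_derivative 0) (at t)"
    by (rule has_vector_derivative_transform_within_open[of "\<lambda>_. 0" _ _ "{- e<..<e}"])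
      (use 0 t in auto)
  from vector_derivative_unique_at[OF 1 this] show ?thesis
    by (simp add: linear_neg[OF P])
qed

lemma axial_flow_fixed:
  assumes "\<rho> (g_zero 0 0 0 1 (1 / 2)) v = 0" "v \<in> V"
  shows "axial_flow \<rho> t v = v"
proof -
  have "exp_op (\<lambda>u. - (t *\<^sub>R \<rho> (g_zero 0 0 0 1 (1 / 2)) u)) v = exp_op (\<lambda>u. 0) v"
    by (rule exp_op_cong_on[of "{v, 0}"]) (use assms in auto)
  then show ?thesis unfolding axial_flow_def by (simp add: exp_op_zero)
qed

section \<open>Eigenspaces and sl(2)-strings\<close>

definition eigenspace :: "real^6^6 \<Rightarrow> real \<Rightarrow> 'v set" where
  "eigenspace Z r = {v \<in> V. \<rho> Z v = r *\<^sub>R v}"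

text \<open>For \<open>grading_elt\<close> and its lowest eigenvalue this is the complement along
  which \<open>lowest_proj\<close> projects.\<close>

definition above :: "real^6^6 \<Rightarrow> real \<Rightarrow> 'v set" where
  "above Z r = span {v \<in> V. \<exists>s>r. \<rho> Z v = s *\<^sub>R v}"

text \<open>The inclusion \<open>V \<subseteq> from_on Z r\<close> says that \<open>Z\<close> is
  diagonalisable on \<open>V\<close> over the reals, with no eigenvalue below
  \<open>r\<close>.\<close>

definition from_on :: "real^6^6 \<Rightarrow> real \<Rightarrow> 'v set" where
  "from_on Z r = span {v \<in> V. \<exists>s\<ge>r. \<rho> Z v = s *\<^sub>R v}"

lemma eigenspace_subset: "eigenspace Z r \<subseteq> V"
  by (auto simp: eigenspace_def)

lemma subspace_eigenspace: "Z \<in> so24 \<Longrightarrow> subspace (eigenspace Z r)"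
  unfolding eigenspace_def by (intro subspaceI) (simp_all add: scaleR_add_right)

lemma above_subset: "above Z r \<subseteq> V"
  unfolding above_def by (rule span_minimal[OF _ subspace_V]) blast

lemma from_on_subset: "from_on Z r \<subseteq> V"
  unfolding from_on_def by (rule span_minimal[OF _ subspace_V]) blast

lemma aboveI: "v \<in> V \<Longrightarrow> \<rho> Z v = s *\<^sub>R v \<Longrightarrow> r < s \<Longrightarrow> v \<in> above Z r"
  unfolding above_def by (intro span_base) blast

lemma from_onI: "v \<in> V \<Longrightarrow> \<rho> Z v = s *\<^sub>R v \<Longrightarrow> r \<le> s \<Longrightarrow> v \<in> from_on Z r"
  unfolding from_on_def by (intro span_base) blast

lemma eigenspace_raise:
  assumes Z: "Z \<in> so24" "X \<in> so24" "commutator Z X = d *\<^sub>R X" and v: "v \<in> V" "\<rho> Z v = r *\<^sub>R v"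
  shows "\<rho> Z (\<rho> X v) = (r + d) *\<^sub>R \<rho> X v"
proof -
  have "\<rho> Z (\<rho> X v) = \<rho> X (\<rho> Z v) + \<rho> (commutator Z X) v"
    using rho_commutator[OF Z(1,2) v(1)] by simp
  then show ?thesis
    unfolding Z(3) v(2) using Z v(1) by (simp add: rho_mat scaleR_add_left)
qed

lemma additive_span_into:
  assumes S: "S \<subseteq> V" and f: "\<And>u v. u \<in> V \<Longrightarrow> v \<in> V \<Longrightarrow> f (u + v) = f u + f v"
    "\<And>v a. v \<in> V \<Longrightarrow> f (a *\<^sub>R v) = a *\<^sub>R f v"
    and W: "subspace W" "\<And>x. x \<in> S \<Longrightarrow> f x \<in> W" and v: "v \<in> span S"
  shows "f v \<in> W"
proof -
  have "v \<in> V \<and> f v \<in> W"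
    using v
  proof (induction rule: span_induct_alt)
    case base
    show ?case using f(2)[of 0 0] W(1) by (simp add: subspace_0)
  next
    case (step c x y)
    then have x: "x \<in> V" "f x \<in> W" using S W(2) by auto
    then show ?case
      using step W(1) by (simp add: f subspace_add subspace_scale)
  qed
  then show ?thesis ..
qed

lemma above_invariant:
  assumes Z: "Z \<in> so24" "X \<in> so24" "commutator Z X = d *\<^sub>R X" "0 \<le> d" and v: "v \<in> above Z r"
  shows "\<rho> X v \<in> above Z r"
  unfolding above_def
proof (rule additive_span_into[OF _ _ _ subspace_span _ v[unfolded above_def]])
  fix x assume "x \<in> {v \<in> V. \<exists>s>r. \<rho> Z v = s *\<^sub>R v}"
  then obtain s where x: "x \<in> V" "s > r" "\<rho> Z x = s *\<^sub>R x" by blast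
  show "\<rho> X x \<in> span {v \<in> V. \<exists>s>r. \<rho> Z v = s *\<^sub>R v}"
    using eigenspace_raise[OF Z(1-3) x(1,3)] x Z
    by (intro span_base CollectI conjI exI[of _ "s + d"]) auto
qed (use Z in auto)

lemma from_on_invariant:
  assumes Z: "Z \<in> so24" "X \<in> so24" "commutator Z X = d *\<^sub>R X" "0 \<le> d" and v: "v \<in> from_on Z r"
  shows "\<rho> X v \<in> from_on Z r"
  unfolding from_on_def
proof (rule additive_span_into[OF _ _ _ subspace_span _ v[unfolded from_on_def]])
  fix x assume "x \<in> {v \<in> V. \<exists>s\<ge>r. \<rho> Z v = s *\<^sub>R v}"
  then obtain s where x: "x \<in> V" "s \<ge> r" "\<rho> Z x = s *\<^sub>R x" by blast
  show "\<rho> X x \<in> span {v \<in> V. \<exists>s\<ge>r. \<rho> Z v = s *\<^sub>R v}"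
    using eigenspace_raise[OF Z(1-3) x(1,3)] x Z
    by (intro span_base CollectI conjI exI[of _ "s + d"]) auto
qed (use Z in auto)

lemma eigenvectors_independent:
  assumes Z: "Z \<in> so24" and I: "finite I"
    and x: "\<And>i. i \<in> I \<Longrightarrow> x i \<in> eigenspace Z i" and 0: "(\<Sum>i\<in>I. x i) = 0"
  shows "\<forall>i\<in>I. x i = 0"
  using I x 0
proof (induction I arbitrary: x rule: finite_induct)
  case (insert r F)
  have xV: "x i \<in> V" if "i \<in> insert r F" for i using insert.prems(1)[OF that] eigenspace_subset by blast
  have sumV: "sum x G \<in> V" if "G \<subseteq> insert r F" for G
    using that xV by (intro subspace_sum[OF subspace_V]) auto
  have rho_sum: "\<rho> Z (sum x G) = (\<Sum>i\<in>G. i *\<^sub>R x i)" if "finite G" "G \<subseteq> insert r F" for G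
    using that
  proof (induction G rule: finite_induct)
    case (insert i G)
    then have "x i \<in> eigenspace Z i" "sum x G \<in> V" using \<open>\<And>i. i \<in> insert r F \<Longrightarrow> x i \<in> eigenspace Z i\<close> sumV by auto
    then show ?case using insert Z by (simp add: eigenspace_def)
  qed (use Z in simp)
  \<comment> \<open>Applying \<open>Z - r\<close> removes the vector at \<open>r\<close> and
    multiplies every other one by the nonzero number \<open>i - r\<close>; the vectors are indexed
    by their eigenvalues.\<close>
  have "(\<Sum>i\<in>F. (i - r) *\<^sub>R x i) = (\<Sum>i\<in>insert r F. (i - r) *\<^sub>R x i)"
    using insert.hyps by simp
  also have "\<dots> = \<rho> Z (sum x (insert r F)) - r *\<^sub>R sum x (insert r F)"
    using insert.hyps by (simp only: rho_sum[OF finite.insertI[OF insert.hyps(1)] order_refl]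
        scaleR_sum_right sum_subtractf[symmetric] scaleR_diff_left)
  also have "\<dots> = 0" unfolding insert.prems(2) using Z by simp
  finally have "(\<Sum>i\<in>F. (i - r) *\<^sub>R x i) = 0" .
  moreover have "(i - r) *\<^sub>R x i \<in> eigenspace Z i" if "i \<in> F" for i
    using insert.prems(1)[of i] that subspace_eigenspace[OF Z] by (simp add: subspace_scale)
  ultimately have "\<forall>i\<in>F. (i - r) *\<^sub>R x i = 0" by (intro insert.IH) auto
  then have F: "\<forall>i\<in>F. x i = 0" using insert.hyps(2) by auto
  then have "x r = 0" using insert.prems(2) insert.hyps by simp
  with F show ?case by blast
qed simp

text \<open>Serves twice: the \<open>Min\<close> in \<open>lowest_eigenvalue\<close> is meaningful
  only for a finite set, and an infinite sl(2)-string becomes contradictory.\<close>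

lemma finite_eigenvalues:
  assumes Z: "Z \<in> so24"
  shows "finite {r. \<exists>v\<in>V. v \<noteq> 0 \<and> \<rho> Z v = r *\<^sub>R v}" (is "finite ?S")
proof -
  have "\<forall>r\<in>?S. \<exists>v. v \<in> V \<and> v \<noteq> 0 \<and> \<rho> Z v = r *\<^sub>R v" by blast
  from bchoice[OF this] obtain x
    where x: "\<And>r. r \<in> ?S \<Longrightarrow> x r \<in> V \<and> x r \<noteq> 0 \<and> \<rho> Z (x r) = r *\<^sub>R x r" by blast
  have inj: "inj_on x ?S"
  proof (rule inj_onI)
    fix r s assume rs: "r \<in> ?S" "s \<in> ?S" "x r = x s"
    have "r *\<^sub>R x r = s *\<^sub>R x r"
      using x[OF rs(1)] x[OF rs(2)] unfolding rs(3) by (elim conjE) (simp only:)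
    then show "r = s" using x[OF rs(1)] by (elim conjE) (simp only: scaleR_cancel_right simp_thms)
  qed
  have "independent (x ` ?S)"
  proof
    assume "dependent (x ` ?S)"
    then obtain t u v where t: "finite t" "t \<subseteq> x ` ?S" "v \<in> t" "u v \<noteq> 0" "(\<Sum>v\<in>t. u v *\<^sub>R v) = 0"
      unfolding dependent_explicit by blast
    then obtain I where I: "I \<subseteq> ?S" "finite I" "t = x ` I"
      by (meson finite_subset_image)
    have injI: "inj_on x I" using inj I(1) by (rule inj_on_subset)
    have "(\<Sum>r\<in>I. u (x r) *\<^sub>R x r) = 0"
      using t(5) unfolding I(3) sum.reindex[OF injI] by simp
    moreover have "u (x r) *\<^sub>R x r \<in> eigenspace Z r" if "r \<in> I" for r
    proof (rule subspace_scale[OF subspace_eigenspace[OF Z]])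
      show "x r \<in> eigenspace Z r"
        using x[OF subsetD[OF I(1) that]] by (elim conjE) (simp only: eigenspace_def mem_Collect_eq simp_thms)
    qed
    ultimately have "\<forall>r\<in>I. u (x r) *\<^sub>R x r = 0"
      using eigenvectors_independent[OF Z I(2), of "\<lambda>r. u (x r) *\<^sub>R x r"] by blast
    moreover obtain r where r: "r \<in> I" "v = x r" using t(3) unfolding I(3) by blast
    ultimately have "u (x r) *\<^sub>R x r = 0" by blast
    then show False
      using t(4) x[OF subsetD[OF I(1) r(1)]] unfolding r(2) by (elim conjE) (simp only: scaleR_eq_0_iff simp_thms)
  qed
  then have "finite (x ` ?S)" by (rule independent_bound_general[THEN conjunct1])
  then show ?thesis using inj by (rule finite_imageD)
qed

lemma above_eigenvectors:
  assumes Z: "Z \<in> so24" and v: "v \<in> above Z r"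
  obtains I y where "finite I" "\<And>i. i \<in> I \<Longrightarrow> r < i" "\<And>i. i \<in> I \<Longrightarrow> y i \<in> eigenspace Z i" "v = sum y I"
proof -
  have "\<exists>I y. finite I \<and> (\<forall>i\<in>I. r < i \<and> y i \<in> eigenspace Z i) \<and> v = sum y I"
    using v unfolding above_def
  proof (induction rule: span_induct_alt)
    case base
    show ?case by (intro exI[of _ "{}"]) simp
  next
    case (step c x v)
    then obtain s I y where x: "x \<in> V" "r < s" "\<rho> Z x = s *\<^sub>R x"
      and I: "finite I" "\<forall>i\<in>I. r < i \<and> y i \<in> eigenspace Z i" "v = sum y I" by blast
    have x': "c *\<^sub>R x \<in> eigenspace Z s" using x Z by (simp add: eigenspace_def)
    define z where "z = (\<lambda>i. (if i = s then c *\<^sub>R x else 0) + (if i \<in> I then y i else 0))"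
    have "z i \<in> eigenspace Z i" if "i \<in> insert s I" for i
      unfolding z_def using x' I that subspace_eigenspace[OF Z] by (intro subspace_add) (auto simp: subspace_0)
    moreover have "sum z (insert s I) = c *\<^sub>R x + v"
    proof -
      have "(\<Sum>i\<in>insert s I. if i = s then c *\<^sub>R x else 0) = c *\<^sub>R x"
        using I(1) by (subst sum.delta) auto
      moreover have "(\<Sum>i\<in>insert s I. if i \<in> I then y i else 0) = v"
        unfolding I(3) using I(1) by (intro sum.mono_neutral_cong_right) auto
      ultimately show ?thesis by (simp only: z_def sum.distrib)
    qed
    ultimately show ?case
      using I x by (intro exI[of _ "insert s I"] exI[of _ z]) auto
  qed
  with that show thesis by blast
qed

lemma eigenspace_Int_above:
  assumes Z: "Z \<in> so24" and v: "v \<in> eigenspace Z r" "v \<in> above Z r"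
  shows "v = 0"
proof -
  obtain I y where I: "finite I" "\<And>i. i \<in> I \<Longrightarrow> r < i" "\<And>i. i \<in> I \<Longrightarrow> y i \<in> eigenspace Z i" "v = sum y I"
    using above_eigenvectors[OF Z v(2)] by metis
  define z where "z i = (if i = r then - v else y i)" for i
  have r: "r \<notin> I" using I(2) by blast
  have "sum z I = sum y I" using r by (intro sum.cong refl) (auto simp: z_def)
  then have "sum z I = v" by (simp only: I(4))
  then have "sum z (insert r I) = 0" using r I(1) by (simp add: z_def)
  moreover have "z i \<in> eigenspace Z i" if "i \<in> insert r I" for i
    using that I(3) v(1) subspace_neg[OF subspace_eigenspace[OF Z]] by (auto simp: z_def)
  ultimately have "\<forall>i\<in>insert r I. z i = 0"
    using eigenvectors_independent[OF Z, of "insert r I" z] I(1) by blast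
  then show ?thesis by (simp add: z_def)
qed

lemma from_on_split:
  assumes Z: "Z \<in> so24" and v: "v \<in> from_on Z r"
  obtains u where "u \<in> eigenspace Z r" "v - u \<in> above Z r"
proof -
  have "\<exists>u. u \<in> eigenspace Z r \<and> v - u \<in> above Z r"
    using v unfolding from_on_def
  proof (induction rule: span_induct_alt)
    case base
    show ?case
      using subspace_0[OF subspace_eigenspace[OF Z]] span_zero unfolding above_def
      by (intro exI[of _ 0]) simp
  next
    case (step c x y)
    then obtain s u where x: "x \<in> V" "r \<le> s" "\<rho> Z x = s *\<^sub>R x"
      and u: "u \<in> eigenspace Z r" "y - u \<in> above Z r" by blast
    show ?case
    proof (cases "s = r")
      case True
      then have "c *\<^sub>R x \<in> eigenspace Z r" using x Z by (simp add: eigenspace_def)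
      then show ?thesis
        using u subspace_add[OF subspace_eigenspace[OF Z]]
        by (intro exI[of _ "c *\<^sub>R x + u"]) simp
    next
      case False
      then have "c *\<^sub>R x \<in> above Z r"
        using x unfolding above_def by (intro span_scale span_base CollectI conjI exI[of _ s]) auto
      then have "c *\<^sub>R x + (y - u) \<in> above Z r"
        using u(2) unfolding above_def by (rule span_add)
      then show ?thesis using u by (intro exI[of _ u]) (simp add: algebra_simps)
    qed
  qed
  with that show thesis by blast
qed

lemma grading_elt_in_so24 [simp]: "grading_elt \<in> so24"
  by (simp add: grading_elt_eq_g_zero)

lemma lowest_eigenvalue_eq:
  assumes V: "V \<subseteq> from_on grading_elt r" and u: "u \<in> eigenspace grading_elt r" "u \<noteq> 0"
  shows "lowest_eigenvalue V \<rho> = r"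
  unfolding lowest_eigenvalue_def
proof (rule Min_eqI[OF finite_eigenvalues])
  show "r \<in> {r. \<exists>v\<in>V. v \<noteq> 0 \<and> \<rho> grading_elt v = r *\<^sub>R v}"
    using u by (auto simp: eigenspace_def)
  fix s assume "s \<in> {r. \<exists>v\<in>V. v \<noteq> 0 \<and> \<rho> grading_elt v = r *\<^sub>R v}"
  then obtain v where v: "v \<in> V" "v \<noteq> 0" "\<rho> grading_elt v = s *\<^sub>R v" by blast
  show "r \<le> s"
  proof (rule ccontr)
    assume "\<not> r \<le> s"
    then have "from_on grading_elt r \<subseteq> above grading_elt s"
      unfolding from_on_def above_def by (intro span_mono) force
    then have "v \<in> above grading_elt s" using V v by blast
    then show False
      using eigenspace_Int_above[of grading_elt v s] v by (simp add: eigenspace_def)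
  qed
qed simp

lemma lowest_proj_eq:
  assumes V: "V \<subseteq> from_on grading_elt r" and u0: "u0 \<in> eigenspace grading_elt r" "u0 \<noteq> 0"
    and u: "u \<in> eigenspace grading_elt r" "v - u \<in> above grading_elt r"
  shows "lowest_proj V \<rho> v = u"
proof -
  have low: "lowest_eigenspace V \<rho> = eigenspace grading_elt r"
    "span {x\<in>V. \<exists>r > lowest_eigenvalue V \<rho>. \<rho> grading_elt x = r *\<^sub>R x} = above grading_elt r"
    unfolding lowest_eigenspace_def eigenspace_def above_def lowest_eigenvalue_eq[OF V u0] by auto
  show ?thesis
    unfolding lowest_proj_def low
  proof (rule the_equality)
    fix u' assume u': "u' \<in> eigenspace grading_elt r \<and> v - u' \<in> above grading_elt r"
    then have "(v - u) - (v - u') \<in> above grading_elt r"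
      using u(2) unfolding above_def by (simp only: span_diff)
    moreover have "u' - u \<in> eigenspace grading_elt r"
      using u u' subspace_diff[OF subspace_eigenspace] by simp
    ultimately have "u' - u = 0"
      using eigenspace_Int_above[of grading_elt "u' - u" r] by (simp add: algebra_simps)
    then show "u' = u" by simp
  qed (use u in simp)
qed

lemma lowest_eigenspace_eq:
  assumes V: "V \<subseteq> from_on grading_elt r" and u0: "u0 \<in> eigenspace grading_elt r" "u0 \<noteq> 0"
  shows "lowest_eigenspace V \<rho> = eigenspace grading_elt r"
  unfolding lowest_eigenspace_def eigenspace_def lowest_eigenvalue_eq[OF V u0] ..

lemma lowest_proj_linear:
  assumes V: "V \<subseteq> from_on grading_elt r" and u0: "u0 \<in> eigenspace grading_elt r" "u0 \<noteq> 0"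
    and v: "v \<in> V" "v' \<in> V"
  shows "lowest_proj V \<rho> (a *\<^sub>R v + b *\<^sub>R v') = a *\<^sub>R lowest_proj V \<rho> v + b *\<^sub>R lowest_proj V \<rho> v'"
proof -
  obtain u u' where u: "u \<in> eigenspace grading_elt r" "v - u \<in> above grading_elt r"
    and u': "u' \<in> eigenspace grading_elt r" "v' - u' \<in> above grading_elt r"
    using from_on_split[OF grading_elt_in_so24 subsetD[OF V v(1)]]
      from_on_split[OF grading_elt_in_so24 subsetD[OF V v(2)]] by metis
  have "a *\<^sub>R (v - u) + b *\<^sub>R (v' - u') \<in> above grading_elt r"
    using u(2) u'(2) unfolding above_def by (intro span_add span_scale)
  then have "a *\<^sub>R v + b *\<^sub>R v' - (a *\<^sub>R u + b *\<^sub>R u') \<in> above grading_elt r"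
    by (simp add: algebra_simps)
  moreover have "a *\<^sub>R u + b *\<^sub>R u' \<in> eigenspace grading_elt r"
    using u(1) u'(1)
    by (intro subspace_add subspace_scale subspace_eigenspace[OF grading_elt_in_so24])
  ultimately show ?thesis
    unfolding lowest_proj_eq[OF V u0 u] lowest_proj_eq[OF V u0 u']
    by (intro lowest_proj_eq[OF V u0])
qed

lemma funpow_closed: "X \<in> so24 \<Longrightarrow> v \<in> V \<Longrightarrow> (\<rho> X ^^ k) v \<in> V"
  by (induction k) auto

lemma funpow_commute:
  assumes "Z \<in> so24" "X \<in> so24" "commutator Z X = 0" "v \<in> V"
  shows "\<rho> Z ((\<rho> X ^^ k) v) = (\<rho> X ^^ k) (\<rho> Z v)"
proof (induction k)
  case (Suc k)
  have "\<rho> Z (\<rho> X ((\<rho> X ^^ k) v)) = \<rho> X (\<rho> Z ((\<rho> X ^^ k) v))"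
    using rho_commutator[OF assms(1,2) funpow_closed[OF assms(2,4), of k]] assms
      rho_mat(1)[OF funpow_closed[OF assms(2,4), of k]] by simp
  then show ?case using Suc by simp
qed simp

section \<open>Strings of sl(2)-triples\<close>

lemma sl2_string:
  assumes E: "E \<in> so24" and F: "F \<in> so24" and H: "H \<in> so24"
    and EF: "commutator E F = H" and HF: "commutator H F = (- 2) *\<^sub>R F"
    and v: "v \<in> V" "\<rho> E v = 0" "\<rho> H v = l *\<^sub>R v"
  shows "\<rho> H ((\<rho> F ^^ k) v) = (l - 2 * real k) *\<^sub>R (\<rho> F ^^ k) v"
    and "\<rho> E ((\<rho> F ^^ Suc k) v) = (real (Suc k) * (l - real k)) *\<^sub>R (\<rho> F ^^ k) v"
proof -
  note V = funpow_closed[OF F v(1)]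
  show h: "\<rho> H ((\<rho> F ^^ k) v) = (l - 2 * real k) *\<^sub>R (\<rho> F ^^ k) v" for k
  proof (induction k)
    case (Suc k)
    then show ?case
      using eigenspace_raise[OF H F HF V[of k] Suc] by (simp add: algebra_simps)
  qed (use v in simp)
  have e: "\<rho> E (\<rho> F ((\<rho> F ^^ k) v)) = \<rho> F (\<rho> E ((\<rho> F ^^ k) v)) + (l - 2 * real k) *\<^sub>R (\<rho> F ^^ k) v" for k
    using rho_commutator[OF E F V[of k]] unfolding EF h by (simp add: algebra_simps)
  show "\<rho> E ((\<rho> F ^^ Suc k) v) = (real (Suc k) * (l - real k)) *\<^sub>R (\<rho> F ^^ k) v"
  proof (induction k)
    case 0
    then show ?case using e[of 0] v F by simp
  next
    case (Suc k)
    have "\<rho> E ((\<rho> F ^^ Suc (Suc k)) v) = (real (Suc k) * (l - real k)) *\<^sub>R \<rho> F ((\<rho> F ^^ k) v)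
        + (l - 2 * real (Suc k)) *\<^sub>R (\<rho> F ^^ Suc k) v"
      using e[of "Suc k"] Suc V[of k] F by simp
    also have "\<dots> = (real (Suc (Suc k)) * (l - real (Suc k))) *\<^sub>R (\<rho> F ^^ Suc k) v"
    proof -
      have "real (Suc k) * (l - real k) + (l - 2 * real (Suc k)) = real (Suc (Suc k)) * (l - real (Suc k))"
        by (simp add: algebra_simps)
      moreover have "\<rho> F ((\<rho> F ^^ k) v) = (\<rho> F ^^ Suc k) v" by simp
      ultimately show ?thesis by (metis scaleR_add_left)
    qed
    finally show ?case .
  qed
qed

lemma sl2_string_nonzero:
  assumes sl2: "E \<in> so24" "F \<in> so24" "H \<in> so24" "commutator E F = H" "commutator H F = (- 2) *\<^sub>R F"
    and v: "v \<in> V" "\<rho> E v = 0" "\<rho> H v = l *\<^sub>R v" "v \<noteq> 0"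
    and l: "\<And>j. j < k \<Longrightarrow> l \<noteq> real j"
  shows "(\<rho> F ^^ k) v \<noteq> 0"
  using l
proof (induction k)
  case (Suc k)
  then have "(\<rho> F ^^ k) v \<noteq> 0" "l \<noteq> real k" by auto
  then have "\<rho> E ((\<rho> F ^^ Suc k) v) \<noteq> 0"
    unfolding sl2_string(2)[OF sl2 v(1-3)] by simp
  then show ?case using sl2(1) by (metis rho_vec(1))
qed (use v in simp)

text \<open>For such \<open>l\<close> the factors \<open>real (Suc k) * (l - real k)\<close> never
  vanish, so a nonzero \<open>v\<close> would produce infinitely many eigenvalues of
  \<open>H\<close>.\<close>

lemma sl2_highest_weight_nat:
  assumes sl2: "E \<in> so24" "F \<in> so24" "H \<in> so24" "commutator E F = H" "commutator H F = (- 2) *\<^sub>R F"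
    and v: "v \<in> V" "\<rho> E v = 0" "\<rho> H v = l *\<^sub>R v" and l: "\<And>j. l \<noteq> real j"
  shows "v = 0"
proof (rule ccontr)
  assume "v \<noteq> 0"
  then have nz: "(\<rho> F ^^ k) v \<noteq> 0" for k
    using sl2_string_nonzero[OF sl2 v] l by blast
  have "range (\<lambda>k. l - 2 * real k) \<subseteq> {r. \<exists>v\<in>V. v \<noteq> 0 \<and> \<rho> H v = r *\<^sub>R v}"
    using nz sl2_string(1)[OF sl2 v] funpow_closed[OF sl2(2) v(1)] by blast
  then have "finite (range (\<lambda>k. l - 2 * real k))"
    using finite_eigenvalues[OF sl2(3)] finite_subset by blast
  moreover have "inj (\<lambda>k. l - 2 * real k)" by (rule injI) simp
  ultimately show False using finite_imageD infinite_UNIV_nat by blast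
qed

text \<open>The factor \<open>l - real n\<close> is zero, so this vector is again killed by
  \<open>E\<close>; its weight \<open>- n - 2\<close> is negative, which is impossible unless it
  vanishes.\<close>

lemma sl2_string_end:
  assumes sl2: "E \<in> so24" "F \<in> so24" "H \<in> so24" "commutator E F = H" "commutator H F = (- 2) *\<^sub>R F"
    and v: "v \<in> V" "\<rho> E v = 0" "\<rho> H v = real n *\<^sub>R v"
  shows "(\<rho> F ^^ Suc n) v = 0"
proof (rule sl2_highest_weight_nat[OF sl2 funpow_closed[OF sl2(2) v(1)]])
  show "\<rho> E ((\<rho> F ^^ Suc n) v) = 0"
    unfolding sl2_string(2)[OF sl2 v] by simp
  show "\<rho> H ((\<rho> F ^^ Suc n) v) = (real n - 2 * real (Suc n)) *\<^sub>R (\<rho> F ^^ Suc n) v"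
    by (rule sl2_string(1)[OF sl2 v])
  show "real n - 2 * real (Suc n) \<noteq> real j" for j by simp
qed

end

section \<open>Highest weight modules\<close>

lemma sum_nth_two_valued:
  fixes g :: "2 \<Rightarrow> 'a::semiring_1"
  shows "(\<Sum>i<length xs. g (xs ! i)) =
    of_nat (count (mset xs) 1) * g 1 + of_nat (length xs - count (mset xs) 1) * g 2"
proof -
  have "(\<Sum>i<length xs. g (xs ! i)) = sum_list (map g xs)"
    by (simp add: sum_list_sum_nth lessThan_atLeast0)
  also have "\<dots> = of_nat (count (mset xs) 1) * g 1 + of_nat (length xs - count (mset xs) 1) * g 2"
  proof (induction xs)
    case (Cons x xs)
    have "count (mset xs) 1 \<le> length xs" by (metis count_le_size size_mset)
    then show ?case using Cons exhaust_2[of x] by (auto simp: algebra_simps Suc_diff_le)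
  qed simp
  finally show ?thesis .
qed

lemma count_1_determines_mset:
  fixes xs ys :: "2 list"
  assumes "length xs = length ys" "count (mset xs) 1 = count (mset ys) 1"
  shows "mset xs = mset ys"
proof (rule multiset_eqI)
  have len: "length zs = count (mset zs) 1 + count (mset zs) 2" for zs :: "2 list"
  proof (induction zs)
    case (Cons z zs)
    then show ?case using exhaust_2[of z] by auto
  qed simp
  fix j :: 2
  show "count (mset xs) j = count (mset ys) j"
    using exhaust_2[of j] assms len[of xs] len[of ys] by auto
qed

lemma count_1_list_update:
  fixes xs :: "2 list"
  assumes "i < length xs"
  shows "count (mset (xs[i := j])) 1 = count (mset xs) 1 - (if xs ! i = 1 then 1 else 0) + (if j = 1 then 1 else 0)"
  using assms by (simp add: mset_update)

text \<open>A common setting for the real and the complex case: \<open>sc\<close> is the scalar multiplication of the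
  real or complex numbers \<open>'k\<close> on \<open>V\<close>, and \<open>\<kappa>\<close> the scalar by which \<open>so(2)\<close> acts on a highest
  weight vector \<open>v0\<close>. Since \<open>1\<close> and \<open>\<kappa>\<close> span \<open>'k\<close> over the reals, real submodules
  for \<open>sl(2) \<oplus> so(2)\<close> that contain a weight vector contain its \<open>'k\<close>-multiples.\<close>

locale so24_highest_weight = so24_module V \<rho>
  for V :: "'v::euclidean_space set" and \<rho> :: "real^6^6 \<Rightarrow> 'v \<Rightarrow> 'v" +
  fixes sc :: "'k::real_normed_field \<Rightarrow> 'v \<Rightarrow> 'v" and v0 :: 'v and \<kappa> :: 'k and w1 w2 w3 :: nat
  assumes sc_closed: "v \<in> V \<Longrightarrow> sc c v \<in> V"
    and sc_add_right: "u \<in> V \<Longrightarrow> v \<in> V \<Longrightarrow> sc c (u + v) = sc c u + sc c v"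
    and sc_add_left: "v \<in> V \<Longrightarrow> sc (c + d) v = sc c v + sc d v"
    and sc_mult: "v \<in> V \<Longrightarrow> sc (c * d) v = sc c (sc d v)"
    and sc_of_real: "v \<in> V \<Longrightarrow> sc (of_real r) v = r *\<^sub>R v"
    and rho_sc: "X \<in> so24 \<Longrightarrow> v \<in> V \<Longrightarrow> \<rho> X (sc c v) = sc c (\<rho> X v)"
    and irreducible: "subspace W \<Longrightarrow> W \<subseteq> V \<Longrightarrow> (\<And>c v. v \<in> W \<Longrightarrow> sc c v \<in> W) \<Longrightarrow>
      invariant_under so24 \<rho> W \<Longrightarrow> W = {0} \<or> W = V"
    and v0: "v0 \<in> V" "v0 \<noteq> 0"
    and upper_v0: "X \<in> so24 \<Longrightarrow> strictly_upper X \<Longrightarrow> \<rho> X v0 = 0"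
    and weight_v0: "\<rho> (cartan a b 0) v0 = (real w1 * a + (real w2 + real w3) / 2 * (a + b)) *\<^sub>R v0"
    and so2_v0: "\<rho> (cartan 0 0 1) v0 = sc \<kappa> v0"
    and real_span: "\<exists>\<alpha> \<beta>. c = of_real \<alpha> + of_real \<beta> * \<kappa>"
begin

lemma sc_0 [simp]: "sc c 0 = 0"
  using sc_add_right[of 0 0 c] by simp

lemma sc_zero [simp]: "v \<in> V \<Longrightarrow> sc 0 v = 0"
  using sc_of_real[of v 0] by simp

lemma sc_one [simp]: "v \<in> V \<Longrightarrow> sc 1 v = v"
  using sc_of_real[of v 1] by simp

lemma sc_scaleR: "v \<in> V \<Longrightarrow> sc c (r *\<^sub>R v) = r *\<^sub>R sc c v"
  using sc_mult[of v c "of_real r"] sc_mult[of v "of_real r" c]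
  by (simp add: sc_of_real sc_closed mult.commute)

lemma sc_eq_0:
  assumes "v \<in> V" "sc c v = 0" "v \<noteq> 0"
  shows "c = 0"
proof (rule ccontr)
  assume "c \<noteq> 0"
  then have "v = sc (inverse c * c) v" using assms by simp
  then show False unfolding sc_mult[OF assms(1)] assms(2) using assms(3) by simp
qed

lemma funpow_sc:
  assumes "X \<in> so24" "v \<in> V"
  shows "(\<rho> X ^^ k) (sc c v) = sc c ((\<rho> X ^^ k) v)"
  using assms by (induction k) (simp_all add: rho_sc funpow_closed)

lemma funpow_scaleR:
  assumes "X \<in> so24" "v \<in> V"
  shows "(\<rho> X ^^ k) (r *\<^sub>R v) = r *\<^sub>R (\<rho> X ^^ k) v"
  using assms by (induction k) (simp_all add: funpow_closed)

section \<open>From the highest weight vector to the lowest\<close>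

text \<open>The value of the highest weight on \<open>h\<close>, where each of the three fundamental
  weights equals 1.\<close>

definition m :: nat where "m = w1 + w2 + w3"

abbreviation "h \<equiv> g_zero 1 1 0 0 0"
text \<open>With these signs \<open>e'\<close>, \<open>f'\<close> and \<open>h'\<close> are the
  images of the standard basis of sl(2) under \<open>B \<mapsto> block_diagonal B 0\<close>, whose
  upper left block is the negative of \<open>B\<close> reflected in the antidiagonal.\<close>

abbreviation "e' \<equiv> g_zero 0 0 0 0 (- 1)"
abbreviation "f' \<equiv> g_zero 0 0 0 (- 1) 0"
abbreviation "h' \<equiv> g_zero 1 (- 1) 0 0 0"
abbreviation "so2 \<equiv> g_zero 0 0 1 0 0"

lemma sl2_long:
  "g_pos 0 0 0 0 1 \<in> so24" "g_neg 0 0 0 0 1 \<in> so24" "h \<in> so24"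
  "commutator (g_pos 0 0 0 0 1) (g_neg 0 0 0 0 1) = h"
  "commutator h (g_neg 0 0 0 0 1) = (- 2) *\<^sub>R g_neg 0 0 0 0 1"
  by (simp_all add: commutator_g_pos_top_g_neg_bottom commutator_g_zero_g_neg,
      simp add: g_neg_def matrix6_simps)

lemma sl2_up:
  "e' \<in> so24" "f' \<in> so24" "h' \<in> so24" "commutator e' f' = h'" "commutator h' f' = (- 2) *\<^sub>R f'"
  by (simp_all add: commutator_g_zero_g_zero, simp add: g_zero_def matrix6_simps)

text \<open>The preceding triple with raising and lowering exchanged, for strings that start at the
  lowest weight vector.\<close>

lemma sl2_down:
  "f' \<in> so24" "e' \<in> so24" "g_zero (- 1) 1 0 0 0 \<in> so24" "commutator f' e' = g_zero (- 1) 1 0 0 0"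
  "commutator (g_zero (- 1) 1 0 0 0) e' = (- 2) *\<^sub>R e'"
  by (simp_all add: commutator_g_zero_g_zero, simp add: g_zero_def matrix6_simps)

lemma h_v0: "\<rho> h v0 = real m *\<^sub>R v0" and h'_v0: "\<rho> h' v0 = real w1 *\<^sub>R v0"
  and so2_v0': "\<rho> so2 v0 = sc \<kappa> v0"
  using weight_v0[of 1 1] weight_v0[of 1 "-1"] so2_v0 unfolding cartan_eq_g_zero
  by (simp_all add: m_def)

lemma g_pos_v0: "\<rho> (g_pos p q r s w) v0 = 0" and e'_v0: "\<rho> e' v0 = 0"
  by (rule upper_v0; simp add: strictly_upper_g)+

text \<open>The power \<open>m\<close> is the last one that does not kill \<open>v0\<close>.\<close>

definition u0 :: 'v where "u0 = (\<rho> (g_neg 0 0 0 0 1) ^^ m) v0"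

lemma u0_in_V: "u0 \<in> V"
  unfolding u0_def using v0(1) by (intro funpow_closed) auto

lemma u0_nonzero: "u0 \<noteq> 0"
  unfolding u0_def
  by (rule sl2_string_nonzero[OF sl2_long v0(1) g_pos_v0 h_v0 v0(2)]) simp

lemma u0_neg_null: "u0 \<in> neg_null V \<rho>"
proof -
  let ?f = "g_neg 0 0 0 0 1"
  have 1: "\<rho> (g_neg p q r s 0) u0 = 0" for p q r s
  proof -
    let ?y = "g_neg p q r s 0"
    let ?z = "\<rho> ?y v0"
    have zV: "?z \<in> V" using v0 by simp
    \<comment> \<open>The bracket of degrees 2 and -1 has degree 1 and kills \<open>v0\<close>. So
      \<open>?z\<close> is again the top of a string, of weight \<open>m - 1\<close>, and
      \<open>m\<close> lowerings exceed its length.\<close>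
    have ez: "\<rho> (g_pos 0 0 0 0 1) ?z = 0"
      using rho_commutator[of "g_pos 0 0 0 0 1" ?y v0] v0(1)
      by (simp add: commutator_g_pos_top_g_neg g_pos_v0)
    have hz: "\<rho> h ?z = (real m - 1) *\<^sub>R ?z"
      using eigenspace_raise[of h ?y "-1" v0 "real m"] h_v0 v0(1)
      by (simp add: commutator_g_zero_g_neg g_scaleR)
    have "(\<rho> ?f ^^ m) ?z = 0"
    \<comment> \<open>For \<open>m = 0\<close> the weight is -1, not a natural number, so
      \<open>?z\<close> itself must vanish.\<close>
    proof (cases m)
      case 0
      have "?z = 0"
        by (rule sl2_highest_weight_nat[OF sl2_long zV ez hz]) (simp add: 0)
      then show ?thesis using 0 by simp
    next
      case (Suc k)
      show ?thesis
        unfolding Suc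
        by (rule sl2_string_end[OF sl2_long zV ez]) (use hz Suc in simp)
    qed
    moreover have "\<rho> ?y u0 = (\<rho> ?f ^^ m) ?z"
      unfolding u0_def
      by (rule funpow_commute) (simp_all add: commutator_g_neg_g_neg v0)
    ultimately show ?thesis by simp
  qed
  have "\<rho> ?f u0 = (\<rho> ?f ^^ Suc m) v0" by (simp add: u0_def)
  also have "\<dots> = 0" by (rule sl2_string_end[OF sl2_long v0(1) g_pos_v0 h_v0])
  finally show ?thesis using 1 u0_in_V by (intro neg_nullI)
qed

lemma h_u0: "\<rho> h u0 = (- real m) *\<^sub>R u0"
  unfolding u0_def sl2_string(1)[OF sl2_long v0(1) g_pos_v0 h_v0] by simp

text \<open>Block diagonal elements with \<open>a + b = 0\<close> commute with the degree -2
  element. Hence \<open>h'\<close>, \<open>e'\<close> and \<open>so2\<close> act on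
  \<open>u0\<close> as on \<open>v0\<close>.\<close>

lemma u0_commuting:
  assumes "commutator Z (g_neg 0 0 0 0 1) = 0" "Z \<in> so24"
  shows "\<rho> Z u0 = (\<rho> (g_neg 0 0 0 0 1) ^^ m) (\<rho> Z v0)"
  unfolding u0_def using assms v0 by (intro funpow_commute) simp_all

lemma h'_u0: "\<rho> h' u0 = real w1 *\<^sub>R u0"
  using u0_commuting[of h'] h'_v0 funpow_scaleR[OF sl2_long(2) v0(1)]
  by (simp add: commutator_g_zero_g_neg u0_def)

lemma e'_u0: "\<rho> e' u0 = 0"
proof -
  have "(\<rho> (g_neg 0 0 0 0 1) ^^ m) 0 = 0"
    using funpow_scaleR[OF sl2_long(2) v0(1), of m 0] by simp
  then show ?thesis using u0_commuting[of e'] e'_v0 by (simp add: commutator_g_zero_g_neg)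
qed

lemma so2_u0: "\<rho> so2 u0 = sc \<kappa> u0"
  using u0_commuting[of so2] so2_v0' funpow_sc[OF sl2_long(2) v0(1)]
  by (simp add: commutator_g_zero_g_neg u0_def)

text \<open>The bottom of the string through \<open>u0\<close>. The nilradical together with
  \<open>f'\<close> spans the strictly lower triangular part of \<open>so24\<close>, so this is a
  lowest weight vector of \<open>V\<close>.\<close>

definition n0 :: 'v where "n0 = (\<rho> f' ^^ w1) u0"

lemma n0_in_V: "n0 \<in> V"
  unfolding n0_def using u0_in_V by (intro funpow_closed) auto

lemma n0_nonzero: "n0 \<noteq> 0"
  unfolding n0_def
  by (rule sl2_string_nonzero[OF sl2_up u0_in_V e'_u0 h'_u0 u0_nonzero]) simp

lemma f'_n0: "\<rho> f' n0 = 0"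
  using sl2_string_end[OF sl2_up u0_in_V e'_u0 h'_u0] by (simp add: n0_def)

lemma h'_n0: "\<rho> (g_zero (- 1) 1 0 0 0) n0 = real w1 *\<^sub>R n0"
proof -
  have "g_zero (- 1) 1 0 0 0 = (- 1) *\<^sub>R h'" by (simp add: g_zero_def matrix6_simps)
  then have "\<rho> (g_zero (- 1) 1 0 0 0) n0 = (- 1) *\<^sub>R \<rho> h' n0"
    using rho_mat(3)[OF n0_in_V] by (metis g_in_so24(2))
  also have "\<rho> h' n0 = (- real w1) *\<^sub>R n0"
    unfolding n0_def sl2_string(1)[OF sl2_up u0_in_V e'_u0 h'_u0] by simp
  finally show ?thesis by simp
qed

definition basis_vec :: "nat \<Rightarrow> 'v" where "basis_vec k = (\<rho> e' ^^ k) n0"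

lemma basis_vec_0: "basis_vec 0 = n0"
  and e'_basis_vec: "\<rho> e' (basis_vec k) = basis_vec (Suc k)"
  by (simp_all add: basis_vec_def)

lemma basis_vec_in_V [simp]: "basis_vec k \<in> V"
  unfolding basis_vec_def using n0_in_V by (intro funpow_closed) auto

lemma basis_vec_nonzero: "k \<le> w1 \<Longrightarrow> basis_vec k \<noteq> 0"
  unfolding basis_vec_def
  by (rule sl2_string_nonzero[OF sl2_down n0_in_V f'_n0 h'_n0 n0_nonzero]) simp

lemma basis_vec_end: "basis_vec (Suc w1) = 0"
  unfolding basis_vec_def by (rule sl2_string_end[OF sl2_down n0_in_V f'_n0 h'_n0])

lemma f'_basis_vec: "\<rho> f' (basis_vec (Suc k)) = (real (Suc k) * (real w1 - real k)) *\<^sub>R basis_vec k"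
  unfolding basis_vec_def by (rule sl2_string(2)[OF sl2_down n0_in_V f'_n0 h'_n0])

lemma h'_basis_vec: "\<rho> h' (basis_vec k) = (2 * real k - real w1) *\<^sub>R basis_vec k"
proof -
  have "h' = (- 1) *\<^sub>R g_zero (- 1) 1 0 0 0" by (simp add: g_zero_def matrix6_simps)
  then have "\<rho> h' (basis_vec k) = (- 1) *\<^sub>R \<rho> (g_zero (- 1) 1 0 0 0) (basis_vec k)"
    using rho_mat(3)[OF basis_vec_in_V] by (metis g_in_so24(2))
  also have "\<rho> (g_zero (- 1) 1 0 0 0) (basis_vec k) = (real w1 - 2 * real k) *\<^sub>R basis_vec k"
    unfolding basis_vec_def by (rule sl2_string(1)[OF sl2_down n0_in_V f'_n0 h'_n0])
  finally show ?thesis by (simp add: scaleR_minus_left[symmetric] del: scaleR_minus_left)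
qed

lemma h_basis_vec: "\<rho> h (basis_vec k) = (- real m) *\<^sub>R basis_vec k"
proof -
  have "\<rho> h n0 = (- real m) *\<^sub>R n0"
    using funpow_commute[of h f' u0 w1] h_u0 u0_in_V funpow_scaleR[OF sl2_up(2) u0_in_V, of w1 "- real m"]
    by (simp add: commutator_g_zero_g_zero n0_def)
  then show ?thesis
    using funpow_commute[of h e' n0 k] n0_in_V funpow_scaleR[OF sl2_up(1) n0_in_V, of k "- real m"]
    by (simp add: commutator_g_zero_g_zero basis_vec_def)
qed

lemma so2_basis_vec: "\<rho> so2 (basis_vec k) = sc \<kappa> (basis_vec k)"
proof -
  have "\<rho> so2 n0 = sc \<kappa> n0"
    using funpow_commute[of so2 f' u0 w1] so2_u0 u0_in_V funpow_sc[OF sl2_up(2) u0_in_V]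
    by (simp add: commutator_g_zero_g_zero n0_def)
  then show ?thesis
    using funpow_commute[of so2 e' n0 k] n0_in_V funpow_sc[OF sl2_up(1) n0_in_V]
    by (simp add: commutator_g_zero_g_zero basis_vec_def)
qed

lemma basis_vec_neg_null: "basis_vec k \<in> neg_null V \<rho>"
proof -
  have *: "(\<rho> (g_zero a b c x z) ^^ j) v \<in> neg_null V \<rho>" if "v \<in> neg_null V \<rho>" for a b c x z j v
    using that by (induction j) (simp_all add: neg_null_g_zero)
  show ?thesis
    unfolding basis_vec_def n0_def by (intro * u0_neg_null)
qed

lemma rho_g_zero:
  assumes "v \<in> V"
  shows "\<rho> (g_zero a b c x z) v = ((a + b) / 2) *\<^sub>R \<rho> h v + ((a - b) / 2) *\<^sub>R \<rho> h' v
    + c *\<^sub>R \<rho> so2 v - x *\<^sub>R \<rho> f' v - z *\<^sub>R \<rho> e' v"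
proof -
  have "g_zero a b c x z = ((a + b) / 2) *\<^sub>R h + (1 *\<^sub>R (((a - b) / 2) *\<^sub>R h' + 1 *\<^sub>R (c *\<^sub>R so2
      + 1 *\<^sub>R ((- x) *\<^sub>R f' + (- z) *\<^sub>R e'))))"
    by (simp add: g_zero_def matrix6_simps field_simps)
  moreover have "(- x) *\<^sub>R f' + (- z) *\<^sub>R e' \<in> so24"
    "c *\<^sub>R so2 + 1 *\<^sub>R ((- x) *\<^sub>R f' + (- z) *\<^sub>R e') \<in> so24"
    "((a - b) / 2) *\<^sub>R h' + 1 *\<^sub>R (c *\<^sub>R so2 + 1 *\<^sub>R ((- x) *\<^sub>R f' + (- z) *\<^sub>R e')) \<in> so24"
    by (intro so24_lincomb g_in_so24)+
  ultimately show ?thesis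
    using assms by (simp only: lincomb_mat g_in_so24) simp
qed

section \<open>Coordinates on the span of the vectors \<open>basis_vec k\<close>\<close>

definition comb :: "(nat \<Rightarrow> 'k) \<Rightarrow> 'v" where
  "comb c = (\<Sum>k\<le>w1. sc (c k) (basis_vec k))"

lemma comb_in_V [simp]: "comb c \<in> V"
  unfolding comb_def by (intro subspace_sum[OF subspace_V] sc_closed basis_vec_in_V)

lemma sc_sum:
  assumes "\<And>i. i \<in> I \<Longrightarrow> x i \<in> V"
  shows "sc a (\<Sum>i\<in>I. x i) = (\<Sum>i\<in>I. sc a (x i))"
  using assms
proof (induction I rule: infinite_finite_induct)
  case (insert i I)
  then have "sum x I \<in> V" by (intro subspace_sum[OF subspace_V]) auto
  then show ?case using insert by (simp add: sc_add_right)
qed simp_all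

lemma rho_sum:
  assumes "X \<in> so24" "\<And>i. i \<in> I \<Longrightarrow> x i \<in> V"
  shows "\<rho> X (\<Sum>i\<in>I. x i) = (\<Sum>i\<in>I. \<rho> X (x i))"
  using assms(2)
proof (induction I rule: infinite_finite_induct)
  case (insert i I)
  then have "sum x I \<in> V" by (intro subspace_sum[OF subspace_V]) auto
  then show ?case using insert assms(1) by simp
qed (use assms(1) in simp_all)

lemma comb_add: "comb c + comb d = comb (\<lambda>k. c k + d k)"
  unfolding comb_def by (simp add: sc_add_left sum.distrib)

lemma comb_sc: "sc a (comb c) = comb (\<lambda>k. a * c k)"
  unfolding comb_def by (subst sc_sum) (simp_all add: sc_mult sc_closed)

lemma comb_scaleR: "r *\<^sub>R comb c = comb (\<lambda>k. of_real r * c k)"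
  using comb_sc[of "of_real r" c] by (simp add: sc_of_real)

lemma comb_diff: "comb c - comb d = comb (\<lambda>k. c k - d k)"
  using comb_add[of "\<lambda>k. c k - d k" d] by (simp add: algebra_simps)

lemma comb_zero: "comb (\<lambda>k. 0) = 0"
  unfolding comb_def by simp

lemma comb_eq_0:
  assumes 0: "comb c = 0" and k: "k \<le> w1"
  shows "c k = 0"
proof -
  define g where "g = (\<lambda>k. 2 * real k - real w1)"
  \<comment> \<open>\<open>eigenvectors_independent\<close> wants vectors indexed by eigenvalues;
    \<open>(i + real w1) / 2\<close> recovers \<open>k\<close> from the eigenvalue
    \<open>2 * real k - real w1\<close>.\<close>
  define x where "x = (\<lambda>i. sc (c (nat \<lfloor>(i + real w1) / 2\<rfloor>)) (basis_vec (nat \<lfloor>(i + real w1) / 2\<rfloor>)))"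
  have xg: "x (g k) = sc (c k) (basis_vec k)" for k by (simp add: x_def g_def)
  have inj: "inj_on g {..w1}" by (auto simp: inj_on_def g_def)
  have eig: "x i \<in> eigenspace h' i" if "i \<in> g ` {..w1}" for i
  proof -
    from that obtain k where "i = g k" by blast
    then show ?thesis
      unfolding eigenspace_def using xg[of k]
      by (simp add: sc_closed rho_sc h'_basis_vec sc_scaleR g_def)
  qed
  have sum: "sum x (g ` {..w1}) = 0"
    using 0 unfolding sum.reindex[OF inj] comb_def by (simp add: xg)
  have "\<forall>i\<in>g ` {..w1}. x i = 0"
    by (rule eigenvectors_independent[OF g_in_so24(2) _ eig sum]) simp
  then have "x (g k) = 0" using k by blast
  then have "sc (c k) (basis_vec k) = 0" unfolding xg .
  then show ?thesis by (rule sc_eq_0[OF basis_vec_in_V _ basis_vec_nonzero[OF k]])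
qed

lemma comb_inj: "comb c = comb d \<Longrightarrow> k \<le> w1 \<Longrightarrow> c k = d k"
  using comb_eq_0[of "\<lambda>k. c k - d k" k] comb_diff[of c d] by simp

lemma comb_cong: "(\<And>k. k \<le> w1 \<Longrightarrow> c k = d k) \<Longrightarrow> comb c = comb d"
  unfolding comb_def by (intro sum.cong) auto

lemma rho_comb: "X \<in> so24 \<Longrightarrow> \<rho> X (comb c) = (\<Sum>k\<le>w1. sc (c k) (\<rho> X (basis_vec k)))"
  unfolding comb_def by (subst rho_sum) (simp_all add: rho_sc sc_closed)

lemma e'_comb: "\<rho> e' (comb c) = comb (\<lambda>k. if k = 0 then 0 else c (k - 1))"
proof -
  have "\<rho> e' (comb c) = (\<Sum>k<w1. sc (c k) (basis_vec (Suc k)))"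
    by (simp add: rho_comb e'_basis_vec lessThan_Suc_atMost[symmetric] basis_vec_end)
  also have "\<dots> = comb (\<lambda>k. if k = 0 then 0 else c (k - 1))"
    unfolding comb_def by (simp add: sum.atMost_shift)
  finally show ?thesis .
qed

lemma f'_comb: "\<rho> f' (comb c) = comb (\<lambda>k. of_real (real (Suc k) * (real w1 - real k)) * c (Suc k))"
proof -
  have "\<rho> f' (comb c) = (\<Sum>k<w1. sc (c (Suc k)) ((real (Suc k) * (real w1 - real k)) *\<^sub>R basis_vec k))"
    by (simp add: rho_comb sum.atMost_shift f'_basis_vec basis_vec_0 f'_n0 del: of_nat_Suc)
  also have "\<dots> = (\<Sum>k<w1. sc (of_real (real (Suc k) * (real w1 - real k)) * c (Suc k)) (basis_vec k))"
    by (simp only: sc_mult[OF basis_vec_in_V] sc_of_real[OF sc_closed[OF basis_vec_in_V]]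
        sc_scaleR[OF basis_vec_in_V])
  also have "\<dots> = comb (\<lambda>k. of_real (real (Suc k) * (real w1 - real k)) * c (Suc k))"
    unfolding comb_def lessThan_Suc_atMost[symmetric] by simp
  finally show ?thesis .
qed

lemma eigen_comb:
  assumes "X \<in> so24" "\<And>k. \<rho> X (basis_vec k) = sc (l k) (basis_vec k)"
  shows "\<rho> X (comb c) = comb (\<lambda>k. l k * c k)"
  unfolding rho_comb[OF assms(1)] assms(2)
  unfolding comb_def by (simp only: sc_mult[OF basis_vec_in_V, symmetric] mult.commute)

lemma h_comb: "\<rho> h (comb c) = (- real m) *\<^sub>R comb c"
  and h'_comb: "\<rho> h' (comb c) = comb (\<lambda>k. of_real (2 * real k - real w1) * c k)"
  and so2_comb: "\<rho> so2 (comb c) = comb (\<lambda>k. \<kappa> * c k)"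
  by (subst eigen_comb; simp add: h_basis_vec h'_basis_vec so2_basis_vec comb_scaleR
      sc_of_real[OF basis_vec_in_V, symmetric] del: of_real_diff of_real_minus)+

text \<open>The first term comes from writing a diagonal matrix as \<open>(a + b) / 2\<close> times
  \<open>h\<close> plus \<open>(a - b) / 2\<close> times \<open>h'\<close>. At \<open>k = w1\<close>
  the factor \<open>real w1 - real k\<close> cancels \<open>d (Suc k)\<close>, a coefficient that
  \<open>comb\<close> does not see.\<close>

definition act :: "real \<Rightarrow> real \<Rightarrow> real \<Rightarrow> real \<Rightarrow> real \<Rightarrow> (nat \<Rightarrow> 'k) \<Rightarrow> nat \<Rightarrow> 'k" where
  "act a b c x z d k = of_real ((a + b) / 2 * (- real m) + (a - b) / 2 * (2 * real k - real w1)) * d k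
    + of_real c * (\<kappa> * d k)
    - of_real (x * (real (Suc k) * (real w1 - real k))) * d (Suc k)
    - of_real z * (if k = 0 then 0 else d (k - 1))"

lemma g_zero_comb: "\<rho> (g_zero a b c x z) (comb d) = comb (act a b c x z d)"
proof -
  have "\<rho> (g_zero a b c x z) (comb d) = comb (\<lambda>k.
      of_real ((a + b) / 2) * (of_real (- real m) * d k)
      + of_real ((a - b) / 2) * (of_real (2 * real k - real w1) * d k) + of_real c * (\<kappa> * d k)
      - of_real x * (of_real (real (Suc k) * (real w1 - real k)) * d (Suc k))
      - of_real z * (if k = 0 then 0 else d (k - 1)))"
    by (subst rho_g_zero[OF comb_in_V])
      (simp only: h_comb h'_comb so2_comb f'_comb e'_comb comb_scaleR comb_add comb_diff)
  also have "\<dots> = comb (act a b c x z d)"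
    by (rule comb_cong) (simp only: act_def of_real_add of_real_mult distrib_right mult.assoc)
  finally show ?thesis .
qed

lemma comb_neg_null: "comb c \<in> neg_null V \<rho>"
proof -
  have "sc a v \<in> neg_null V \<rho>" if "v \<in> neg_null V \<rho>" for a v
    using that by (auto simp: neg_null_def sc_closed rho_sc)
  then show ?thesis
    unfolding comb_def by (intro subspace_sum[OF subspace_neg_null]) (simp add: basis_vec_neg_null)
qed

lemma subspace_range_comb: "subspace (range comb)"
proof (rule subspaceI)
  show "0 \<in> range comb" using comb_zero by (metis rangeI)
qed (auto simp: comb_add comb_scaleR)

lemma n0_eq_comb: "n0 = comb (\<lambda>k. if k = 0 then 1 else 0)"
proof -
  have "(\<Sum>k\<le>w1. sc (if k = 0 then 1 else 0) (basis_vec k)) = (\<Sum>k\<le>w1. if k = 0 then n0 else 0)"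
    by (intro sum.cong) (auto simp: basis_vec_0 n0_in_V)
  then show ?thesis by (simp add: comb_def)
qed

section \<open>Consequences of irreducibility\<close>

text \<open>Takes the place of the triangular decomposition of the enveloping algebra. The least
  admissible subspace \<open>H\<close> inside \<open>W\<close> turns out to be invariant under
  \<open>so24\<close>; as it contains \<open>S\<close>, it is not zero and must be
  \<open>V\<close>.\<close>

lemma generates_V:
  assumes S: "subspace S" "S \<subseteq> neg_null V \<rho>" "\<And>c v. v \<in> S \<Longrightarrow> sc c v \<in> S"
      "\<And>a b c x z v. v \<in> S \<Longrightarrow> \<rho> (g_zero a b c x z) v \<in> S" "v \<in> S" "v \<noteq> 0"
    and W: "subspace W" "S \<subseteq> W" "W \<subseteq> V" "\<And>c v. v \<in> W \<Longrightarrow> sc c v \<in> W"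
      "\<And>p q r s w v. v \<in> W \<Longrightarrow> \<rho> (g_pos p q r s w) v \<in> W"
  shows "W = V"
proof -
  define F where "F = {W. subspace W \<and> S \<subseteq> W \<and> W \<subseteq> V \<and> (\<forall>c v. v \<in> W \<longrightarrow> sc c v \<in> W) \<and>
    (\<forall>p q r s w v. v \<in> W \<longrightarrow> \<rho> (g_pos p q r s w) v \<in> W)}"
  define H where "H = \<Inter>F"
  have F: "subspace X" "S \<subseteq> X" "\<And>c v. v \<in> X \<Longrightarrow> sc c v \<in> X"
      "\<And>p q r s w v. v \<in> X \<Longrightarrow> \<rho> (g_pos p q r s w) v \<in> X" if "X \<in> F" for X
    using that by (simp_all add: F_def)
  have "W \<in> F" unfolding F_def using W by simp
  then have HW: "H \<subseteq> W" unfolding H_def by (rule Inter_lower)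
  have H: "subspace H" "S \<subseteq> H"
    unfolding H_def using F(1,2) by (intro subspace_Inter Inter_greatest; simp)+
  have HF: "v \<in> X" if "v \<in> H" "X \<in> F" for v X
    using that unfolding H_def by (rule InterD)
  have H_sc: "sc c v \<in> H" if "v \<in> H" for c v
    unfolding H_def using F(3) HF[OF that] by (intro InterI) simp
  have H_pos: "\<rho> (g_pos p q r s w) v \<in> H" if "v \<in> H" for p q r s w v
    unfolding H_def using F(4) HF[OF that] by (intro InterI) simp
  have H_sub: "H \<subseteq> V" using HW W(3) by (rule subset_trans)
  have HV: "v \<in> V" if "v \<in> H" for v using that H_sub by blast
  \<comment> \<open>The vectors of \<open>H\<close> that no element of \<open>so24\<close> leads out
    of \<open>H\<close>. For \<open>X\<close> in \<open>g_pos\<close> the rule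
    \<open>N X v = X N v + [N, X] v\<close> makes \<open>K\<close> admissible as well, and
    minimality of \<open>H\<close> gives \<open>H \<subseteq> K\<close>.\<close>
  define K where "K = {v \<in> H. (\<forall>p q r s w. \<rho> (g_neg p q r s w) v \<in> H) \<and>
    (\<forall>a b c x z. \<rho> (g_zero a b c x z) v \<in> H)}"
  have all: "\<rho> Y v \<in> H" if "v \<in> K" "Y \<in> so24" for Y v
  proof -
    from that(2) obtain p q r s w a b c x z p' q' r' s' w' where
      Y: "Y = g_neg p q r s w + g_zero a b c x z + g_pos p' q' r' s' w'" by (rule so24_cases)
    have vH: "v \<in> H" using that(1) unfolding K_def by blast
    have "\<rho> (g_neg p q r s w) v \<in> H" "\<rho> (g_zero a b c x z) v \<in> H"
      using that(1) unfolding K_def by blast+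
    moreover have "\<rho> (g_pos p' q' r' s' w') v \<in> H" using vH by (rule H_pos)
    moreover have "\<rho> Y v = \<rho> (g_neg p q r s w) v + \<rho> (g_zero a b c x z) v + \<rho> (g_pos p' q' r' s' w') v"
      unfolding Y using HV[OF vH] subspace_add[OF subspace_so24] by (simp add: rho_mat)
    ultimately show ?thesis using subspace_add[OF H(1)] by simp
  qed
  have "K \<in> F"
    unfolding F_def
  proof (intro CollectI conjI allI impI)
    show "subspace K"
      unfolding K_def using H(1) HV
      by (intro subspaceI) (auto simp: subspace_0 subspace_add subspace_scale)
    show "S \<subseteq> K"
    proof
      fix v assume v: "v \<in> S"
      then have "v \<in> neg_null V \<rho>" using S(2) by blast
      then show "v \<in> K"
        unfolding K_def using v H(1,2) S(4)[OF v] by (auto simp: rho_neg_null subspace_0)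
    qed
    show "K \<subseteq> V" unfolding K_def using HV by blast
    show "sc c v \<in> K" if "v \<in> K" for c v
      using that unfolding K_def using H_sc HV by (auto simp: rho_sc)
    show "\<rho> (g_pos p q r s w) v \<in> K" if v: "v \<in> K" for p q r s w v
    proof -
      let ?X = "g_pos p q r s w"
      have vH: "v \<in> H" using v unfolding K_def by blast
      have *: "\<rho> N (\<rho> ?X v) \<in> H" if N: "N \<in> so24" for N
      proof -
        have "\<rho> N (\<rho> ?X v) = \<rho> ?X (\<rho> N v) + \<rho> (commutator N ?X) v"
          using rho_commutator[OF N g_in_so24(3) HV[OF vH]] by simp
        moreover have "\<rho> ?X (\<rho> N v) \<in> H" using all[OF v N] by (rule H_pos)
        moreover have "\<rho> (commutator N ?X) v \<in> H" using all[OF v commutator_so24[OF N g_in_so24(3)]] .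
        ultimately show ?thesis using subspace_add[OF H(1)] by simp
      qed
      show ?thesis unfolding K_def using * H_pos[OF vH] by simp
    qed
  qed
  then have "H \<subseteq> K" unfolding H_def by blast
  then have "invariant_under so24 \<rho> H" unfolding invariant_under_def using all by blast
  then have "H = {0} \<or> H = V" using irreducible[OF H(1) H_sub H_sc] by blast
  then show ?thesis using S(5,6) H(2) HW W(3) by blast
qed

lemma sc_above:
  assumes "Z \<in> so24" "v \<in> above Z r"
  shows "sc c v \<in> above Z r"
  unfolding above_def
proof (rule additive_span_into[OF _ _ _ subspace_span _ assms(2)[unfolded above_def]])
  fix x assume "x \<in> {v \<in> V. \<exists>s>r. \<rho> Z v = s *\<^sub>R v}"
  then show "sc c x \<in> span {v \<in> V. \<exists>s>r. \<rho> Z v = s *\<^sub>R v}"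
    using assms(1) by (intro span_base) (auto simp: sc_closed rho_sc sc_scaleR)
qed (auto simp: sc_add_right sc_scaleR)

lemma sc_from_on:
  assumes "Z \<in> so24" "v \<in> from_on Z r"
  shows "sc c v \<in> from_on Z r"
  unfolding from_on_def
proof (rule additive_span_into[OF _ _ _ subspace_span _ assms(2)[unfolded from_on_def]])
  fix x assume "x \<in> {v \<in> V. \<exists>s\<ge>r. \<rho> Z v = s *\<^sub>R v}"
  then show "sc c x \<in> span {v \<in> V. \<exists>s\<ge>r. \<rho> Z v = s *\<^sub>R v}"
    using assms(1) by (intro span_base) (auto simp: sc_closed rho_sc sc_scaleR)
qed (auto simp: sc_add_right sc_scaleR)

text \<open>Elements of \<open>g_pos\<close> are homogeneous neither for \<open>h\<close> nor for
  \<open>grading_elt\<close>. The first splitting has parts homogeneous for \<open>h\<close>, the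
  second for \<open>grading_elt\<close>.\<close>

lemma g_pos_split: "v \<in> V \<Longrightarrow> \<rho> (g_pos p q r s w) v = \<rho> (g_pos p q r s 0) v + \<rho> (g_pos 0 0 0 0 w) v"
  "v \<in> V \<Longrightarrow> \<rho> (g_pos p q r s w) v = \<rho> (g_pos p q 0 0 w) v + \<rho> (g_pos 0 0 r s 0) v"
  by (simp_all add: rho_mat(2)[symmetric] g_add)

lemma g_pos_degrees:
  "commutator h (g_pos p q r s 0) = 1 *\<^sub>R g_pos p q r s 0"
  "commutator h (g_pos 0 0 0 0 w) = 2 *\<^sub>R g_pos 0 0 0 0 w"
  "commutator grading_elt (g_pos p q 0 0 w) = 1 *\<^sub>R g_pos p q 0 0 w"
  "commutator grading_elt (g_pos 0 0 r s 0) = 0 *\<^sub>R g_pos 0 0 r s 0"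
  by (simp_all add: commutator_g_zero_g_pos grading_elt_eq_g_zero g_scaleR)

lemma g_pos_above_h:
  assumes "v \<in> above h r"
  shows "\<rho> (g_pos p q s t w) v \<in> above h r"
proof -
  have "v \<in> V" using assms above_subset by blast
  have "\<rho> (g_pos p q s t 0) v \<in> above h r"
    by (rule above_invariant[OF _ _ g_pos_degrees(1) _ assms]) simp_all
  moreover have "\<rho> (g_pos 0 0 0 0 w) v \<in> above h r"
    by (rule above_invariant[OF _ _ g_pos_degrees(2) _ assms]) simp_all
  ultimately show ?thesis
    unfolding above_def by (subst g_pos_split(1)[OF \<open>v \<in> V\<close>]) (rule span_add)
qed

lemma g_pos_comb: "\<rho> (g_pos p q s t w) (comb c) \<in> above h (- real m)"
proof -
  have "\<rho> (g_pos p q s t 0) (comb c) \<in> above h (- real m)"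
    unfolding above_def
    using eigenspace_raise[OF _ _ g_pos_degrees(1) comb_in_V h_comb, of p q s t c]
    by (intro span_base CollectI conjI exI[of _ "- real m + 1"]) auto
  moreover have "\<rho> (g_pos 0 0 0 0 w) (comb c) \<in> above h (- real m)"
    unfolding above_def
    using eigenspace_raise[OF _ _ g_pos_degrees(2) comb_in_V h_comb, of w c]
    by (intro span_base CollectI conjI exI[of _ "- real m + 2"]) auto
  ultimately show ?thesis
    unfolding above_def by (subst g_pos_split(1)[OF comb_in_V]) (rule span_add)
qed

lemma n0_in_range_comb: "n0 \<in> range comb"
  using n0_eq_comb by blast

lemma generates_V_comb:
  assumes "subspace W" "range comb \<subseteq> W" "W \<subseteq> V" "\<And>c v. v \<in> W \<Longrightarrow> sc c v \<in> W"
      "\<And>p q r s w v. v \<in> W \<Longrightarrow> \<rho> (g_pos p q r s w) v \<in> W"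
  shows "W = V"
proof (rule generates_V[OF subspace_range_comb _ _ _ n0_in_range_comb n0_nonzero assms(1,2,3)])
  show "range comb \<subseteq> neg_null V \<rho>" using comb_neg_null by blast
  show "sc c v \<in> range comb" if "v \<in> range comb" for c v using that by (auto simp: comb_sc)
  show "\<rho> (g_zero a b c x z) v \<in> range comb" if "v \<in> range comb" for a b c x z v
    using that by (auto simp: g_zero_comb)
qed (use assms in auto)

text \<open>The sum of \<open>range comb\<close> and \<open>above h (- real m)\<close> is stable
  under \<open>g_pos\<close>, which raises the eigenvalue of \<open>h\<close>, so it is all of
  \<open>V\<close>.\<close>

lemma V_split:
  assumes "v \<in> V"
  obtains c y where "y \<in> above h (- real m)" "v = comb c + y"
proof -
  let ?W = "{x + y |x y. x \<in> range comb \<and> y \<in> above h (- real m)}"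
  have sub: "subspace (above h (- real m))" unfolding above_def by (rule subspace_span)
  have W: "comb c + y \<in> ?W" if "y \<in> above h (- real m)" for c y using that by blast
  have aV: "y \<in> V" if "y \<in> above h (- real m)" for y using that above_subset by blast
  have "?W = V"
  proof (rule generates_V_comb)
    show "subspace ?W" by (rule subspace_sums[OF subspace_range_comb sub])
    show "range comb \<subseteq> ?W" using W[OF subspace_0[OF sub]] by auto
    show "?W \<subseteq> V" using aV by auto
    fix v assume "v \<in> ?W"
    then obtain c y where v: "v = comb c + y" "y \<in> above h (- real m)" by blast
    show "sc a v \<in> ?W" for a
      unfolding v(1) sc_add_right[OF comb_in_V aV[OF v(2)]] comb_sc
      by (rule W[OF sc_above[OF g_in_so24(2) v(2)]])
    show "\<rho> (g_pos p q r s w) v \<in> ?W" for p q r s w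
    proof -
      have "\<rho> (g_pos p q r s w) v = comb (\<lambda>k. 0) + (\<rho> (g_pos p q r s w) (comb c) + \<rho> (g_pos p q r s w) y)"
        unfolding v(1) using aV[OF v(2)] by (simp add: comb_zero)
      also have "\<dots> \<in> ?W"
        by (intro W subspace_add[OF sub] g_pos_comb g_pos_above_h v(2))
      finally show ?thesis .
    qed
  qed
  with assms that show thesis by blast
qed

text \<open>Otherwise the intersection would generate \<open>V\<close> without leaving
  \<open>above h (- real m)\<close>, which cannot contain the eigenvector \<open>n0\<close> for
  \<open>- real m\<close>.\<close>

lemma neg_null_Int_above:
  assumes "v \<in> neg_null V \<rho>" "v \<in> above h (- real m)"
  shows "v = 0"
proof (rule ccontr)
  assume "v \<noteq> 0"
  let ?S = "neg_null V \<rho> \<inter> above h (- real m)"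
  have "above h (- real m) = V"
  proof (rule generates_V[of ?S v])
    show "subspace ?S"
      unfolding above_def by (rule subspace_inter[OF subspace_neg_null subspace_span])
    show "v \<in> ?S" using assms by blast
    show "sc c u \<in> ?S" if "u \<in> ?S" for c u
      using that neg_null_subset sc_above[OF g_in_so24(2)] by (auto simp: neg_null_def sc_closed rho_sc)
    show "\<rho> (g_zero a b c x z) u \<in> ?S" if "u \<in> ?S" for a b c x z u
    proof -
      have "commutator h (g_zero a b c x z) = 0 *\<^sub>R g_zero a b c x z"
        by (simp add: commutator_g_zero_g_zero)
      then have "\<rho> (g_zero a b c x z) u \<in> above h (- real m)"
        by (rule above_invariant[rotated 2]) (use that in simp_all)
      then show ?thesis using that neg_null_g_zero by blast
    qed
    show "subspace (above h (- real m))" unfolding above_def by (rule subspace_span)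
    show "sc c u \<in> above h (- real m)" if "u \<in> above h (- real m)" for c u
      using sc_above[OF g_in_so24(2) that] .
    show "\<rho> (g_pos p q r s w) u \<in> above h (- real m)" if "u \<in> above h (- real m)" for p q r s w u
      using g_pos_above_h[OF that] .
  qed (use above_subset \<open>v \<noteq> 0\<close> in auto)
  then have "n0 \<in> above h (- real m)" using n0_in_V by simp
  moreover have "n0 \<in> eigenspace h (- real m)"
    unfolding n0_eq_comb eigenspace_def by (simp add: h_comb)
  ultimately show False
    using eigenspace_Int_above[of h n0 "- real m"] n0_nonzero by simp
qed

lemma neg_null_eq: "neg_null V \<rho> = range comb"
proof (intro equalityI subsetI)
  fix v assume v: "v \<in> neg_null V \<rho>"
  then have "v \<in> V" using neg_null_subset by blast
  then obtain c y where y: "y \<in> above h (- real m)" "v = comb c + y" by (rule V_split)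
  then have "y \<in> neg_null V \<rho>"
    using subspace_diff[OF subspace_neg_null v comb_neg_null[of c]] by simp
  then have "y = 0" using y(1) by (rule neg_null_Int_above)
  then show "v \<in> range comb" using y(2) by simp
qed (use comb_neg_null in auto)

section \<open>The grading element and the projection\<close>

text \<open>\<open>grading_elt\<close> is half of \<open>h + h'\<close>, and on \<open>n0\<close>
  these two have the eigenvalues \<open>- real m\<close> and \<open>- real w1\<close>.\<close>

definition r0 :: real where "r0 = - (real m + real w1) / 2"

lemma grading_basis_vec: "\<rho> grading_elt (basis_vec k) = (r0 + real k) *\<^sub>R basis_vec k"
proof -
  have "\<rho> grading_elt (basis_vec k) = (1 / 2 * (- real m) + 1 / 2 * (2 * real k - real w1)) *\<^sub>R basis_vec k"
    unfolding grading_elt_eq_g_zero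
    by (subst rho_g_zero[OF basis_vec_in_V]) (simp only: h_basis_vec h'_basis_vec
        scaleR_scaleR scaleR_zero_left add_0_right diff_zero scaleR_add_left)
  also have "1 / 2 * (- real m) + 1 / 2 * (2 * real k - real w1) = r0 + real k"
    by (simp add: r0_def field_simps)
  finally show ?thesis .
qed

lemma V_from_on: "V \<subseteq> from_on grading_elt r0"
proof -
  have sub: "subspace (from_on grading_elt r0)" unfolding from_on_def by (rule subspace_span)
  have "from_on grading_elt r0 = V"
  proof (rule generates_V_comb[OF sub])
    have "basis_vec k \<in> from_on grading_elt r0" for k
      unfolding from_on_def using grading_basis_vec[of k]
      by (intro span_base CollectI conjI exI[of _ "r0 + real k"]) auto
    then have "comb c \<in> from_on grading_elt r0" for c
      unfolding comb_def by (intro subspace_sum[OF sub] sc_from_on) auto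
    then show "range comb \<subseteq> from_on grading_elt r0" by blast
    show "sc c v \<in> from_on grading_elt r0" if "v \<in> from_on grading_elt r0" for c v
      using that by (intro sc_from_on) simp
    show "\<rho> (g_pos p q r s w) v \<in> from_on grading_elt r0" if v: "v \<in> from_on grading_elt r0" for p q r s w v
    proof -
      have vV: "v \<in> V" using v from_on_subset by blast
      have "\<rho> (g_pos p q 0 0 w) v \<in> from_on grading_elt r0"
        by (rule from_on_invariant[OF _ _ g_pos_degrees(3) _ v]) simp_all
      moreover have "\<rho> (g_pos 0 0 r s 0) v \<in> from_on grading_elt r0"
        by (rule from_on_invariant[OF _ _ g_pos_degrees(4) _ v]) simp_all
      ultimately show ?thesis
        by (subst g_pos_split(2)[OF vV]) (rule subspace_add[OF sub])
    qed
  qed (rule from_on_subset)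
  then show ?thesis by simp
qed

lemma n0_eigenspace: "n0 \<in> eigenspace grading_elt r0"
  using grading_basis_vec[of 0] n0_in_V by (simp add: basis_vec_0 eigenspace_def)

lemma lowest_proj_comb: "lowest_proj V \<rho> (comb c) = sc (c 0) n0"
proof (rule lowest_proj_eq[OF V_from_on n0_eigenspace n0_nonzero])
  show "sc (c 0) n0 \<in> eigenspace grading_elt r0"
    using n0_eigenspace by (simp add: eigenspace_def sc_closed rho_sc sc_scaleR)
  have "sc (c (Suc i)) (basis_vec (Suc i)) \<in> above grading_elt r0" for i
  proof -
    have "\<rho> grading_elt (sc (c (Suc i)) (basis_vec (Suc i)))
        = (r0 + real (Suc i)) *\<^sub>R sc (c (Suc i)) (basis_vec (Suc i))"
      unfolding rho_sc[OF grading_elt_in_so24 basis_vec_in_V] grading_basis_vec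
      by (rule sc_scaleR[OF basis_vec_in_V])
    then show ?thesis
      unfolding above_def
      by (intro span_base CollectI conjI exI[of _ "r0 + real (Suc i)"] sc_closed basis_vec_in_V) auto
  qed
  then have "(\<Sum>i<w1. sc (c (Suc i)) (basis_vec (Suc i))) \<in> above grading_elt r0"
    unfolding above_def by (intro span_sum)
  then show "comb c - sc (c 0) n0 \<in> above grading_elt r0"
    unfolding comb_def sum.atMost_shift basis_vec_0 by simp
qed

text \<open>If the projection vanishes along the flow, then all coefficients vanish one after the other,
  since the generator of the flow is a combination of \<open>f'\<close> and \<open>e'\<close>, and \<open>f'\<close> lowers the degree
  injectively.\<close>

lemma lowest_proj_axial_flow_injective:
  assumes w: "w \<in> neg_null V \<rho>" and e: "0 < e"
    and 0: "\<And>t. \<bar>t\<bar> < e \<Longrightarrow> lowest_proj V \<rho> (axial_flow \<rho> t w) = 0"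
  shows "w = 0"
proof -
  let ?A = "\<rho> (g_zero 0 0 0 1 (1 / 2))"
  obtain P where P: "linear P" "\<And>v. v \<in> V \<Longrightarrow> P v = lowest_proj V \<rho> v"
    using linear_extension_on_subspace[OF subspace_V, of "lowest_proj V \<rho>"]
      lowest_proj_linear[OF V_from_on n0_eigenspace n0_nonzero] by metis
  \<comment> \<open>Coefficients whose flow projects to zero; by \<open>axial_flow_kernel\<close>
    this set is closed under the generator of the flow.\<close>
  define Q where "Q = {c. \<forall>t. \<bar>t\<bar> < e \<longrightarrow> P (axial_flow \<rho> t (comb c)) = 0}"
  have A: "act 0 0 0 1 (1 / 2) c \<in> Q" if "c \<in> Q" for c
    using axial_flow_kernel[OF P(1) comb_neg_null, of e c] that
    unfolding Q_def by (simp add: g_zero_comb)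
  have zero: "c 0 = 0" if "c \<in> Q" for c
  proof -
    have "\<bar>0\<bar> < e \<longrightarrow> P (axial_flow \<rho> 0 (comb c)) = 0"
      using that unfolding Q_def by blast
    then have "P (comb c) = 0" using e by (simp add: axial_flow_zero)
    then have "sc (c 0) n0 = 0" using P(2)[OF comb_in_V] lowest_proj_comb by simp
    then show ?thesis by (rule sc_eq_0[OF n0_in_V _ n0_nonzero])
  qed
  have "c k = 0" if "c \<in> Q" "k \<le> w1" for c k
    using that
  proof (induction k arbitrary: c rule: less_induct)
    case (less k)
    show ?case
    proof (cases k)
      case 0
      then show ?thesis using zero less.prems(1) by simp
    next
      case (Suc j)
      \<comment> \<open>Coefficient \<open>j\<close> of the generator applied to
        \<open>comb c\<close> involves only \<open>c (Suc j)\<close> and \<open>c (j - 1)\<close>.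
        The induction hypothesis applies to it, as well as to \<open>c (j - 1)\<close>, which leaves
        \<open>c (Suc j)\<close>.\<close>
      have "act 0 0 0 1 (1 / 2) c j = 0"
        using less.IH[of j "act 0 0 0 1 (1 / 2) c"] A[OF less.prems(1)] less.prems(2) Suc by simp
      moreover have "(if j = 0 then 0 else c (j - 1)) = 0"
        using less.IH[of "j - 1" c] less.prems Suc by simp
      ultimately have "of_real (real (Suc j) * (real w1 - real j)) * c (Suc j) = 0"
        unfolding act_def by simp
      moreover have "real (Suc j) * (real w1 - real j) \<noteq> 0" using less.prems(2) Suc by simp
      ultimately show ?thesis unfolding Suc by (metis mult_eq_0_iff of_real_eq_0_iff)
    qed
  qed
  moreover obtain c where c: "w = comb c" using w unfolding neg_null_eq by blast
  moreover have "c \<in> Q"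
    unfolding Q_def
  proof (intro CollectI allI impI)
    fix t assume "\<bar>t\<bar> < e"
    moreover have "axial_flow \<rho> t (comb c) \<in> V"
      using axial_flow_neg_null[OF comb_neg_null] neg_null_subset by blast
    ultimately show "P (axial_flow \<rho> t (comb c)) = 0"
      using 0 P(2) unfolding c by simp
  qed
  ultimately show "w = 0" using comb_cong[of c "\<lambda>k. 0"] comb_zero by simp
qed

lemma parametrises: "parametrises_normal_solutions V \<rho> (normal_values V \<rho>)"
  unfolding normal_values_eq_neg_null
proof (rule parametrises_normal_solutionsI)
  show "w = 0" if "w \<in> neg_null V \<rho>" "0 < e"
    "\<And>t. \<bar>t\<bar> < e \<Longrightarrow> lowest_proj V \<rho> (axial_flow \<rho> t w) = 0" for w e
    using lowest_proj_axial_flow_injective that by blast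
  show "lowest_proj V \<rho> (u - v) = lowest_proj V \<rho> u - lowest_proj V \<rho> v" if "u \<in> V" "v \<in> V" for u v
    using lowest_proj_linear[OF V_from_on n0_eigenspace n0_nonzero that, of 1 "-1"] by simp
qed

section \<open>Identification with symmetric tensors\<close>

text \<open>The factor \<open>k!\<close> turns multiplication by \<open>e'\<close> on \<open>basis_vec k\<close>, i.e. on \<open>e'\<^sup>k n0\<close>, into its action
  on symmetric tensors.\<close>

definition sym_tensor :: "(nat \<Rightarrow> 'k) \<Rightarrow> 2 list \<Rightarrow> 'k" where
  "sym_tensor c is = (if length is = w1
     then of_nat (fact (count (mset is) 1)) * c (count (mset is) 1) else 0)"

definition tensor_of :: "'v \<Rightarrow> 2 list \<Rightarrow> 'k" where
  "tensor_of v = sym_tensor (SOME c. v = comb c)"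

lemma count_1_le: "length is = w1 \<Longrightarrow> count (mset is) (1 :: 2) \<le> w1"
  by (metis count_le_size size_mset)

lemma tensor_of_comb: "tensor_of (comb c) = sym_tensor c"
proof -
  have "comb c = comb (SOME d. comb c = comb d)" by (rule someI[of "\<lambda>d. comb c = comb d" c]) simp
  then have "(SOME d. comb c = comb d) k = c k" if "k \<le> w1" for k
    using comb_inj[OF _ that, of c "SOME d. comb c = comb d"] by simp
  then show ?thesis
    unfolding tensor_of_def by (auto simp: fun_eq_iff sym_tensor_def count_1_le)
qed

lemma sym_tensor_in_sym_tensors: "sym_tensor c \<in> sym_tensors w1"
  unfolding sym_tensors_def
proof (intro CollectI conjI allI impI)
  fix "is" js :: "2 list"
  assume *: "mset is = mset js"
  show "sym_tensor c is = sym_tensor c js"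
    unfolding sym_tensor_def mset_eq_length[OF *] * ..
qed (simp add: sym_tensor_def)

lemma sym_tensor_inj:
  assumes "sym_tensor c = sym_tensor d" "k \<le> w1"
  shows "c k = d k"
proof -
  let ?is = "replicate k (1 :: 2) @ replicate (w1 - k) 2"
  have "length ?is = w1" "count (mset ?is) 1 = k" using assms(2) by auto
  then have "sym_tensor c ?is = of_nat (fact k) * c k" "sym_tensor d ?is = of_nat (fact k) * d k"
    by (simp_all only: sym_tensor_def if_True refl)
  then show ?thesis using assms(1) by simp
qed

lemma sym_tensor_surj:
  assumes "S \<in> sym_tensors w1"
  shows "\<exists>c. S = sym_tensor c"
proof -
  \<comment> \<open>A symmetric tensor is determined by its values on the lists that begin with
    \<open>k\<close> ones and continue with twos.\<close>
  define c where "c = (\<lambda>k. S (replicate k (1 :: 2) @ replicate (w1 - k) 2) / of_nat (fact k))"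
  have "S is = sym_tensor c is" for "is"
  proof (cases "length is = w1")
    case True
    let ?k = "count (mset is) 1"
    have "mset is = mset (replicate ?k (1 :: 2) @ replicate (w1 - ?k) 2)"
      using count_1_le[OF True] True by (intro count_1_determines_mset) auto
    then have "S is = S (replicate ?k (1 :: 2) @ replicate (w1 - ?k) 2)"
      using assms unfolding sym_tensors_def by blast
    then show ?thesis using True by (simp add: sym_tensor_def c_def)
  next
    case False
    then show ?thesis using assms by (simp add: sym_tensor_def sym_tensors_def)
  qed
  then show ?thesis by blast
qed

lemma linear_iso_tensor_of: "linear_iso_sym sc (neg_null V \<rho>) w1 tensor_of"
  unfolding linear_iso_sym_def
proof (intro conjI allI ballI)
  show "bij_betw tensor_of (neg_null V \<rho>) (sym_tensors w1)"
    unfolding bij_betw_def neg_null_eq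
  proof (intro conjI inj_onI equalityI subsetI)
    fix u v assume "u \<in> range comb" "v \<in> range comb" and eq: "tensor_of u = tensor_of v"
    then obtain c d where cd: "u = comb c" "v = comb d" by blast
    then have "\<And>k. k \<le> w1 \<Longrightarrow> c k = d k" using eq sym_tensor_inj by (simp add: tensor_of_comb)
    then show "u = v" unfolding cd by (rule comb_cong)
  next
    fix S :: "2 list \<Rightarrow> 'k" assume "S \<in> sym_tensors w1"
    then obtain c where "S = sym_tensor c" using sym_tensor_surj by blast
    then show "S \<in> tensor_of ` range comb" using tensor_of_comb by (metis rangeI image_eqI)
  qed (auto simp: tensor_of_comb sym_tensor_in_sym_tensors)
  fix a b u v assume "u \<in> neg_null V \<rho>" "v \<in> neg_null V \<rho>"
  then obtain c d where cd: "u = comb c" "v = comb d" unfolding neg_null_eq by blast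
  show "sc a u + sc b v \<in> neg_null V \<rho>"
    unfolding cd comb_sc comb_add by (rule comb_neg_null)
  show "tensor_of (sc a u + sc b v) = (\<lambda>is. a * tensor_of u is + b * tensor_of v is)"
    unfolding cd comb_sc comb_add tensor_of_comb by (auto simp: fun_eq_iff sym_tensor_def algebra_simps)
qed

text \<open>Each of the \<open>k\<close> slots with index 1 contributes \<open>g 1\<close>, each
  other slot \<open>g 2\<close>. Turning a 1 into a 2 gives \<open>t (k - 1)\<close>, and the number
  \<open>k\<close> of such slots completes \<open>(k - 1)!\<close> to \<open>k!\<close>; in the
  other direction \<open>(k + 1)!\<close> supplies the factor \<open>k + 1\<close> of the
  coefficient of \<open>f'\<close>.\<close>

lemma sym_action_sym_tensor:
  fixes B :: "real^2^2"
  assumes "trace B = 0"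
  shows "sym_action (\<chi> i j. of_real (B$i$j)) (sym_tensor d)
    = sym_tensor (act (- B$2$2) (- B$1$1) 0 (- B$2$1) (- B$1$2) d)"
proof
  fix "is" :: "2 list"
  define t where "t = (\<lambda>k. of_nat (fact k) * d k)"
  define k where "k = count (mset is) 1"
  have B22: "B$2$2 = - B$1$1" using assms by (simp add: trace_def sum_2 eq_neg_iff_add_eq_0 add.commute)
  show "sym_action (\<chi> i j. of_real (B$i$j)) (sym_tensor d) is
    = sym_tensor (act (- B$2$2) (- B$1$1) 0 (- B$2$1) (- B$1$2) d) is"
  proof (cases "length is = w1")
    case True
    define g :: "2 \<Rightarrow> 'k" where "g = (\<lambda>i. if i = 1
      then of_real (B$1$1) * t k + of_real (B$1$2) * t (k - 1)
      else of_real (B$2$1) * t (Suc k) + of_real (B$2$2) * t k)"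
    have k: "k \<le> w1" unfolding k_def using True by (rule count_1_le)
    have inner: "(\<Sum>j\<in>UNIV. (\<chi> i j. of_real (B$i$j)) $ (is ! i) $ j * sym_tensor d (is[i := j])) = g (is ! i)"
      if "i < length is" for i
    proof -
      have T: "sym_tensor d (is[i := j]) = t (k - (if is ! i = 1 then 1 else 0) + (if j = 1 then 1 else 0))" for j
        using True count_1_list_update[OF that, of j] by (simp add: sym_tensor_def t_def k_def)
      consider "is ! i = 1" | "is ! i = 2" using exhaust_2 by blast
      then show ?thesis
      proof cases
        case 1
        then have "1 \<in> set is" using that nth_mem by metis
        then have "0 < k" unfolding k_def by (simp add: count_greater_zero_iff)
        then show ?thesis using 1 by (simp add: sum_2 T g_def)
      next
        case 2
        then show ?thesis by (simp add: sum_2 T g_def)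
      qed
    qed
    have "sym_action (\<chi> i j. of_real (B$i$j)) (sym_tensor d) is = (\<Sum>i<length is. g (is ! i))"
      unfolding sym_action_def using inner by (intro sum.cong) auto
    also have "\<dots> = of_nat k * g 1 + of_nat (w1 - k) * g 2"
      using sum_nth_two_valued[of g "is"] unfolding k_def True .
    also have "\<dots> = of_nat (fact k) * act (- B$2$2) (- B$1$1) 0 (- B$2$1) (- B$1$2) d k"
    proof -
      have e: "of_nat (w1 - k) = (of_nat w1 - of_nat k :: 'k)" using k by (simp add: of_nat_diff)
      have s: "t (Suc k) = of_nat (fact k) * ((of_nat k + 1) * d (Suc k))"
        by (simp add: t_def algebra_simps)
      have p: "of_nat k * t (k - 1) = of_nat (fact k) * (if k = 0 then 0 else d (k - 1))"
        by (cases k) (simp_all add: t_def algebra_simps)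
      have "of_nat k * g 1 + of_nat (w1 - k) * g 2 = of_nat k * (of_real (B$1$1) * t k)
         + of_real (B$1$2) * (of_nat k * t (k - 1))
         + (of_nat w1 - of_nat k) * (of_real (B$2$1) * t (Suc k) - of_real (B$1$1) * t k)"
        unfolding e by (simp add: g_def B22 algebra_simps)
      also have "\<dots> = of_nat (fact k) * act (- B$2$2) (- B$1$1) 0 (- B$2$1) (- B$1$2) d k"
        unfolding p s act_def B22 by (simp add: t_def algebra_simps)
      finally show ?thesis .
    qed
    also have "\<dots> = sym_tensor (act (- B$2$2) (- B$1$1) 0 (- B$2$1) (- B$1$2) d) is"
      using True by (simp add: sym_tensor_def k_def)
    finally show ?thesis .
  next
    case False
    then show ?thesis by (simp add: sym_action_def sym_tensor_def)
  qed
qed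

lemma tensor_of_block_diagonal:
  assumes "v \<in> neg_null V \<rho>" "trace B = 0"
  shows "tensor_of (\<rho> (block_diagonal B 0) v) = sym_action (\<chi> i j. of_real (B$i$j)) (tensor_of v)"
proof -
  obtain d where "v = comb d" using assms(1) unfolding neg_null_eq by blast
  then show ?thesis
    unfolding block_diagonal_eq_g_zero by (simp add: g_zero_comb tensor_of_comb sym_action_sym_tensor[OF assms(2)])
qed

lemma block_diagonal_neg_null:
  "v \<in> neg_null V \<rho> \<Longrightarrow> \<rho> (block_diagonal B c) v \<in> neg_null V \<rho>"
  unfolding block_diagonal_eq_g_zero by (rule neg_null_g_zero)

lemma tensor_of_Phi:
  assumes "v \<in> neg_null V \<rho>"
  shows "tensor_of (Phi \<rho> X v) = sym_action (\<chi> i j. of_real (branch_matrix X $ i $ j)) (tensor_of v)"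
proof -
  have v: "v \<in> V" using assms neg_null_subset by blast
  have "trace (branch_matrix X) = 0" by (simp add: trace_def sum_2 branch_matrix_def)
  moreover have "Phi \<rho> X v = \<rho> (block_diagonal (branch_matrix X) 0) v"
    unfolding Phi_def alpha_eq block_diagonal_branch_matrix
    using assms v by (simp add: rho_mat rho_neg_null)
  ultimately show ?thesis using tensor_of_block_diagonal[OF assms] by simp
qed

section \<open>Lowest weight vectors and the submodule they generate\<close>

lemma n0_weight:
  "\<rho> (cartan a b c) n0
    = sc (of_real ((a + b) / 2 * (- real m) + (a - b) / 2 * (- real w1)) + of_real c * \<kappa>) n0"
  unfolding cartan_eq_g_zero n0_eq_comb g_zero_comb comb_sc
  by (rule comb_cong) (simp add: act_def)

lemma strictly_lower_n0:
  assumes "X \<in> so24" "strictly_lower X"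
  shows "\<rho> X n0 = 0"
proof -
  obtain p q r s w x where X: "X = g_neg p q r s w + g_zero 0 0 0 x 0"
    using assms strictly_lower_iff by blast
  have "\<rho> (g_zero 0 0 0 x 0) n0 = comb (\<lambda>k. 0)"
    unfolding n0_eq_comb g_zero_comb by (rule comb_cong) (simp add: act_def)
  moreover have "n0 \<in> neg_null V \<rho>" using comb_neg_null n0_eq_comb by metis
  ultimately show ?thesis
    unfolding X using n0_in_V by (simp add: rho_mat rho_neg_null comb_zero)
qed

text \<open>The nilradical forces \<open>v\<close> into the annihilator, and \<open>f'\<close>
  carries every coefficient except the one at 0 to a nonzero multiple, so only that one
  survives.\<close>

lemma lowest_weight_vector_unique:
  assumes v: "v \<in> V" "v \<noteq> 0" "\<And>X. X \<in> so24 \<Longrightarrow> strictly_lower X \<Longrightarrow> \<rho> X v = 0"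
  obtains a where "a \<noteq> 0" "v = sc a n0"
proof -
  have low: "\<rho> (g_neg p q r s w) v = 0" "\<rho> f' v = 0" for p q r s w
  proof -
    have "g_neg p q r s w = g_neg p q r s w + g_zero 0 0 0 0 0" "f' = g_neg 0 0 0 0 0 + f'" by simp_all
    then have "strictly_lower (g_neg p q r s w)" "strictly_lower f'"
      using strictly_lower_iff by blast+
    then show "\<rho> (g_neg p q r s w) v = 0" "\<rho> f' v = 0" by (simp_all add: v(3))
  qed
  have "v \<in> neg_null V \<rho>" unfolding neg_null_def using v low by simp
  then obtain c where c: "v = comb c" unfolding neg_null_eq by blast
  have "c (Suc k) = 0" if "k < w1" for k
  proof -
    have "of_real (real (Suc k) * (real w1 - real k)) * c (Suc k) = 0"
      using low(2) comb_eq_0[of "\<lambda>k. of_real (real (Suc k) * (real w1 - real k)) * c (Suc k)" k] that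
      unfolding c f'_comb by simp
    moreover have "real (Suc k) * (real w1 - real k) \<noteq> 0" using that by simp
    ultimately show ?thesis by (metis mult_eq_0_iff of_real_eq_0_iff)
  qed
  then have "c k = c 0 * (if k = 0 then 1 else 0)" if "k \<le> w1" for k
    using that by (cases k) auto
  then have "v = sc (c 0) n0" unfolding c n0_eq_comb comb_sc by (rule comb_cong)
  moreover from this have "c 0 \<noteq> 0" using v(2) n0_in_V by auto
  ultimately show thesis using that by blast
qed

lemma neg_null_eq_submodule_generated:
  assumes a: "a \<noteq> 0"
  shows "neg_null V \<rho> = submodule_generated sl2_so2 \<rho> (sc a n0)"
  unfolding submodule_generated_def
proof (intro equalityI subsetI)
  fix v assume "v \<in> neg_null V \<rho>"
  then obtain c where c: "v = comb c" unfolding neg_null_eq by blast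
  show "v \<in> (\<lambda>W. subspace W \<and> invariant_under sl2_so2 \<rho> W) hull {sc a n0}"
    unfolding hull_def
  proof (intro InterI, elim CollectE conjE)
    fix W assume W: "subspace W" "invariant_under sl2_so2 \<rho> W" "{sc a n0} \<subseteq> W"
    have inv: "\<rho> (g_zero s (- s) t x z) u \<in> W" if "u \<in> W" for s t x z u
      using W(2) that unfolding invariant_under_def sl2_so2_eq by blast
    have "sc d n0 \<in> W" for d
    proof -
      \<comment> \<open>\<open>W\<close> is only a real subspace; its closure under
        \<open>so2\<close>, which acts as \<open>\<kappa>\<close>, yields all scalar multiples, here
        the multiple of \<open>sc a n0\<close> by \<open>d / a\<close>.\<close>
      obtain \<alpha> \<beta> where ab: "d / a = of_real \<alpha> + of_real \<beta> * \<kappa>" using real_span by blast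
      have "\<rho> so2 (sc a n0) = sc \<kappa> (sc a n0)"
        unfolding rho_sc[OF g_in_so24(2) n0_in_V] so2_basis_vec[of 0, unfolded basis_vec_0]
          sc_mult[OF n0_in_V, symmetric] by (simp add: mult.commute)
      moreover have "\<rho> so2 (sc a n0) \<in> W" using inv[of "sc a n0" 0 1 0 0] W(3) by simp
      ultimately have "\<alpha> *\<^sub>R sc a n0 + \<beta> *\<^sub>R sc \<kappa> (sc a n0) \<in> W"
        using W(1,3) by (intro subspace_add subspace_scale) auto
      also have "\<alpha> *\<^sub>R sc a n0 + \<beta> *\<^sub>R sc \<kappa> (sc a n0) = sc (d / a) (sc a n0)"
        unfolding ab using n0_in_V
        by (simp add: sc_add_left sc_closed sc_of_real sc_mult)
      also have "\<dots> = sc d n0" using a sc_mult[OF n0_in_V, of "d / a" a] by simp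
      finally show ?thesis .
    qed
    then have "(\<rho> e' ^^ k) (sc d n0) \<in> W" for k d
      using inv[of _ 0 0 0 "- 1"] by (induction k) simp_all
    then have "sc d (basis_vec k) \<in> W" for k d
      unfolding basis_vec_def funpow_sc[OF sl2_up(1) n0_in_V] .
    then show "v \<in> W" unfolding c comb_def by (intro subspace_sum[OF W(1)])
  qed
next
  have "sc a n0 \<in> neg_null V \<rho>" unfolding n0_eq_comb comb_sc by (rule comb_neg_null)
  moreover have "invariant_under sl2_so2 \<rho> (neg_null V \<rho>)"
    unfolding invariant_under_def sl2_so2_eq using neg_null_g_zero by blast
  ultimately have "(\<lambda>W. subspace W \<and> invariant_under sl2_so2 \<rho> W) hull {sc a n0} \<subseteq> neg_null V \<rho>"
    using subspace_neg_null by (intro hull_minimal) auto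
  then show "v \<in> neg_null V \<rho>"
    if "v \<in> (\<lambda>W. subspace W \<and> invariant_under sl2_so2 \<rho> W) hull {sc a n0}" for v
    using that by blast
qed

lemma normal_values_structure:
  "k_rep (normal_values V \<rho>) (Phi \<rho>)"
  "parametrises_normal_solutions V \<rho> (normal_values V \<rho>)"
  "\<exists>T. linear_iso_sym sc (normal_values V \<rho>) w1 T \<and>
    (\<forall>v\<in>normal_values V \<rho>. \<forall>B. trace B = 0 \<longrightarrow>
       \<rho> (block_diagonal B 0) v \<in> normal_values V \<rho> \<and>
       T (\<rho> (block_diagonal B 0) v) = sym_action (\<chi> i j. of_real (B $ i $ j)) (T v)) \<and>
    (\<forall>v\<in>normal_values V \<rho>. \<forall>X.
       T (Phi \<rho> X v) = sym_action (\<chi> i j. of_real (branch_matrix X $ i $ j)) (T v))"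
proof -
  show "parametrises_normal_solutions V \<rho> (normal_values V \<rho>)" by (rule parametrises)
  show "k_rep (normal_values V \<rho>) (Phi \<rho>)"
    unfolding normal_values_eq_neg_null by (rule k_rep_neg_null)
  show "\<exists>T. linear_iso_sym sc (normal_values V \<rho>) w1 T \<and>
    (\<forall>v\<in>normal_values V \<rho>. \<forall>B. trace B = 0 \<longrightarrow>
       \<rho> (block_diagonal B 0) v \<in> normal_values V \<rho> \<and>
       T (\<rho> (block_diagonal B 0) v) = sym_action (\<chi> i j. of_real (B $ i $ j)) (T v)) \<and>
    (\<forall>v\<in>normal_values V \<rho>. \<forall>X.
       T (Phi \<rho> X v) = sym_action (\<chi> i j. of_real (branch_matrix X $ i $ j)) (T v))"
    unfolding normal_values_eq_neg_null
    using linear_iso_tensor_of block_diagonal_neg_null tensor_of_block_diagonal tensor_of_Phi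
    by (intro exI[of _ tensor_of]) simp
qed

lemma normal_values_submodule:
  assumes "v \<in> V" "v \<noteq> 0" "\<And>X. X \<in> so24 \<Longrightarrow> strictly_lower X \<Longrightarrow> \<rho> X v = 0"
  shows "normal_values V \<rho> = submodule_generated sl2_so2 \<rho> v"
proof -
  obtain a where "a \<noteq> 0" "v = sc a n0" using lowest_weight_vector_unique[OF assms] by metis
  then show ?thesis
    unfolding normal_values_eq_neg_null using neg_null_eq_submodule_generated by simp
qed

end

section \<open>Real and complex irreducible representations as instances\<close>

lemma weight_comb_eq:
  "weight_comb w1 w2 w3 a b c = of_real (real w1 * a + (real w2 + real w3) / 2 * (a + b))
    + \<i> * of_real ((real w3 - real w2) / 2 * c)"
  unfolding weight_comb_def fund_weight1_def fund_weight2_def fund_weight3_def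
  by (simp add: field_simps)

text \<open>For equal half-spin coefficients the weight is real, so both components of a highest
  weight vector of the complexification satisfy its equations in \<open>V\<close>, and one of them
  is not zero.\<close>

lemma real_irrep_so24_highest_weight:
  assumes "real_irrep V \<rho> (weight_comb w1 w w)"
  obtains v0 where "so24_highest_weight V \<rho> scaleR v0 0 w1 w w"
proof -
  have rep: "so24_rep V \<rho>" and irr: "irreducible_rep V \<rho>"
    using assms unfolding real_irrep_def by auto
  interpret so24_module V \<rho> using rep by unfold_locales
  obtain u v where uv: "highest_weight_vector (V \<times> V) complexify_J (complexify_rep \<rho>) (weight_comb w1 w w) (u, v)"
    using assms unfolding real_irrep_def by auto
  have weight: "\<rho> (cartan a b c) x = (real w1 * a + (real w + real w) / 2 * (a + b)) *\<^sub>R x"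
    if "x \<in> {u, v}" for a b c x
    using uv that unfolding highest_weight_vector_def weight_vector_def
    by (auto simp: complexify_rep_def scaleC_def weight_comb_eq)
  have upper: "\<rho> X x = 0" if "x \<in> {u, v}" "X \<in> so24" "strictly_upper X" for X x
    using uv that unfolding highest_weight_vector_def by (auto simp: complexify_rep_def zero_prod_def)
  have V: "u \<in> V" "v \<in> V" and "u \<noteq> 0 \<or> v \<noteq> 0"
    using uv unfolding highest_weight_vector_def weight_vector_def by (auto simp: zero_prod_def)
  then obtain v0 where v0: "v0 \<in> {u, v}" "v0 \<noteq> 0" by blast
  have "so24_highest_weight V \<rho> scaleR v0 0 w1 w w"
  proof unfold_locales
    show "v0 \<in> V" "v0 \<noteq> 0" using v0 V by auto
    show "\<rho> X v0 = 0" if "X \<in> so24" "strictly_upper X" for X using upper[OF v0(1) that] .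
    show "\<rho> (cartan a b 0) v0 = (real w1 * a + (real w + real w) / 2 * (a + b)) *\<^sub>R v0" for a b
      by (rule weight[OF v0(1)])
    show "\<rho> (cartan 0 0 1) v0 = 0 *\<^sub>R v0" using weight[OF v0(1), of 0 0 1] by simp
    show "\<exists>\<alpha> \<beta>. c = of_real \<alpha> + of_real \<beta> * 0" for c :: real by (intro exI[of _ c]) simp
    show "W = {0} \<or> W = V"
      if "subspace W" "W \<subseteq> V" "invariant_under so24 \<rho> W" for W
      using irr that unfolding irreducible_rep_def by blast
  qed (simp_all add: scaleR_add_right scaleR_add_left)
  then show thesis by (rule that)
qed

lemma complex_irrep_so24_highest_weight:
  assumes "complex_irrep V J \<rho> (weight_comb w1 w2 w3)" "w2 \<noteq> w3"
  obtains v0 where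
    "so24_highest_weight V \<rho> (scaleC J) v0 (\<i> * of_real ((real w3 - real w2) / 2)) w1 w2 w3"
proof -
  have rep: "so24_rep V \<rho>" and J: "complex_structure V J" and irr: "irreducible_complex_rep V J \<rho>"
    and com: "\<And>X v. X \<in> so24 \<Longrightarrow> v \<in> V \<Longrightarrow> \<rho> X (J v) = J (\<rho> X v)"
    using assms unfolding complex_irrep_def by auto
  interpret so24_module V \<rho> using rep by unfold_locales
  obtain v0 where v0: "highest_weight_vector V J \<rho> (weight_comb w1 w2 w3) v0"
    using assms unfolding complex_irrep_def by auto
  have JV: "J v \<in> V" "J (J v) = - v" if "v \<in> V" for v
    using J that unfolding complex_structure_def by auto
  have Jlin: "J (a *\<^sub>R u + b *\<^sub>R v) = a *\<^sub>R J u + b *\<^sub>R J v" if "u \<in> V" "v \<in> V" for a b u v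
    using J that unfolding complex_structure_def by auto
  let ?\<kappa> = "\<i> * of_real ((real w3 - real w2) / 2) :: complex"
  have "so24_highest_weight V \<rho> (scaleC J) v0 ?\<kappa> w1 w2 w3"
  proof unfold_locales
    show "v0 \<in> V" "v0 \<noteq> 0" using v0 unfolding highest_weight_vector_def weight_vector_def by auto
    show "\<rho> X v0 = 0" if "X \<in> so24" "strictly_upper X" for X
      using v0 that unfolding highest_weight_vector_def by auto
    have w: "\<rho> (cartan a b c) v0 = scaleC J (weight_comb w1 w2 w3 a b c) v0" for a b c
      using v0 unfolding highest_weight_vector_def weight_vector_def by auto
    show "\<rho> (cartan a b 0) v0 = (real w1 * a + (real w2 + real w3) / 2 * (a + b)) *\<^sub>R v0" for a b
      unfolding w weight_comb_eq scaleC_def by simp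
    show "\<rho> (cartan 0 0 1) v0 = scaleC J ?\<kappa> v0"
      unfolding w weight_comb_eq scaleC_def by simp
    \<comment> \<open>Because \<open>w2 \<noteq> w3\<close>, the scalar \<open>?\<kappa>\<close> is
      a nonzero imaginary number and forms with 1 a real basis of the complex numbers.\<close>
    show "\<exists>\<alpha> \<beta>. c = of_real \<alpha> + of_real \<beta> * ?\<kappa>" for c :: complex
      using assms(2) by (intro exI[of _ "Re c"] exI[of _ "2 * Im c / (real w3 - real w2)"])
        (simp add: complex_eq_iff)
    show "W = {0} \<or> W = V"
      if W: "subspace W" "W \<subseteq> V" "\<And>c v. v \<in> W \<Longrightarrow> scaleC J c v \<in> W" "invariant_under so24 \<rho> W" for W
    proof -
      have "J ` W \<subseteq> W" using W(3)[of _ \<i>] by (auto simp: scaleC_def)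
      then show ?thesis using irr W unfolding irreducible_complex_rep_def by blast
    qed
    fix u v c d assume V: "u \<in> V" "v \<in> V"
    show "scaleC J c v \<in> V" using V JV by (simp add: scaleC_def)
    show "scaleC J c (u + v) = scaleC J c u + scaleC J c v"
      using Jlin[OF V, of 1 1] by (simp add: scaleC_def algebra_simps)
    show "scaleC J (c + d) v = scaleC J c v + scaleC J d v"
      by (simp add: scaleC_def algebra_simps)
    show "scaleC J (c * d) v = scaleC J c (scaleC J d v)"
      unfolding scaleC_def Jlin[OF V(2) JV(1)[OF V(2)], of "Re d" "Im d"] JV(2)[OF V(2)]
      by (simp add: algebra_simps)
    show "scaleC J (of_real r) v = r *\<^sub>R v" for r by (simp add: scaleC_def)
    show "\<rho> X (scaleC J c v) = scaleC J c (\<rho> X v)" if "X \<in> so24" for X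
      using lincomb_vec[OF that V(2) JV(1)[OF V(2)]] com[OF that V(2)] by (simp add: scaleC_def)
  qed
  then show thesis by (rule that)
qed

lemma real_irrep_normal_values:
  assumes "w2 = w3 \<and> real_irrep V \<rho> (weight_comb w1 w2 w3)"
  shows "k_rep (normal_values V \<rho>) (Phi \<rho>)" "parametrises_normal_solutions V \<rho> (normal_values V \<rho>)"
    "\<exists>T. linear_iso_sym scaleR (normal_values V \<rho>) w1 T \<and>
      (\<forall>v\<in>normal_values V \<rho>. \<forall>B. trace B = 0 \<longrightarrow>
         \<rho> (block_diagonal B 0) v \<in> normal_values V \<rho> \<and>
         T (\<rho> (block_diagonal B 0) v) = sym_action B (T v)) \<and>
      (\<forall>v\<in>normal_values V \<rho>. \<forall>X. T (Phi \<rho> X v) = sym_action (branch_matrix X) (T v))"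
    "\<exists>v. lowest_weight_vector (V \<times> V) complexify_J (complexify_rep \<rho>) (v, 0)"
    "\<forall>v. lowest_weight_vector (V \<times> V) complexify_J (complexify_rep \<rho>) (v, 0) \<longrightarrow>
      normal_values V \<rho> = submodule_generated sl2_so2 \<rho> v"
proof -
  from conjunct2[OF assms] have "real_irrep V \<rho> (weight_comb w1 w3 w3)"
    unfolding conjunct1[OF assms] .
  then obtain v0 where "so24_highest_weight V \<rho> scaleR v0 0 w1 w3 w3"
    using real_irrep_so24_highest_weight by metis
  then interpret so24_highest_weight V \<rho> scaleR v0 0 w1 w3 w3 .
  show "k_rep (normal_values V \<rho>) (Phi \<rho>)" "parametrises_normal_solutions V \<rho> (normal_values V \<rho>)"
    by (rule normal_values_structure)+
  have "(\<chi> i j. of_real (B $ i $ j)) = B" for B :: "real^2^2"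
    by (simp add: vec_eq_iff)
  then show "\<exists>T. linear_iso_sym scaleR (normal_values V \<rho>) w1 T \<and>
      (\<forall>v\<in>normal_values V \<rho>. \<forall>B. trace B = 0 \<longrightarrow>
         \<rho> (block_diagonal B 0) v \<in> normal_values V \<rho> \<and>
         T (\<rho> (block_diagonal B 0) v) = sym_action B (T v)) \<and>
      (\<forall>v\<in>normal_values V \<rho>. \<forall>X. T (Phi \<rho> X v) = sym_action (branch_matrix X) (T v))"
    using normal_values_structure(3) by simp
  have "lowest_weight_vector (V \<times> V) complexify_J (complexify_rep \<rho>) (n0, 0)"
    unfolding lowest_weight_vector_def weight_vector_def
  proof (intro conjI exI allI ballI impI)
    show "complexify_rep \<rho> (cartan a b c) (n0, 0)
      = scaleC complexify_J (of_real ((a + b) / 2 * (- real m) + (a - b) / 2 * (- real w1))) (n0, 0)" for a b c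
      using n0_weight[of a b c] by (simp add: complexify_rep_def scaleC_def cartan_eq_g_zero)
    show "complexify_rep \<rho> X (n0, 0) = 0" if "X \<in> so24" "strictly_lower X" for X
      using strictly_lower_n0[OF that] that by (simp add: complexify_rep_def zero_prod_def)
  qed (use n0_in_V n0_nonzero in \<open>auto simp: zero_prod_def\<close>)
  then show "\<exists>v. lowest_weight_vector (V \<times> V) complexify_J (complexify_rep \<rho>) (v, 0)" by blast
  show "\<forall>v. lowest_weight_vector (V \<times> V) complexify_J (complexify_rep \<rho>) (v, 0) \<longrightarrow>
      normal_values V \<rho> = submodule_generated sl2_so2 \<rho> v"
    unfolding lowest_weight_vector_def weight_vector_def
    by (intro allI impI normal_values_submodule) (auto simp: complexify_rep_def zero_prod_def)
qed

lemma complex_irrep_normal_values: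
  assumes "w2 \<noteq> w3 \<and> complex_irrep V J \<rho> (weight_comb w1 w2 w3)"
  shows "k_rep (normal_values V \<rho>) (Phi \<rho>)" "parametrises_normal_solutions V \<rho> (normal_values V \<rho>)"
    "\<exists>T. linear_iso_sym (scaleC J) (normal_values V \<rho>) w1 T \<and>
      (\<forall>v\<in>normal_values V \<rho>. \<forall>B. trace B = 0 \<longrightarrow>
         \<rho> (block_diagonal B 0) v \<in> normal_values V \<rho> \<and>
         T (\<rho> (block_diagonal B 0) v) = sym_action (complexify_matrix B) (T v)) \<and>
      (\<forall>v\<in>normal_values V \<rho>. \<forall>X.
         T (Phi \<rho> X v) = sym_action (complexify_matrix (branch_matrix X)) (T v))"
    "\<exists>v. lowest_weight_vector V J \<rho> v"
    "\<forall>v. lowest_weight_vector V J \<rho> v \<longrightarrow> normal_values V \<rho> = submodule_generated sl2_so2 \<rho> v"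
proof -
  obtain v0 where "so24_highest_weight V \<rho> (scaleC J) v0 (\<i> * of_real ((real w3 - real w2) / 2)) w1 w2 w3"
    using complex_irrep_so24_highest_weight assms by metis
  then interpret so24_highest_weight V \<rho> "scaleC J" v0 "\<i> * of_real ((real w3 - real w2) / 2)" w1 w2 w3 .
  show "k_rep (normal_values V \<rho>) (Phi \<rho>)" "parametrises_normal_solutions V \<rho> (normal_values V \<rho>)"
    by (rule normal_values_structure)+
  show "\<exists>T. linear_iso_sym (scaleC J) (normal_values V \<rho>) w1 T \<and>
      (\<forall>v\<in>normal_values V \<rho>. \<forall>B. trace B = 0 \<longrightarrow>
         \<rho> (block_diagonal B 0) v \<in> normal_values V \<rho> \<and>
         T (\<rho> (block_diagonal B 0) v) = sym_action (complexify_matrix B) (T v)) \<and>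
      (\<forall>v\<in>normal_values V \<rho>. \<forall>X.
         T (Phi \<rho> X v) = sym_action (complexify_matrix (branch_matrix X)) (T v))"
    unfolding complexify_matrix_def by (rule normal_values_structure(3))
  have "lowest_weight_vector V J \<rho> n0"
    unfolding lowest_weight_vector_def weight_vector_def
  proof (intro conjI exI allI ballI impI)
    show "\<rho> (cartan a b c) n0
      = scaleC J (of_real ((a + b) / 2 * (- real m) + (a - b) / 2 * (- real w1))
        + of_real c * (\<i> * of_real ((real w3 - real w2) / 2))) n0" for a b c
      by (rule n0_weight)
  qed (use n0_in_V n0_nonzero strictly_lower_n0 in auto)
  then show "\<exists>v. lowest_weight_vector V J \<rho> v" by blast
  show "\<forall>v. lowest_weight_vector V J \<rho> v \<longrightarrow> normal_values V \<rho> = submodule_generated sl2_so2 \<rho> v"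
    unfolding lowest_weight_vector_def weight_vector_def
    by (intro allI impI normal_values_submodule) auto
qed

section \<open>Twistor spinors\<close>

text \<open>The sum of Clifford products in closed form, simplified by skewness; it represents
  \<open>spin_rep\<close> on \<open>so24\<close> only.\<close>

definition spin_mat :: "real^6^6 \<Rightarrow> complex^4^4" where
  "spin_mat X = vector
    [vector [Complex ((X$1$1 + X$2$2) / 2) (X$4$3 / 2), Complex (X$2$3) (X$2$4),
       Complex (- X$1$3) (- X$1$4), of_real (2 * X$1$5)],
     vector [Complex (X$3$2 / 2) (- X$4$2 / 2), Complex ((X$1$1 - X$2$2) / 2) (- X$4$3 / 2),
       of_real (X$1$2), Complex (X$1$3) (- X$1$4)],
     vector [Complex (- X$3$1 / 2) (X$4$1 / 2), of_real (X$2$1),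
       Complex ((X$2$2 - X$1$1) / 2) (- X$4$3 / 2), Complex (X$2$3) (- X$2$4)],
     vector [of_real (X$5$1 / 2), Complex (X$3$1 / 2) (X$4$1 / 2),
       Complex (X$3$2 / 2) (X$4$2 / 2), Complex (- (X$1$1 + X$2$2) / 2) (X$4$3 / 2)]]"

lemma spin_rep_eq:
  assumes "X \<in> so24"
  shows "spin_rep X \<psi> = spin_mat X *v \<psi>"
proof -
  have col: "X *v axis i 1 = (\<chi> j. X$j$i)" for i
    by (simp only: matrix_vector_mult_basis column_def)
  have "(1 / 4) *\<^sub>R (\<Sum>i\<in>UNIV. clifford (X *v axis i 1) ** clifford' (dual_basis i)) = spin_mat X"
    using assms unfolding so24_iff_skew col
    by (simp add: vec_eq_iff forall_4 sum_6 matrix_matrix_mult_def sum_4 clifford_def clifford'_def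
        dual_basis_def vector_6_nth vector_4_nth spin_mat_def axis_def complex_eq_iff)
  then show ?thesis unfolding spin_rep_def by simp
qed

lemma spin_mat_commutator:
  assumes "X \<in> so24" "Y \<in> so24"
  shows "spin_mat (commutator X Y) = spin_mat X ** spin_mat Y - spin_mat Y ** spin_mat X"
proof -
  obtain p q r s w a b c x z p' q' r' s' w' where
    X: "X = g_neg p q r s w + g_zero a b c x z + g_pos p' q' r' s' w'"
    using assms(1) by (rule so24_cases)
  obtain P Q R S W A B C D Z P' Q' R' S' W' where
    Y: "Y = g_neg P Q R S W + g_zero A B C D Z + g_pos P' Q' R' S' W'"
    using assms(2) by (rule so24_cases)

  show ?thesis
    unfolding X Y
    by (simp add: vec_eq_iff forall_4 matrix_matrix_mult_def sum_4 spin_mat_def vector_4_nth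
        commutator_nth g_neg_def g_zero_def g_pos_def vector_6_nth complex_eq_iff)
      (simp add: field_simps)
qed

lemma so24_rep_spin_rep: "so24_rep UNIV spin_rep"
proof -
  have lin: "spin_mat (a *\<^sub>R X + b *\<^sub>R Y) *v \<psi> = a *\<^sub>R (spin_mat X *v \<psi>) + b *\<^sub>R (spin_mat Y *v \<psi>)" for a b X Y \<psi>
    by (simp add: vec_eq_iff forall_4 matrix_vector_mult_def sum_4 spin_mat_def vector_4_nth complex_eq_iff)
      (simp add: field_simps)
  have vec: "M *v (a *\<^sub>R u + b *\<^sub>R v) = a *\<^sub>R (M *v u) + b *\<^sub>R (M *v v)" for a b u v and M :: "complex^4^4"
    by (simp add: vec_eq_iff forall_4 matrix_vector_mult_def sum_4 algebra_simps)
  show ?thesis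
    unfolding so24_rep_def
    by (simp add: spin_rep_eq so24_lincomb commutator_so24 lin vec spin_mat_commutator
        matrix_vector_mult_diff_rdistrib matrix_vector_mul_assoc)
qed

interpretation spin: so24_module UNIV spin_rep
  using so24_rep_spin_rep by unfold_locales

lemma spin_rep_g_neg:
  "spin_rep (g_neg p q r s w) \<psi> = vector [0,
     Complex (r / 2) (- s / 2) * \<psi>$1, Complex (- p / 2) (q / 2) * \<psi>$1,
     of_real (w / 2) * \<psi>$1 + Complex (p / 2) (q / 2) * \<psi>$2 + Complex (r / 2) (s / 2) * \<psi>$3]"
  unfolding spin_rep_eq[OF g_in_so24(1)]
  by (simp add: vec_eq_iff forall_4 matrix_vector_mult_def sum_4 spin_mat_def vector_4_nth
      g_neg_def vector_6_nth complex_eq_iff)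

lemma spin_rep_g_zero:
  "spin_rep (g_zero a b c x z) \<psi> = vector [Complex ((a + b) / 2) (c / 2) * \<psi>$1,
     Complex ((a - b) / 2) (- c / 2) * \<psi>$2 + of_real z * \<psi>$3,
     of_real x * \<psi>$2 + Complex ((b - a) / 2) (- c / 2) * \<psi>$3,
     Complex (- (a + b) / 2) (c / 2) * \<psi>$4]"
  unfolding spin_rep_eq[OF g_in_so24(2)]
  by (simp add: vec_eq_iff forall_4 matrix_vector_mult_def sum_4 spin_mat_def vector_4_nth
      g_zero_def vector_6_nth complex_eq_iff)

lemma neg_null_spin_rep: "neg_null UNIV spin_rep = {\<psi>. \<psi>$1 = 0 \<and> \<psi>$2 = 0 \<and> \<psi>$3 = 0}"
proof (intro equalityI subsetI)
  fix \<psi> :: "complex^4" assume "\<psi> \<in> neg_null UNIV spin_rep"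
  then have *: "spin_rep (g_neg p q r s w) \<psi> = 0" for p q r s w by (simp add: neg_null_def)
  have "of_real (1 / 2) * \<psi>$1 = 0" "of_real (1 / 2) * \<psi>$2 = 0" "of_real (1 / 2) * \<psi>$3 = 0"
    using *[of 0 0 0 0 1] *[of 1 0 0 0 0] *[of 0 0 1 0 0]
    by (simp_all add: spin_rep_g_neg vec_eq_iff forall_4 vector_4_nth complex_eq_iff)
  then show "\<psi> \<in> {\<psi>. \<psi>$1 = 0 \<and> \<psi>$2 = 0 \<and> \<psi>$3 = 0}" by simp
qed (auto simp: neg_null_def spin_rep_g_neg vec_eq_iff forall_4 vector_4_nth)

lemma spin_eigenspace: "spin.eigenspace grading_elt (- (1 / 2)) = {\<psi>. \<psi>$1 = 0 \<and> \<psi>$2 = 0}"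
  unfolding spin.eigenspace_def grading_elt_eq_g_zero
  by (auto simp: spin_rep_g_zero vec_eq_iff forall_4 vector_4_nth complex_eq_iff)

lemma spin_from_on: "UNIV \<subseteq> spin.from_on grading_elt (- (1 / 2))"
proof
  fix \<psi> :: "complex^4"
  let ?u = "vector [\<psi>$1, \<psi>$2, 0, 0] :: complex^4" and ?v = "vector [0, 0, \<psi>$3, \<psi>$4] :: complex^4"
  have "spin_rep grading_elt ?u = (1 / 2) *\<^sub>R ?u" "spin_rep grading_elt ?v = (- (1 / 2)) *\<^sub>R ?v"
    unfolding grading_elt_eq_g_zero
    by (simp_all add: spin_rep_g_zero vec_eq_iff forall_4 vector_4_nth complex_eq_iff)
  then have "?u \<in> spin.from_on grading_elt (- (1 / 2))" "?v \<in> spin.from_on grading_elt (- (1 / 2))"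
    unfolding spin.from_on_def
    by (intro span_base CollectI conjI UNIV_I exI[of _ "1 / 2"] exI[of _ "- (1 / 2)"]; simp)+
  then have "?u + ?v \<in> spin.from_on grading_elt (- (1 / 2))"
    unfolding spin.from_on_def by (rule span_add)
  moreover have "?u + ?v = \<psi>" by (simp add: vec_eq_iff forall_4 vector_4_nth)
  ultimately show "\<psi> \<in> spin.from_on grading_elt (- (1 / 2))" by simp
qed

lemma axis_4_spin_eigenspace:
  "axis 4 1 \<in> spin.eigenspace grading_elt (- (1 / 2))" "axis 4 1 \<noteq> (0 :: complex^4)"
  unfolding spin_eigenspace by (simp_all add: axis_def axis_eq_0_iff[unfolded axis_def])

lemma twistor_spinors:
  "lowest_eigenspace UNIV spin_rep = {\<psi>. \<psi>$1 = 0 \<and> \<psi>$2 = 0}"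
  "\<exists>\<Lambda>. weight_vector UNIV (\<lambda>\<psi>. \<i> *s \<psi>) spin_rep \<Lambda> (axis 3 1)"
  "lowest_weight_vector UNIV (\<lambda>\<psi>. \<i> *s \<psi>) spin_rep (axis 4 1)"
  "neighbourhood U \<Longrightarrow> normal_solution UNIV spin_rep U \<sigma> \<longleftrightarrow>
    (\<exists>!v :: real^2. \<forall>p\<in>U. \<sigma> p = vector [0, 0, 0, Complex (v$1) (v$2)])"
proof -
  show "lowest_eigenspace UNIV spin_rep = {\<psi>. \<psi>$1 = 0 \<and> \<psi>$2 = 0}"
    unfolding spin.lowest_eigenspace_eq[OF spin_from_on axis_4_spin_eigenspace] by (rule spin_eigenspace)
  have weight: "weight_vector UNIV (\<lambda>\<psi>. \<i> *s \<psi>) spin_rep (\<lambda>a b c. Complex ((b - a) / 2) (- c / 2)) (axis 3 1)"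
    "weight_vector UNIV (\<lambda>\<psi>. \<i> *s \<psi>) spin_rep (\<lambda>a b c. Complex (- (a + b) / 2) (c / 2)) (axis 4 1)"
    unfolding weight_vector_def cartan_eq_g_zero
    by (simp_all add: axis_eq_0_iff spin_rep_g_zero vec_eq_iff forall_4 vector_4_nth scaleC_def axis_def complex_eq_iff)
  then show "\<exists>\<Lambda>. weight_vector UNIV (\<lambda>\<psi>. \<i> *s \<psi>) spin_rep \<Lambda> (axis 3 1)" by blast
  have "spin_rep X (axis 4 1) = 0" if "X \<in> so24" "strictly_lower X" for X
  proof -
    obtain p q r s w x where X: "X = g_neg p q r s w + g_zero 0 0 0 x 0"
      using \<open>X \<in> so24\<close> \<open>strictly_lower X\<close> strictly_lower_iff by blast
    show ?thesis
      unfolding X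
      by (simp add: spin.rho_mat spin_rep_g_neg spin_rep_g_zero vec_eq_iff forall_4 vector_4_nth axis_def
          complex_eq_iff)
  qed
  then show "lowest_weight_vector UNIV (\<lambda>\<psi>. \<i> *s \<psi>) spin_rep (axis 4 1)"
    unfolding lowest_weight_vector_def using weight(2) by blast
  let ?f = "\<lambda>v :: real^2. vector [0, 0, 0, Complex (v$1) (v$2)] :: complex^4"
  have range: "neg_null UNIV spin_rep = range ?f"
  proof (intro equalityI subsetI)
    fix \<psi> assume "\<psi> \<in> neg_null UNIV spin_rep"
    then have "\<psi> = ?f (vector [Re (\<psi>$4), Im (\<psi>$4)])"
      unfolding neg_null_spin_rep by (simp add: vec_eq_iff forall_4 vector_4_nth)
    then show "\<psi> \<in> range ?f" by blast
  qed (auto simp: neg_null_spin_rep vector_4_nth)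
  have proj: "lowest_proj UNIV spin_rep (axial_flow spin_rep t (?f v)) = ?f v" for t v
  proof -
    \<comment> \<open>A half-spin representation has \<open>w1 = 0\<close>: the annihilator is a
      complex line killed by the generator of the flow, which is why the solutions are constant in
      the frame.\<close>
    have "spin_rep (g_zero 0 0 0 1 (1 / 2)) (?f v) = 0"
      by (simp add: spin_rep_g_zero vec_eq_iff forall_4 vector_4_nth zero_complex.code[symmetric])
    then have "axial_flow spin_rep t (?f v) = ?f v" by (rule spin.axial_flow_fixed) simp
    moreover have "lowest_proj UNIV spin_rep (?f v) = ?f v"
      by (rule spin.lowest_proj_eq[OF spin_from_on axis_4_spin_eigenspace])
        (simp_all add: spin_eigenspace vector_4_nth spin.above_def span_zero)
    ultimately show ?thesis by simp
  qed
  assume U: "neighbourhood U"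
  then have U0: "0 \<in> U" unfolding neighbourhood_def by blast
  have inj: "v = w" if "?f v = ?f w" for v w
    using that by (simp add: vec_eq_iff forall_4 forall_2 vector_4_nth)
  have "normal_solution UNIV spin_rep U \<sigma> \<longleftrightarrow> (\<exists>v. \<forall>p\<in>U. \<sigma> p = ?f v)"
    unfolding spin.normal_solution_iff[OF U] range by (simp add: proj)
  also have "\<dots> \<longleftrightarrow> (\<exists>!v. \<forall>p\<in>U. \<sigma> p = ?f v)"
    using inj U0 by metis
  finally show "normal_solution UNIV spin_rep U \<sigma> \<longleftrightarrow> (\<exists>!v. \<forall>p\<in>U. \<sigma> p = ?f v)" .
qed

section \<open>Normal conformal Killing fields\<close>

lemma commutator_jacobi:
  "commutator (commutator X Y) Z = commutator X (commutator Y Z) - commutator Y (commutator X Z)"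
proof -
  have l: "A ** (B - C) = A ** B - A ** C" "(B - C) ** A = B ** A - C ** A" for A B C :: "real^6^6"
    by (simp_all add: vec_eq_iff matrix_matrix_mult_def sum_6 algebra_simps)
  show ?thesis
    unfolding commutator_def l by (simp add: matrix_mul_assoc)
qed

lemma so24_rep_commutator: "so24_rep so24 commutator"
  unfolding so24_rep_def
  by (simp add: subspace_so24 commutator_so24 commutator_add commutator_scaleR commutator_jacobi)

interpretation adjoint: so24_module so24 commutator
  using so24_rep_commutator by unfold_locales

lemma neg_null_commutator: "neg_null so24 commutator = range (g_neg 0 0 0 0)"
proof (intro equalityI subsetI)
  fix Z assume "Z \<in> neg_null so24 commutator"
  then have Z: "Z \<in> so24" and *: "commutator (g_neg p q r s w) Z = 0" for p q r s w
    by (auto simp: neg_null_def)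
  from Z obtain p q r s w a b c x z p' q' r' s' w' where
    eq: "Z = g_neg p q r s w + g_zero a b c x z + g_pos p' q' r' s' w'" by (rule so24_cases)
  \<comment> \<open>Selected entries of brackets with the nilradical that together force every
    coordinate of \<open>Z\<close> except \<open>w\<close> to vanish.\<close>
  have "commutator (g_neg 0 0 0 0 1) Z $ 1 $ 1 = 0" "commutator (g_neg 0 0 0 0 1) Z $ 5 $ 1 = 0"
    "commutator (g_neg 1 0 0 0 0) Z $ i $ j = 0" "commutator (g_neg 0 0 1 0 0) Z $ i $ j = 0"
    "commutator (g_neg 0 1 0 0 0) Z $ i $ j = 0" "commutator (g_neg 0 0 0 1 0) Z $ i $ j = 0" for i j
    by (simp_all add: *)
  from this(1,2) this(3)[of 3 1] this(3)[of 3 2] this(3)[of 4 1] this(3)[of 5 1] this(3)[of 5 3]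
    this(4)[of 3 1] this(4)[of 3 2] this(4)[of 4 2] this(4)[of 5 1]
    this(3)[of 1 1] this(3)[of 1 2] this(3)[of 2 1] this(3)[of 2 2] this(3)[of 4 3]
    this(4)[of 1 1] this(4)[of 1 2] this(4)[of 2 1] this(4)[of 2 2] this(4)[of 4 3]
    this(5)[of 5 1] this(6)[of 5 1] this(5)[of 3 1]
  have "Z = g_neg 0 0 0 0 w"
    unfolding eq commutator_nth
    by (simp add: g_neg_def g_zero_def g_pos_def vector_6_nth matrix6_simps)
  then show "Z \<in> range (g_neg 0 0 0 0)" by blast
qed (auto simp: neg_null_def commutator_g_neg_g_neg)

text \<open>The grading by \<open>grading_elt\<close> cuts across the block grading:
  \<open>x\<close> and \<open>z\<close> of the block diagonal part have degrees -1 and 1, while the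
  parameters \<open>r\<close> and \<open>s\<close> of \<open>g_neg\<close> and \<open>g_pos\<close>
  belong to degree 0.\<close>

lemma adjoint_eigenvectors:
  "commutator grading_elt (g_neg 0 0 r s 0 + g_zero a b c 0 0 + g_pos 0 0 r' s' 0)
    = 0 *\<^sub>R (g_neg 0 0 r s 0 + g_zero a b c 0 0 + g_pos 0 0 r' s' 0)"
  "commutator grading_elt (g_neg p q 0 0 w + g_zero 0 0 0 x 0) = (- 1) *\<^sub>R (g_neg p q 0 0 w + g_zero 0 0 0 x 0)"
  "commutator grading_elt (g_zero 0 0 0 0 z + g_pos p q 0 0 w) = 1 *\<^sub>R (g_zero 0 0 0 0 z + g_pos p q 0 0 w)"
  unfolding grading_elt_eq_g_zero commutator_add commutator_g_zero_g_neg commutator_g_zero_g_zero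
    commutator_g_zero_g_pos scaleR_add_right g_scaleR by simp_all

lemma adjoint_from_on: "so24 \<subseteq> adjoint.from_on grading_elt (- 1)"
proof
  fix Z assume "Z \<in> so24"
  then obtain p q r s w a b c x z p' q' r' s' w' where
    eq: "Z = g_neg p q r s w + g_zero a b c x z + g_pos p' q' r' s' w'" by (rule so24_cases)
  let ?x = "g_neg 0 0 r s 0 + g_zero a b c 0 0 + g_pos 0 0 r' s' 0"
    and ?y = "g_neg p q 0 0 w + g_zero 0 0 0 x 0" and ?z = "g_zero 0 0 0 0 z + g_pos p' q' 0 0 w'"
  have "?x \<in> so24" "?y \<in> so24" "?z \<in> so24"
    by (intro subspace_add[OF subspace_so24] g_in_so24)+
  then have "?x \<in> adjoint.from_on grading_elt (- 1)" "?y \<in> adjoint.from_on grading_elt (- 1)"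
    "?z \<in> adjoint.from_on grading_elt (- 1)"
    unfolding adjoint.from_on_def
    using adjoint_eigenvectors(1)[of r s a b c r' s'] adjoint_eigenvectors(2)[of p q w x]
      adjoint_eigenvectors(3)[of z p' q' w']
    by (intro span_base CollectI conjI exI[of _ 0] exI[of _ "- 1"] exI[of _ 1]; simp)+
  then have "?x + ?y + ?z \<in> adjoint.from_on grading_elt (- 1)"
    unfolding adjoint.from_on_def by (rule span_add[OF span_add])
  moreover have "?x + ?y + ?z = Z"
    unfolding eq by (simp add: g_neg_def g_zero_def g_pos_def matrix6_simps)
  ultimately show "Z \<in> adjoint.from_on grading_elt (- 1)" by simp
qed

lemma g_neg_adjoint_eigenspace:
  "g_neg 0 0 0 0 w \<in> adjoint.eigenspace grading_elt (- 1)" "g_neg 0 0 0 0 1 \<noteq> 0"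
  using adjoint_eigenvectors(2)[of 0 0 w 0]
  by (simp_all add: adjoint.eigenspace_def) (simp add: g_neg_def matrix6_simps)

lemma adjoint_flow:
  "axial_flow commutator t (g_neg 0 0 0 0 w) = g_neg 0 0 0 0 w"
  "lowest_proj so24 commutator (g_neg 0 0 0 0 w) = g_neg 0 0 0 0 w"
proof -
  show "axial_flow commutator t (g_neg 0 0 0 0 w) = g_neg 0 0 0 0 w"
    by (rule adjoint.axial_flow_fixed) (simp_all add: commutator_g_zero_g_neg)
  show "lowest_proj so24 commutator (g_neg 0 0 0 0 w) = g_neg 0 0 0 0 w"
    by (rule adjoint.lowest_proj_eq[OF adjoint_from_on g_neg_adjoint_eigenspace])
      (use g_neg_adjoint_eigenspace in \<open>simp_all add: adjoint.above_def span_zero\<close>)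
qed

lemma metric_eq: "metric p $ i $ j = metric 0 $ i $ j + (if i = 1 \<and> j = 1 then (p$2)\<^sup>2 else 0)"
  using exhaust_4[of i] exhaust_4[of j] by (auto simp: metric_def vector_4_nth)

lemma has_derivative_metric:
  "((\<lambda>q. metric q $ i $ j) has_derivative (\<lambda>h. if i = 1 \<and> j = 1 then 2 * p$2 * h$2 else 0)) (at p)"
proof (subst metric_eq, cases "i = 1 \<and> j = 1")
  case True
  then show "((\<lambda>q. metric 0 $ i $ j + (if i = 1 \<and> j = 1 then (q$2)\<^sup>2 else 0)) has_derivative
      (\<lambda>h. if i = 1 \<and> j = 1 then 2 * p$2 * h$2 else 0)) (at p)"
    by (auto intro!: derivative_eq_intros bounded_linear.has_derivative[OF bounded_linear_vec_nth])
next
  case False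
  then show "((\<lambda>q. metric 0 $ i $ j + (if i = 1 \<and> j = 1 then (q$2)\<^sup>2 else 0)) has_derivative
      (\<lambda>h. if i = 1 \<and> j = 1 then 2 * p$2 * h$2 else 0)) (at p)"
    by (simp only: if_False has_derivative_const)
qed

lemma g_neg_bottom_eq:
  "(\<lambda>w. \<chi> i j. if i = 5 \<and> j = 1 then w else if i = 6 \<and> j = 2 then - w else 0) = g_neg 0 0 0 0"
  by (rule ext) (simp add: g_neg_def matrix6_simps)

lemma normal_conformal_Killing_fields:
  assumes U: "neighbourhood U"
  shows "parallel_section so24 commutator U s \<longleftrightarrow> (\<exists>!w. \<forall>p\<in>U. s p = g_neg 0 0 0 0 w)"
    "normal_solution so24 commutator U s \<longleftrightarrow> (\<exists>!w. \<forall>p\<in>U. s p = g_neg 0 0 0 0 w)"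
    "normal_solution so24 commutator U s \<Longrightarrow> conformal_killing_on U (\<lambda>p. tangent_of (s p) p)"
proof -
  have U': "open U" "0 \<in> U" using U unfolding neighbourhood_def by auto
  have inj: "v = w" if "g_neg 0 0 0 0 v = g_neg 0 0 0 0 w" for v w
  proof -
    have "g_neg 0 0 0 0 v $ 5 $ 1 = g_neg 0 0 0 0 w $ 5 $ 1" using that by simp
    then show ?thesis by (simp add: g_neg_def vector_6_nth)
  qed
  have uniq: "(\<exists>w. \<forall>p\<in>U. s p = g_neg 0 0 0 0 w) \<longleftrightarrow> (\<exists>!w. \<forall>p\<in>U. s p = g_neg 0 0 0 0 w)"
    using inj U'(2) by metis
  show "parallel_section so24 commutator U s \<longleftrightarrow> (\<exists>!w. \<forall>p\<in>U. s p = g_neg 0 0 0 0 w)"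
    unfolding adjoint.parallel_section_iff[OF U] neg_null_commutator uniq[symmetric]
    by (simp add: adjoint_flow)
  show sol: "normal_solution so24 commutator U s \<longleftrightarrow> (\<exists>!w. \<forall>p\<in>U. s p = g_neg 0 0 0 0 w)"
    unfolding adjoint.normal_solution_iff[OF U] neg_null_commutator uniq[symmetric]
    by (simp add: adjoint_flow)
  assume "normal_solution so24 commutator U s"
  then obtain w where w: "\<And>p. p \<in> U \<Longrightarrow> s p = g_neg 0 0 0 0 w" unfolding sol by blast
  \<comment> \<open>The field is a constant multiple of the fourth coordinate field. The metric
    coefficients do not depend on that coordinate, so it is even a Killing field and the conformal
    factor can be taken as 0.\<close>
  let ?c = "vector [0, 0, 0, w] :: real^4"
  have c: "tangent_of (s p) p = ?c" if "p \<in> U" for p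
    unfolding w[OF that] tangent_of_def inv_field_def
    by (simp add: g_neg_def vector_6_nth vector_4_nth)
  have "smooth_on U (\<lambda>p. tangent_of (s p) p) \<longleftrightarrow> smooth_on U (\<lambda>p. ?c)"
    by (rule smooth_on_cong[OF U'(1) c])
  then have "smooth_on U (\<lambda>p. tangent_of (s p) p)" by (simp add: smooth_on_def Ck_on_const)
  moreover have "partial i (\<lambda>q. tangent_of (s q) q $ k) p = 0" if "p \<in> U" for i k p
  proof -
    have "frechet_derivative (\<lambda>q. tangent_of (s q) q $ k) (at p) = frechet_derivative (\<lambda>q. ?c $ k) (at p)"
      by (rule frechet_derivative_cong_open[OF U'(1) that]) (simp add: c)
    then show ?thesis unfolding partial_def by simp
  qed
  moreover have "partial 4 (\<lambda>q. metric q $ i $ j) p = 0" for i j p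
    unfolding partial_def frechet_derivative_at[OF has_derivative_metric, symmetric]
    by (simp add: axis_def)
  ultimately show "conformal_killing_on U (\<lambda>p. tangent_of (s p) p)"
    unfolding conformal_killing_on_def
    by (intro conjI exI[of _ "\<lambda>_. 0"] ballI allI) (simp_all add: sum_4 c vector_4_nth)
qed

section \<open>Einstein scales\<close>

definition rescaled_metric :: "(real \<Rightarrow> real) \<Rightarrow> real^4 \<Rightarrow> real^4^4" where
  "rescaled_metric \<phi> p = (1 / (\<phi> (p$1))\<^sup>2) *\<^sub>R metric p"

definition inverse_metric :: "real^4 \<Rightarrow> real^4^4" where
  "inverse_metric p = vector [vector [0, 0, 0, 1],
                              vector [0, 1, 0, 0],
                              vector [0, 0, 1, 0],
                              vector [1, 0, 0, - (p$2)\<^sup>2]]"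

lemma matrix_inv_unique:
  fixes A B :: "real^'n^'n"
  assumes "A ** B = mat 1" "B ** A = mat 1"
  shows "matrix_inv A = B"
  unfolding matrix_inv_def
proof (rule some_equality)
  fix X assume "A ** X = mat 1 \<and> X ** A = mat 1"
  then have "B ** (A ** X) = B" by simp
  then show "X = B" unfolding matrix_mul_assoc assms by simp
qed (use assms in simp)

lemma matrix_inv_rescaled_metric:
  assumes "\<phi> (p$1) \<noteq> 0"
  shows "matrix_inv (rescaled_metric \<phi> p) = (\<phi> (p$1))\<^sup>2 *\<^sub>R inverse_metric p"
proof (rule matrix_inv_unique)
  show "rescaled_metric \<phi> p ** ((\<phi> (p$1))\<^sup>2 *\<^sub>R inverse_metric p) = mat 1"
    "((\<phi> (p$1))\<^sup>2 *\<^sub>R inverse_metric p) ** rescaled_metric \<phi> p = mat 1"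
    using assms
    by (simp_all add: rescaled_metric_def inverse_metric_def metric_def vec_eq_iff forall_4
        matrix_matrix_mult_def sum_4 vector_4_nth mat_def)
qed

text \<open>The Christoffel symbols of \<open>metric / \<phi>\<^sup>2\<close>, with \<open>\<phi>\<close> depending on \<open>t\<close> only, are
  \<open>christoffel_const * x + (\<phi>' / \<phi>) * christoffel_log\<close>, the first summand being those of
  \<^const>\<open>metric\<close>.\<close>

definition christoffel_const :: "4 \<Rightarrow> 4 \<Rightarrow> 4 \<Rightarrow> real" where
  "christoffel_const k i j = (if k = 4 \<and> (i = 1 \<and> j = 2 \<or> i = 2 \<and> j = 1) then 1 else 0)
     - (if k = 2 \<and> i = 1 \<and> j = 1 then 1 else 0)"

definition christoffel_log :: "real^4 \<Rightarrow> 4 \<Rightarrow> 4 \<Rightarrow> 4 \<Rightarrow> real" where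
  "christoffel_log p k i j = (if k = 4 then metric p $ i $ j else 0)
     - (if i = 1 \<and> k = j then 1 else 0) - (if j = 1 \<and> k = i then 1 else 0)"

lemma metric_nth:
  "metric p $ 1 $ 1 = (p$2)\<^sup>2" "metric p $ 1 $ 2 = 0" "metric p $ 1 $ 3 = 0" "metric p $ 1 $ 4 = 1"
  "metric p $ 2 $ 1 = 0" "metric p $ 2 $ 2 = 1" "metric p $ 2 $ 3 = 0" "metric p $ 2 $ 4 = 0"
  "metric p $ 3 $ 1 = 0" "metric p $ 3 $ 2 = 0" "metric p $ 3 $ 3 = 1" "metric p $ 3 $ 4 = 0"
  "metric p $ 4 $ 1 = 1" "metric p $ 4 $ 2 = 0" "metric p $ 4 $ 3 = 0" "metric p $ 4 $ 4 = 0"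
  by (simp_all add: metric_def vector_4_nth)

section \<open>Ricci flatness of the rescaled metric\<close>

text \<open>Together the assumptions say that the second derivative of \<open>\<phi>\<close> is
  \<open>\<phi> / 2\<close>. The only nonzero Ricci component of \<open>metric\<close> is -1 in
  position (1,1), and the rescaling adds twice the second derivative over \<open>\<phi>\<close>
  there; the constant 1/2 makes them cancel.\<close>

context
  fixes \<phi> \<psi> :: "real \<Rightarrow> real"
  assumes \<phi>: "\<And>t. (\<phi> has_real_derivative \<psi> t) (at t)"
    and \<psi>: "\<And>t. (\<psi> has_real_derivative \<phi> t / 2) (at t)"
begin

lemma has_derivative_first_coordinate:
  fixes p :: "real^4"
  assumes "(f has_real_derivative d) (at (p$1))"
  shows "((\<lambda>q :: real^4. f (q$1)) has_derivative (\<lambda>h. h$1 * d)) (at p)"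
  using has_derivative_compose[OF bounded_linear_imp_has_derivative[OF bounded_linear_vec_nth]
      assms[unfolded has_field_derivative_def]]
  by (simp add: mult.commute)

lemma partial_rescaled_metric:
  assumes "\<phi> (p$1) \<noteq> 0"
  shows "partial i (\<lambda>q. rescaled_metric \<phi> q $ j $ l) p
    = (if i = 1 then - 2 * \<psi> (p$1) / (\<phi> (p$1))^3 * metric p $ j $ l else 0)
      + (if i = 2 \<and> j = 1 \<and> l = 1 then 2 * p$2 / (\<phi> (p$1))\<^sup>2 else 0)"
proof -
  have "((\<lambda>t. 1 / (\<phi> t)\<^sup>2) has_real_derivative - 2 * \<psi> (p$1) / (\<phi> (p$1))^3) (at (p$1))"
    using assms \<phi>[of "p$1"]
    by (auto intro!: derivative_eq_intros simp: field_simps power2_eq_square power3_eq_cube)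
  from has_derivative_mult[OF has_derivative_first_coordinate[OF this] has_derivative_metric[of j l p]]
  have "((\<lambda>q. rescaled_metric \<phi> q $ j $ l) has_derivative
      (\<lambda>h. 1 / (\<phi> (p$1))\<^sup>2 * (if j = 1 \<and> l = 1 then 2 * p$2 * h$2 else 0)
        + h$1 * (- 2 * \<psi> (p$1) / (\<phi> (p$1))^3) * metric p $ j $ l)) (at p)"
    by (simp add: rescaled_metric_def)
  from frechet_derivative_at[OF this, symmetric] show ?thesis
    unfolding partial_def by (simp add: axis_def)
qed

lemma christoffel_rescaled_metric:
  assumes "\<phi> (p$1) \<noteq> 0"
  shows "christoffel (rescaled_metric \<phi>) k i j p
    = christoffel_const k i j * p$2 + \<psi> (p$1) / \<phi> (p$1) * christoffel_log p k i j"
proof -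
  note defs = christoffel_def matrix_inv_rescaled_metric[of \<phi> p, OF assms] partial_rescaled_metric[OF assms]
    sum_4 inverse_metric_def vector_4_nth christoffel_const_def christoffel_log_def metric_nth
  show ?thesis
    using exhaust_4[of k] exhaust_4[of i] exhaust_4[of j] assms
    by (elim disjE; simp add: defs; simp add: field_simps power2_eq_square power3_eq_cube)
qed

text \<open>The closed formula for the Christoffel symbols holds only on this set; openness allows
  it to be differentiated.\<close>

lemma open_nonzero_first_coordinate: "open {p :: real^4. \<phi> (p$1) \<noteq> 0}"
proof -
  have "continuous_on UNIV \<phi>"
    using \<phi> by (intro continuous_at_imp_continuous_on ballI) (blast intro: DERIV_isCont)
  then have "continuous_on UNIV (\<lambda>p :: real^4. \<phi> (p$1))"
    by (rule continuous_on_compose2[OF _ linear_continuous_on[OF bounded_linear_vec_nth] subset_UNIV])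
  then show ?thesis by (rule open_Collect_neq[OF _ continuous_on_const])
qed

lemma partial_christoffel_rescaled_metric:
  assumes "\<phi> (p$1) \<noteq> 0"
  shows "partial n (christoffel (rescaled_metric \<phi>) k i j) p
    = (if n = 1 then (1 / 2 - (\<psi> (p$1) / \<phi> (p$1))\<^sup>2) * christoffel_log p k i j else 0)
      + (if n = 2 then christoffel_const k i j
          + \<psi> (p$1) / \<phi> (p$1) * (if k = 4 \<and> i = 1 \<and> j = 1 then 2 * p$2 else 0) else 0)"
proof -
  let ?f = "\<lambda>q. christoffel_const k i j * q$2 + \<psi> (q$1) / \<phi> (q$1) * christoffel_log q k i j"
  \<comment> \<open>The summand 1/2 is the derivative of \<open>\<psi>\<close> divided by
    \<open>\<phi>\<close>.\<close>
  have "((\<lambda>t. \<psi> t / \<phi> t) has_real_derivative 1 / 2 - (\<psi> (p$1) / \<phi> (p$1))\<^sup>2) (at (p$1))"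
    using assms \<phi>[of "p$1"] \<psi>[of "p$1"]
    by (auto intro!: derivative_eq_intros simp: field_simps power2_eq_square)
  note 1 = has_derivative_first_coordinate[OF this]
  have 2: "((\<lambda>q. christoffel_log q k i j) has_derivative
      (\<lambda>h. if k = 4 \<and> i = 1 \<and> j = 1 then 2 * p$2 * h$2 else 0)) (at p)"
  proof (cases "k = 4")
    case True
    have "((\<lambda>q. metric q $ i $ j - c - d) has_derivative
        (\<lambda>h. (if i = 1 \<and> j = 1 then 2 * p$2 * h$2 else 0) - 0 - 0)) (at p)" for c d
      by (intro has_derivative_diff has_derivative_metric has_derivative_const)
    then show ?thesis using True unfolding christoffel_log_def by simp
  next
    case False
    then show ?thesis unfolding christoffel_log_def by simp
  qed
  have "(?f has_derivative (\<lambda>h. christoffel_const k i j * h$2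
      + (\<psi> (p$1) / \<phi> (p$1) * (if k = 4 \<and> i = 1 \<and> j = 1 then 2 * p$2 * h$2 else 0)
        + h$1 * (1 / 2 - (\<psi> (p$1) / \<phi> (p$1))\<^sup>2) * christoffel_log p k i j))) (at p)"
    by (intro has_derivative_add has_derivative_mult[OF 1 2] has_derivative_mult_right
        bounded_linear_imp_has_derivative[OF bounded_linear_vec_nth])
  moreover have "frechet_derivative (christoffel (rescaled_metric \<phi>) k i j) (at p) = frechet_derivative ?f (at p)"
    by (rule frechet_derivative_cong_open[OF open_nonzero_first_coordinate])
      (simp_all add: assms christoffel_rescaled_metric)
  ultimately show ?thesis
    unfolding partial_def by (simp add: frechet_derivative_at[symmetric] axis_def)
qed

lemma ricci_rescaled_metric:
  assumes "\<phi> (p$1) \<noteq> 0"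
  shows "ricci (rescaled_metric \<phi>) p = 0"
proof -
  note defs = sum_4 christoffel_const_def christoffel_log_def metric_nth
  have "ricci (rescaled_metric \<phi>) p $ i $ j = 0" for i j
    unfolding ricci_def vec_lambda_beta
      partial_christoffel_rescaled_metric[OF assms] christoffel_rescaled_metric[OF assms]
    using exhaust_4[of i] exhaust_4[of j]
    by (elim disjE; simp add: defs; simp add: power2_eq_square algebra_simps)
  then show ?thesis by (simp add: vec_eq_iff)
qed

text \<open>\<open>f\<close> is a function of the first coordinate on \<open>U\<close> only. The
  agreement is carried over in two stages, Christoffel symbols before Ricci tensor, because the
  latter differentiates the former.\<close>

lemma einstein_on_rescaled_metric:
  assumes U: "open U" and f: "\<And>p. p \<in> U \<Longrightarrow> f p = \<phi> (p$1)"
  shows "einstein_on {p\<in>U. f p \<noteq> 0} (\<lambda>p. (1 / (f p)\<^sup>2) *\<^sub>R metric p)"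
proof -
  let ?h = "\<lambda>p. (1 / (f p)\<^sup>2) *\<^sub>R metric p"
  have h: "?h p = rescaled_metric \<phi> p" if "p \<in> U" for p
    unfolding rescaled_metric_def f[OF that] ..
  have chr: "christoffel ?h k i j p = christoffel (rescaled_metric \<phi>) k i j p" if "p \<in> U" for k i j p
  proof -
    have "frechet_derivative (\<lambda>q. ?h q $ j $ l) (at p) = frechet_derivative (\<lambda>q. rescaled_metric \<phi> q $ j $ l) (at p)" for j l
      by (rule frechet_derivative_cong_open[OF U that]) (simp only: h)
    then show ?thesis unfolding christoffel_def partial_def h[OF that] by (simp only:)
  qed
  have "ricci ?h p = ricci (rescaled_metric \<phi>) p" if "p \<in> U" for p
  proof -
    have "frechet_derivative (christoffel ?h k i j) (at p) = frechet_derivative (christoffel (rescaled_metric \<phi>) k i j) (at p)" for k i j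
      by (rule frechet_derivative_cong_open[OF U that]) (rule chr)
    then show ?thesis unfolding ricci_def partial_def chr[OF that] by (simp only:)
  qed
  then have "ricci ?h p = 0 *\<^sub>R ?h p" if "p \<in> {p\<in>U. f p \<noteq> 0}" for p
    using that ricci_rescaled_metric[of p] f[of p] by simp
  then show ?thesis unfolding einstein_on_def by blast
qed

end

section \<open>The standard representation and its flow\<close>

lemma so24_rep_std_rep: "so24_rep UNIV std_rep"
  unfolding so24_rep_def std_rep_def commutator_def
  by (simp add: vec_eq_iff forall_6 matrix_vector_mult_def matrix_matrix_mult_def sum_6 algebra_simps)

interpretation std: so24_module UNIV std_rep
  using so24_rep_std_rep by unfold_locales

definition tail_vec :: "real^2 \<Rightarrow> real^6" where
  "tail_vec v = vector [0, 0, 0, 0, v$1, v$2]"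

lemma linear_tail_vec: "linear tail_vec"
  by (rule linearI) (simp_all add: tail_vec_def matrix6_simps)

lemma neg_null_std_rep: "neg_null UNIV std_rep = range tail_vec"
proof (intro equalityI subsetI)
  fix v :: "real^6" assume "v \<in> neg_null UNIV std_rep"
  then have *: "std_rep (g_neg p q r s w) v $ i = 0" for p q r s w i by (simp add: neg_null_def)
  have "v$1 = 0" "v$2 = 0" "v$3 = 0" "v$4 = 0"
    using *[of 1 0 0 0 0 3] *[of 0 0 0 0 1 6] *[of 0 0 1 0 0 5] *[of 0 0 0 1 0 5]
    by (simp_all add: std_rep_def matrix_vector_mult_def sum_6 g_neg_def vector_6_nth)
  then have "v = tail_vec (vector [v$5, v$6])" by (simp add: tail_vec_def matrix6_simps)
  then show "v \<in> range tail_vec" by blast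
qed (auto simp: neg_null_def std_rep_def tail_vec_def matrix_vector_mult_def sum_6 g_neg_def matrix6_simps)

lemma Phi_std_rep: "Phi std_rep X (tail_vec v) = tail_vec (branch_matrix X *v v)"
  by (simp add: Phi_def std_rep_def tail_vec_def alpha_def branch_matrix_def matrix_vector_mult_def
      sum_6 sum_2 matrix6_simps)

lemma std_eigenspace: "std.eigenspace grading_elt (- 1) = range (\<lambda>r. r *\<^sub>R axis 6 1)"
proof (intro equalityI subsetI)
  fix v assume "v \<in> std.eigenspace grading_elt (- 1)"
  then have "v = v$6 *\<^sub>R axis 6 1"
    by (simp add: std.eigenspace_def std_rep_def grading_elt_eq_g_zero g_zero_def matrix_vector_mult_def
        sum_6 matrix6_simps axis_def)
  then show "v \<in> range (\<lambda>r. r *\<^sub>R axis 6 1)" by blast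
qed (auto simp: std.eigenspace_def std_rep_def grading_elt_eq_g_zero g_zero_def matrix_vector_mult_def
    sum_6 matrix6_simps axis_def)

lemma std_split:
  fixes v :: "real^6"
  shows "v = v$6 *\<^sub>R axis 6 1 + (vector [0, v$2, v$3, v$4, v$5, 0] + v$1 *\<^sub>R axis 1 1)"
    "std_rep grading_elt (v$6 *\<^sub>R axis 6 1) = (- 1) *\<^sub>R (v$6 *\<^sub>R axis 6 1)"
    "std_rep grading_elt (vector [0, v$2, v$3, v$4, v$5, 0]) = 0 *\<^sub>R vector [0, v$2, v$3, v$4, v$5, 0]"
    "std_rep grading_elt (v$1 *\<^sub>R axis 1 1) = 1 *\<^sub>R (v$1 *\<^sub>R axis 1 1)"
  by (simp_all add: std_rep_def grading_elt_eq_g_zero g_zero_def matrix_vector_mult_def sum_6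
      matrix6_simps axis_def)

lemma std_from_on: "UNIV \<subseteq> std.from_on grading_elt (- 1)"
proof
  fix v :: "real^6"
  show "v \<in> std.from_on grading_elt (- 1)"
    using std.from_onI[OF UNIV_I std_split(2)] std.from_onI[OF UNIV_I std_split(3)]
      std.from_onI[OF UNIV_I std_split(4)]
    unfolding std.from_on_def by (subst std_split(1)) (intro span_add; simp)
qed

lemma axis_6_std_eigenspace:
  "axis 6 1 \<in> std.eigenspace grading_elt (- 1)" "axis 6 1 \<noteq> (0 :: real^6)"
  unfolding std_eigenspace by (auto simp: axis_eq_0_iff intro: range_eqI[of _ _ 1])

lemma lowest_proj_std_rep: "lowest_proj UNIV std_rep v = v$6 *\<^sub>R axis 6 1"
proof (rule std.lowest_proj_eq[OF std_from_on axis_6_std_eigenspace])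
  show "v$6 *\<^sub>R axis 6 1 \<in> std.eigenspace grading_elt (- 1)" unfolding std_eigenspace by blast
  have "vector [0, v$2, v$3, v$4, v$5, 0] + v$1 *\<^sub>R axis 1 1 \<in> std.above grading_elt (- 1)"
    using std.aboveI[OF UNIV_I std_split(3)] std.aboveI[OF UNIV_I std_split(4)]
    unfolding std.above_def by (intro span_add; simp)
  moreover have "v - v$6 *\<^sub>R axis 6 1 = vector [0, v$2, v$3, v$4, v$5, 0] + v$1 *\<^sub>R axis 1 1"
    using std_split(1)[of v] by (simp add: algebra_simps)
  ultimately show "v - v$6 *\<^sub>R axis 6 1 \<in> std.above grading_elt (- 1)" by simp
qed

text \<open>Transports the flow from the annihilator in \<open>real^6\<close> to the plane of its
  last two coordinates.\<close>

lemma exp_op_intertwine: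
  fixes A :: "'a::euclidean_space \<Rightarrow> 'a" and L :: "'a \<Rightarrow> 'b::euclidean_space"
  assumes A: "linear A" and L: "linear L" and BL: "\<And>u. B (L u) = L (A u)"
  shows "exp_op B (L v) = L (exp_op A v)"
proof -
  have "bounded_linear L" using L by (simp add: linear_conv_bounded_linear)
  have "(B ^^ n) (L v) = L ((A ^^ n) v)" for n by (induction n) (simp_all add: BL)
  then have "(B ^^ n) (L v) /\<^sub>R fact n = L ((A ^^ n) v /\<^sub>R fact n)" for n
    by (simp add: linear_scale[OF L])
  then show ?thesis
    unfolding exp_op_def
    by (subst bounded_linear.suminf[OF \<open>bounded_linear L\<close> summable_exp_op[OF A]]) (rule suminf_cong)
qed

text \<open>Minus \<open>branch_matrix X\<close> for \<open>X$1 = 1\<close>, the generator of the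
  flow in that plane.\<close>

definition oscillator :: "real^2 \<Rightarrow> real^2" where
  "oscillator u = vector [u$2 / 2, u$1]"

lemma linear_oscillator: "linear oscillator"
  by (rule linearI) (simp_all add: oscillator_def vec_eq_iff forall_2 field_simps)

lemma branch_matrix_oscillator: "- (branch_matrix Y *v u) = Y$1 *\<^sub>R oscillator u"
  by (simp add: branch_matrix_def oscillator_def matrix_vector_mult_def sum_2 vec_eq_iff forall_2)

lemma axial_flow_std_rep:
  "axial_flow std_rep t (tail_vec v) = tail_vec (exp_op (\<lambda>u. t *\<^sub>R oscillator u) v)"
  unfolding axial_flow_def
proof (rule exp_op_intertwine[OF linear_compose_scale_right[OF linear_oscillator] linear_tail_vec])
  show "- (t *\<^sub>R std_rep (g_zero 0 0 0 1 (1 / 2)) (tail_vec u)) = tail_vec (t *\<^sub>R oscillator u)" for u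
    by (simp add: std_rep_def tail_vec_def oscillator_def g_zero_def matrix_vector_mult_def sum_6 matrix6_simps)
qed

text \<open>Exactly the pair of equations under which the rescaled metric is Ricci flat, with the
  second component as \<open>\<phi>\<close> and the first as \<open>\<psi>\<close>.\<close>

lemma oscillator_flow_derivatives:
  defines "F v \<equiv> \<lambda>t. exp_op (\<lambda>u. t *\<^sub>R oscillator u) v"
  shows "((\<lambda>t. F v t $ 2) has_real_derivative F v t $ 1) (at t)"
    "((\<lambda>t. F v t $ 1) has_real_derivative F v t $ 2 / 2) (at t)"
proof -
  have "((\<lambda>t. F v t) has_vector_derivative oscillator (F v t)) (at t)"
    unfolding F_def exp_op_commute[OF linear_oscillator]
    by (rule has_vector_derivative_exp_op[OF linear_oscillator])
  from bounded_linear.has_vector_derivative[OF bounded_linear_vec_nth[of 2] this]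
    bounded_linear.has_vector_derivative[OF bounded_linear_vec_nth[of 1] this]
  show "((\<lambda>t. F v t $ 2) has_real_derivative F v t $ 1) (at t)"
    "((\<lambda>t. F v t $ 1) has_real_derivative F v t $ 2 / 2) (at t)"
    unfolding has_real_derivative_iff_has_vector_derivative by (simp_all add: oscillator_def)
qed

text \<open>Value and derivative of the second component at 0 are the two entries of the initial
  vector.\<close>

lemma oscillator_flow_inj:
  assumes e: "0 < e"
    and eq: "\<And>t. \<bar>t\<bar> < e \<Longrightarrow> exp_op (\<lambda>u. t *\<^sub>R oscillator u) v $ 2 = exp_op (\<lambda>u. t *\<^sub>R oscillator u) w $ 2"
  shows "v = w"
proof -
  let ?F = "\<lambda>v t. exp_op (\<lambda>u. t *\<^sub>R oscillator u) v"
  have F0: "?F v 0 = v" for v by (simp add: exp_op_zero)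
  have "((\<lambda>t. ?F v t $ 2) has_real_derivative ?F w 0 $ 1) (at 0)"
  proof (rule has_field_derivative_transform_within_open[where S = "{- e<..<e}"])
    show "((\<lambda>t. ?F w t $ 2) has_real_derivative ?F w 0 $ 1) (at 0)"
      by (rule oscillator_flow_derivatives(1))
    show "?F w t $ 2 = ?F v t $ 2" if "t \<in> {- e<..<e}" for t using eq that by auto
  qed (use e in auto)
  then have "?F v 0 $ 1 = ?F w 0 $ 1"
    using oscillator_flow_derivatives(1)[of v 0] DERIV_unique by blast
  moreover have "?F v 0 $ 2 = ?F w 0 $ 2" using eq[of 0] e by simp
  ultimately show ?thesis unfolding F0 by (simp add: vec_eq_iff forall_2)
qed

lemma Einstein_scales:
  assumes U: "neighbourhood U"
  shows "normal_solution UNIV std_rep U (\<lambda>p. f p *\<^sub>R axis 6 1) \<longleftrightarrow>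
      (\<exists>!v. \<forall>Y p. k_exp Y p \<and> p \<in> U \<longrightarrow> f p = exp_op (\<lambda>u. - (branch_matrix Y *v u)) v $ 2)"
    "normal_solution UNIV std_rep U (\<lambda>p. f p *\<^sub>R axis 6 1) \<Longrightarrow> almost_einstein_scale U f"
proof -
  have U': "open U" "0 \<in> U" using U unfolding neighbourhood_def by auto
  then obtain e where e: "0 < e" "ball 0 e \<subseteq> U" by (meson openE)
  let ?F = "\<lambda>v t. exp_op (\<lambda>u. t *\<^sub>R oscillator u) v"
  have axis: "f p *\<^sub>R axis 6 1 = r *\<^sub>R (axis 6 1 :: real^6) \<longleftrightarrow> f p = r" for p r
    by (simp add: axis_eq_0_iff)
  have sol: "normal_solution UNIV std_rep U (\<lambda>p. f p *\<^sub>R axis 6 1) \<longleftrightarrow>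
      (\<exists>v. \<forall>p\<in>U. f p = ?F v (p$1) $ 2)"
    unfolding std.normal_solution_iff[OF U] neg_null_std_rep lowest_proj_std_rep
    by (simp add: axial_flow_std_rep axis) (simp add: tail_vec_def vector_6_nth)
  have v_eq: "v = w" if "\<forall>p\<in>U. f p = ?F v (p$1) $ 2" "\<forall>p\<in>U. f p = ?F w (p$1) $ 2" for v w
  proof (rule oscillator_flow_inj[OF e(1)])
    fix t :: real assume t: "\<bar>t\<bar> < e"
    have "axis 1 t = t *\<^sub>R (axis 1 1 :: real^4)" by (simp add: vec_eq_iff axis_def)
    then have "axis 1 t \<in> U" using t e(2) by (auto simp: subset_eq)
    from bspec[OF that(1) this] bspec[OF that(2) this]
    show "?F v t $ 2 = ?F w t $ 2" by (simp only: axis_nth)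
  qed
  have "(\<forall>Y p. k_exp Y p \<and> p \<in> U \<longrightarrow> f p = exp_op (\<lambda>u. - (branch_matrix Y *v u)) v $ 2) \<longleftrightarrow>
      (\<forall>p\<in>U. f p = ?F v (p$1) $ 2)" for v
  proof -
    have eq: "exp_op (\<lambda>u. - (branch_matrix Y *v u)) v = ?F v (p$1)" if "k_exp Y p" for Y p
      unfolding branch_matrix_oscillator k_exp_first_coordinate[OF that] ..
    show ?thesis
    proof (intro iffI ballI allI impI)
      fix p assume *: "\<forall>Y p. k_exp Y p \<and> p \<in> U \<longrightarrow> f p = exp_op (\<lambda>u. - (branch_matrix Y *v u)) v $ 2"
        and p: "p \<in> U"
      obtain Y where Y: "k_exp Y p" using k_exp_surj by blast
      then have "f p = exp_op (\<lambda>u. - (branch_matrix Y *v u)) v $ 2" using * p by blast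
      then show "f p = ?F v (p$1) $ 2" unfolding eq[OF Y] .
    next
      fix Y p assume *: "\<forall>p\<in>U. f p = ?F v (p$1) $ 2" and Yp: "k_exp Y p \<and> p \<in> U"
      then have "f p = ?F v (p$1) $ 2" by blast
      then show "f p = exp_op (\<lambda>u. - (branch_matrix Y *v u)) v $ 2"
        unfolding eq[OF conjunct1[OF Yp]] .
    qed
  qed
  then show "normal_solution UNIV std_rep U (\<lambda>p. f p *\<^sub>R axis 6 1) \<longleftrightarrow>
      (\<exists>!v. \<forall>Y p. k_exp Y p \<and> p \<in> U \<longrightarrow> f p = exp_op (\<lambda>u. - (branch_matrix Y *v u)) v $ 2)"
    unfolding sol using v_eq by blast
  assume "normal_solution UNIV std_rep U (\<lambda>p. f p *\<^sub>R axis 6 1)"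
  then obtain v where v: "\<And>p. p \<in> U \<Longrightarrow> f p = ?F v (p$1) $ 2" unfolding sol by blast
  have "smooth_on U f \<longleftrightarrow> smooth_on U (\<lambda>p. ?F v (p$1) $ 2)"
    by (rule smooth_on_cong[OF U'(1) v])
  moreover have "smooth_on U (\<lambda>p. ?F v (p$1) $ 2)"
    by (rule smooth_on_exp_op_coordinate[OF linear_oscillator bounded_linear_vec_nth])
  moreover have "einstein_on {p\<in>U. f p \<noteq> 0} (\<lambda>p. (1 / (f p)\<^sup>2) *\<^sub>R metric p)"
    by (rule einstein_on_rescaled_metric[OF oscillator_flow_derivatives U'(1)]) (rule v)
  ultimately show "almost_einstein_scale U f" unfolding almost_einstein_scale_def by blast
qed

theorem proposition4p2:
  fixes V :: "'v::euclidean_space set" and \<rho> :: "real^6^6 \<Rightarrow> 'v \<Rightarrow> 'v" and J :: "'v \<Rightarrow> 'v"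
    and w1 w2 w3 :: nat
  shows
    "(w2 = w3 \<and> real_irrep V \<rho> (weight_comb w1 w2 w3) \<longrightarrow>
       k_rep (normal_values V \<rho>) (Phi \<rho>) \<and>
       parametrises_normal_solutions V \<rho> (normal_values V \<rho>) \<and>
       (\<exists>T. linear_iso_sym scaleR (normal_values V \<rho>) w1 T \<and>
          (\<forall>v\<in>normal_values V \<rho>. \<forall>B. trace B = 0 \<longrightarrow>
             \<rho> (block_diagonal B 0) v \<in> normal_values V \<rho> \<and>
             T (\<rho> (block_diagonal B 0) v) = sym_action B (T v)) \<and>
          (\<forall>v\<in>normal_values V \<rho>. \<forall>X. T (Phi \<rho> X v) = sym_action (branch_matrix X) (T v))) \<and>
       (\<exists>v. lowest_weight_vector (V \<times> V) complexify_J (complexify_rep \<rho>) (v, 0)) \<and>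
       (\<forall>v. lowest_weight_vector (V \<times> V) complexify_J (complexify_rep \<rho>) (v, 0) \<longrightarrow>
          normal_values V \<rho> = submodule_generated sl2_so2 \<rho> v)) \<and>
     (w2 \<noteq> w3 \<and> complex_irrep V J \<rho> (weight_comb w1 w2 w3) \<longrightarrow>
       k_rep (normal_values V \<rho>) (Phi \<rho>) \<and>
       parametrises_normal_solutions V \<rho> (normal_values V \<rho>) \<and>
       (\<exists>T. linear_iso_sym (scaleC J) (normal_values V \<rho>) w1 T \<and>
          (\<forall>v\<in>normal_values V \<rho>. \<forall>B. trace B = 0 \<longrightarrow>
             \<rho> (block_diagonal B 0) v \<in> normal_values V \<rho> \<and>
             T (\<rho> (block_diagonal B 0) v) = sym_action (complexify_matrix B) (T v)) \<and>
          (\<forall>v\<in>normal_values V \<rho>. \<forall>X.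
             T (Phi \<rho> X v) = sym_action (complexify_matrix (branch_matrix X)) (T v))) \<and>
       (\<exists>v. lowest_weight_vector V J \<rho> v) \<and>
       (\<forall>v. lowest_weight_vector V J \<rho> v \<longrightarrow>
          normal_values V \<rho> = submodule_generated sl2_so2 \<rho> v)) \<and>
     (\<comment> \<open>(Es)\<close>
      \<exists>emb :: real^2 \<Rightarrow> real^6. emb = (\<lambda>v. vector [0, 0, 0, 0, v$1, v$2]) \<and>
       normal_values UNIV std_rep = range emb \<and>
       (\<forall>X v. Phi std_rep X (emb v) = emb (branch_matrix X *v v)) \<and>
       (\<forall>v. lowest_proj UNIV std_rep (emb v) = v$2 *\<^sub>R axis 6 1) \<and>
       (\<forall>U f. neighbourhood U \<longrightarrow>
          (normal_solution UNIV std_rep U (\<lambda>p. f p *\<^sub>R axis 6 1) \<longleftrightarrow>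
            (\<exists>!v. \<forall>Y p. k_exp Y p \<and> p \<in> U \<longrightarrow>
               f p = exp_op (\<lambda>u. - (branch_matrix Y *v u)) v $ 2)) \<and>
          (normal_solution UNIV std_rep U (\<lambda>p. f p *\<^sub>R axis 6 1) \<longrightarrow>
            almost_einstein_scale U f))) \<and>
     (\<comment> \<open>(ts)\<close>
      lowest_eigenspace UNIV spin_rep = {\<psi>. \<psi>$1 = 0 \<and> \<psi>$2 = 0} \<and>
      (\<exists>\<Lambda>. weight_vector UNIV (\<lambda>\<psi>. \<i> *s \<psi>) spin_rep \<Lambda> (axis 3 1)) \<and>
      lowest_weight_vector UNIV (\<lambda>\<psi>. \<i> *s \<psi>) spin_rep (axis 4 1) \<and>
      (\<forall>U \<sigma>. neighbourhood U \<longrightarrow>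
         (normal_solution UNIV spin_rep U \<sigma> \<longleftrightarrow>
           (\<exists>!v :: real^2. \<forall>p\<in>U. \<sigma> p = vector [0, 0, 0, Complex (v$1) (v$2)])))) \<and>
     (\<comment> \<open>(cKf)\<close>
      \<exists>W :: real \<Rightarrow> real^6^6.
       W = (\<lambda>w. \<chi> i j. if i = 5 \<and> j = 1 then w else if i = 6 \<and> j = 2 then - w else 0) \<and>
       (\<forall>w. W w \<in> so24) \<and>
       (\<forall>U s. neighbourhood U \<longrightarrow>
          (parallel_section so24 commutator U s \<longleftrightarrow> (\<exists>!w. \<forall>p\<in>U. s p = W w)) \<and>
          (normal_solution so24 commutator U s \<longleftrightarrow> (\<exists>!w. \<forall>p\<in>U. s p = W w)) \<and>
          (normal_solution so24 commutator U s \<longrightarrow>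
            conformal_killing_on U (\<lambda>p. tangent_of (s p) p))))"
proof (intro conjI impI, goal_cases)
  \<comment> \<open>Five goals each belong to the real and to the complex case, then one to the
    Einstein scales, four to the twistor spinors and one to the Killing fields.\<close>
  case 1 then show ?case by (rule real_irrep_normal_values)
next
  case 2 then show ?case by (rule real_irrep_normal_values)
next
  case 3 then show ?case by (rule real_irrep_normal_values)
next
  case 4 then show ?case by (rule real_irrep_normal_values)
next
  case 5 then show ?case by (rule real_irrep_normal_values)
next
  case 6 then show ?case by (rule complex_irrep_normal_values)
next
  case 7 then show ?case by (rule complex_irrep_normal_values)
next
  case 8 then show ?case by (rule complex_irrep_normal_values)
next
  case 9 then show ?case by (rule complex_irrep_normal_values)
next
  case 10 then show ?case by (rule complex_irrep_normal_values)
next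
  case 11
  show ?case
  proof (intro exI[of _ tail_vec] conjI allI impI)
    show "tail_vec = (\<lambda>v. vector [0, 0, 0, 0, v$1, v$2])" by (simp add: fun_eq_iff tail_vec_def)
    show "normal_values UNIV std_rep = range tail_vec"
      by (simp only: std.normal_values_eq_neg_null neg_null_std_rep)
    show "lowest_proj UNIV std_rep (tail_vec v) = v$2 *\<^sub>R axis 6 1" for v
      by (simp add: lowest_proj_std_rep tail_vec_def vector_6_nth)
  qed (rule Phi_std_rep Einstein_scales; assumption)+
next
  case 12 show ?case by (rule twistor_spinors)
next
  case 13 show ?case by (rule twistor_spinors)
next
  case 14 show ?case by (rule twistor_spinors)
next
  case 15 show ?case by (intro allI impI twistor_spinors)
next
  case 16 show ?case
    unfolding g_neg_bottom_eq
    by (intro exI[of _ "g_neg 0 0 0 0"] conjI allI impI refl g_in_so24 normal_conformal_Killing_fields)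
qed

end
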